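(* Let $K$ be a field, $\Lambda$ a $k$-graph, $C$ a connected component of $\mathbf{RG}(\Lambda)$ and $y\in\Gamma_C^{\mathrm{ob}}$. Then the $\mathrm{KP}(\Lambda)$-module $V_{(\Omega_C,\zeta_C)}$ is indecomposable if and only if the group algebra $KG$ has no nontrivial idempotents, where $G=\pi(\Gamma_C,y)$.
   Context: **$k$-graphs.** $\mathbb N=\{0,1,2,\dots\}$; for a positive integer $k$ the additive monoid $\mathbb N^k$ is viewed as a category with one object. A $k$-graph is a small category $\Lambda$ (the symbol $\Lambda$ also denotes its set of morphisms, $\Lambda^{\mathrm{ob}}$ its set of objects or vertices, $r,s$ the range and source maps) together with a functor $d:\Lambda\to\mathbb N^k$ (degree map) such that: if $d(\lambda)=m+n$ with $m,n\in\mathbb N^k$, there are unique $\mu,\nu\in\Lambda$ with $d(\mu)=m$, $d(\nu)=n$, $\lambda=\mu\circ\nu$. For $u,v\in\Lambda^{\mathrm{ob}}$, $n\in\mathbb N^k$: $u\Lambda=r^{-1}(u)$, $\Lambda v=s^{-1}(v)$, $u\Lambda v=u\Lambda\cap\Lambda v$, $u\Lambda^n=u\Lambda\cap d^{-1}(n)$. A morphism of $k$-graphs is a degree-preserving functor. Standing assumption: all $k$-graphs are nonempty ($\Lambda^{\mathrm{ob}}\ne\emptyset$), connected (the equivalence relation on $\Lambda^{\mathrm{ob}}$ generated by $\{(u,v): u\Lambda v\neq\emptyset\}$ is all of $\Lambda^{\mathrm{ob}}\times\Lambda^{\mathrm{ob}}$), row-finite (each $v\Lambda^n$ is finite) and without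 sources (each $v\Lambda^n$ is nonempty). **Walks and fundamental group.** Let $E_d$ be the directed graph with vertex set $\Lambda^{\mathrm{ob}}$, with one edge from $s(\lambda)$ to $r(\lambda)$ for each morphism $\lambda$ (identities included) and, for each non-identity $\lambda$, an extra edge $\lambda^*$ from $r(\lambda)$ to $s(\lambda)$. A walk in $\Lambda$ is a nonempty finite path $p=e_n\cdots e_1$ in $E_d$ ($s(e_i)=r(e_{i-1})$), with $s(p)=s(e_1)$, $r(p)=r(e_n)$. $\mathrm{Walk}_u(\Lambda)$ denotes the set of walks starting in $u$. A $k$-graph morphism $\alpha$ induces a map on walks (with $\lambda^*\mapsto\alpha(\lambda)^*$), again denoted $\alpha$. The fundamental groupoid $\mathcal G(\Lambda)$ has objects $\Lambda^{\mathrm{ob}}$ and morphisms the classes $[p]$ of walks modulo the equivalence relation generated by replacing, inside a walk, a subpath by another according to $\lambda\lambda^*\leftrightarrow 1_{r(\lambda)}$, $\lambda^*\lambda\leftrightarrow 1_{s(\lambda)}$, $(\lambda\circ\mu)\leftrightarrow\lambda\mu$ (for $s(\lambda)=r(\mu)$), with composition induced by concatenation. The fundamental group of $\Lambda$ at $x$ is $\pi(\Lambda,x)=x\mathcal G(\Lambda)x$. **Representation $k$-graphs.** A representation $k$-graph for $\Lambda$ is a pair $(\Delta,\alpha)$ of a $k$-graph $\Delta$ and a $k$-graph morphism $\alpha:\Delta\to\Lambda$ such that for every $v\in\Delta^{\mathrm{ob}}$: (i) $\alpha$ maps $\Delta v$ bijectively onto $\Lambda\alpha(v)$; (ii) $v\Delta^n$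 is a singleton for every $n\in\mathbb N^k$. A morphism $(\Delta,\alpha)\to(\Sigma,\beta)$ is a $k$-graph morphism $\phi:\Delta\to\Sigma$ with $\beta\circ\phi=\alpha$. This gives the category $\mathbf{RG}(\Lambda)$. The connected components of a category are the full subcategories on the classes of objects for the equivalence relation generated by existence of a morphism. **The quotient by $\sim$.** For $(\Delta,\alpha)$ in $\mathbf{RG}(\Lambda)$ write $u\sim v$ (for $u,v\in\Delta^{\mathrm{ob}}$) if $\alpha(\mathrm{Walk}_u(\Delta))=\alpha(\mathrm{Walk}_v(\Delta))$. Put $\delta\sim\delta'$ for morphisms of $\Delta$ if $s(\delta)\sim s(\delta')$ and $\alpha(\delta)=\alpha(\delta')$. The quotient $(\Delta_\sim,\alpha_\sim)$ is the representation $k$-graph with objects $\Delta^{\mathrm{ob}}/{\sim}$, morphisms $\Delta/{\sim}$, $s([\delta])=[s(\delta)]$, $r([\delta])=[r(\delta)]$, $d([\delta])=d(\delta)$, $1_{[v]}=[1_v]$, composition $[\delta]\circ[\delta']=[\delta''\circ\delta']$ where $\delta''\in\Delta r(\delta')$ satisfies $\alpha(\delta'')=\alpha(\delta)$, and $\alpha_\sim([v])=\alpha(v)$, $\alpha_\sim([\delta])=\alpha(\delta)$. **Coverings.** A covering of a $k$-graph $\Delta$ is a pair $(\Omega,\tau)$ of a $k$-graph $\Omega$ and a $k$-graph morphism $\tau:\Omega\to\Delta$ such that for every $v\in\Omega^{\mathrm{ob}}$, $\tau$ maps $\Omega v$ bijectively onto $\Delta\tau(v)$ and $v\Omega$ bijectively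 onto $\tau(v)\Delta$. A morphism of coverings $(\Omega,\tau)\to(\Sigma,\beta)$ is a $k$-graph morphism $\phi:\Omega\to\Sigma$ with $\beta\circ\phi=\tau$. A covering is universal if it admits a morphism to every covering; every $k$-graph has a universal covering. **The objects $(\Omega_C,\zeta_C)$ and $(\Gamma_C,\xi_C)$.** Choose an object $(\Delta,\alpha)$ of $C$ and a universal covering $(\Omega,\tau)$ of $\Delta$; set $(\Omega_C,\zeta_C):=(\Omega,\alpha\circ\tau)$, which is an object of $C$, and $(\Gamma_C,\xi_C):=((\Omega_C)_\sim,(\zeta_C)_\sim)$. **Kumjian-Pask algebra.** $K$-algebras are associative, not necessarily commutative or unital. For $\lambda\in\Lambda$ of nonzero degree let $\lambda^*$ be a new symbol; for $\lambda$ of degree $0$ put $\lambda^*:=\lambda$. $\mathrm{KP}(\Lambda)$ is the $K$-algebra presented by generators $\Lambda\cup\Lambda^*$ and relations: (KP1) $\lambda\mu=\delta_{s(\lambda),r(\mu)}(\lambda\circ\mu)$ for $\lambda,\mu\in\Lambda$; (KP2) $\mu^*\lambda^*=\delta_{s(\lambda),r(\mu)}(\lambda\circ\mu)^*$ for $\lambda,\mu\in\Lambda$; (KP3) $\lambda^*\mu=\delta_{\lambda,\mu}1_{s(\lambda)}$ for $\lambda,\mu\in\Lambda$ with $d(\lambda)=d(\mu)$; (KP4) $\sum_{\lambda\in v\Lambda^n}\lambda\lambda^*=1_v$ for $v\in\Lambda^{\mathrm{ob}}$, $n\in\mathbb N^k$. **The module $V_{(\Delta,\alpha)}$.** It is the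 $K$-vector space with basis $\Delta^{\mathrm{ob}}$, with the left $\mathrm{KP}(\Lambda)$-action determined, for $\lambda\in\Lambda$ and $v\in\Delta^{\mathrm{ob}}$, by: $\lambda.v=r(\delta)$ if there is a (necessarily unique) $\delta\in\Delta v$ with $\alpha(\delta)=\lambda$, and $\lambda.v=0$ otherwise; $\lambda^*.v=s(\delta)$ if there is a (necessarily unique) $\delta\in v\Delta$ with $\alpha(\delta)=\lambda$, and $\lambda^*.v=0$ otherwise. A module is indecomposable if it is nonzero and is not a direct sum of two nonzero submodules. An idempotent is nontrivial if it is different from $0$ and $1$. *)

theory Defs
  imports
    "HOL-Analysis.Finite_Cartesian_Product"
    "HOL-Library.Poly_Mapping"
    "HOL-Algebra.Ring"
begin

section \<open>Higher-rank graphs\<close>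

text \<open>
  The rank of a graph is the cardinality of the finite index type \<open>'k\<close>, so it is automatically
  positive. The operations of the record are meaningful only on \<open>objs\<close> and \<open>mors\<close>, and
  \<open>cmp \<kappa> \<mu>\<close> only for composable morphisms (\<open>src \<kappa> = rng \<mu>\<close>).
\<close>

record ('o, 'm, 'k) kgraph =
  objs :: "'o set"
  mors :: "'m set"
  src :: "'m \<Rightarrow> 'o"
  rng :: "'m \<Rightarrow> 'o"
  idm :: "'o \<Rightarrow> 'm"
  cmp :: "'m \<Rightarrow> 'm \<Rightarrow> 'm"
  deg :: "'m \<Rightarrow> nat ^ 'k"

text \<open>
  \<open>mors_from \<Lambda> v\<close>, \<open>mors_to \<Lambda> v\<close> and \<open>mors_to_deg \<Lambda> v n\<close> are \<open>\<Lambda>v\<close>, \<open>v\<Lambda>\<close> and \<open>v\<Lambda>\<^sup>n\<close>.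
\<close>

definition mors_from :: "('o, 'm, 'k::finite) kgraph \<Rightarrow> 'o \<Rightarrow> 'm set" where
  "mors_from \<Lambda> v = {\<kappa> \<in> mors \<Lambda>. src \<Lambda> \<kappa> = v}"

definition mors_to :: "('o, 'm, 'k::finite) kgraph \<Rightarrow> 'o \<Rightarrow> 'm set" where
  "mors_to \<Lambda> v = {\<kappa> \<in> mors \<Lambda>. rng \<Lambda> \<kappa> = v}"

definition mors_to_deg :: "('o, 'm, 'k::finite) kgraph \<Rightarrow> 'o \<Rightarrow> nat ^ 'k \<Rightarrow> 'm set" where
  "mors_to_deg \<Lambda> v n = {\<kappa> \<in> mors_to \<Lambda> v. deg \<Lambda> \<kappa> = n}"

locale k_graph =
  fixes \<Lambda> :: "('o, 'm, 'k::finite) kgraph"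
  assumes src_in: "\<kappa> \<in> mors \<Lambda> \<Longrightarrow> src \<Lambda> \<kappa> \<in> objs \<Lambda>"
    and rng_in: "\<kappa> \<in> mors \<Lambda> \<Longrightarrow> rng \<Lambda> \<kappa> \<in> objs \<Lambda>"
    and idm_in: "v \<in> objs \<Lambda> \<Longrightarrow> idm \<Lambda> v \<in> mors \<Lambda>"
    and src_idm: "v \<in> objs \<Lambda> \<Longrightarrow> src \<Lambda> (idm \<Lambda> v) = v"
    and rng_idm: "v \<in> objs \<Lambda> \<Longrightarrow> rng \<Lambda> (idm \<Lambda> v) = v"
    and cmp_in: "\<kappa> \<in> mors \<Lambda> \<Longrightarrow> \<mu> \<in> mors \<Lambda> \<Longrightarrow> src \<Lambda> \<kappa> = rng \<Lambda> \<mu> \<Longrightarrow> cmp \<Lambda> \<kappa> \<mu> \<in> mors \<Lambda>"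
    and src_cmp: "\<kappa> \<in> mors \<Lambda> \<Longrightarrow> \<mu> \<in> mors \<Lambda> \<Longrightarrow> src \<Lambda> \<kappa> = rng \<Lambda> \<mu> \<Longrightarrow>
      src \<Lambda> (cmp \<Lambda> \<kappa> \<mu>) = src \<Lambda> \<mu>"
    and rng_cmp: "\<kappa> \<in> mors \<Lambda> \<Longrightarrow> \<mu> \<in> mors \<Lambda> \<Longrightarrow> src \<Lambda> \<kappa> = rng \<Lambda> \<mu> \<Longrightarrow>
      rng \<Lambda> (cmp \<Lambda> \<kappa> \<mu>) = rng \<Lambda> \<kappa>"
    and cmp_idm_left: "\<kappa> \<in> mors \<Lambda> \<Longrightarrow> cmp \<Lambda> (idm \<Lambda> (rng \<Lambda> \<kappa>)) \<kappa> = \<kappa>"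
    and cmp_idm_right: "\<kappa> \<in> mors \<Lambda> \<Longrightarrow> cmp \<Lambda> \<kappa> (idm \<Lambda> (src \<Lambda> \<kappa>)) = \<kappa>"
    and cmp_assoc: "\<kappa> \<in> mors \<Lambda> \<Longrightarrow> \<mu> \<in> mors \<Lambda> \<Longrightarrow> \<nu> \<in> mors \<Lambda> \<Longrightarrow>
      src \<Lambda> \<kappa> = rng \<Lambda> \<mu> \<Longrightarrow> src \<Lambda> \<mu> = rng \<Lambda> \<nu> \<Longrightarrow>
      cmp \<Lambda> (cmp \<Lambda> \<kappa> \<mu>) \<nu> = cmp \<Lambda> \<kappa> (cmp \<Lambda> \<mu> \<nu>)"
    and deg_idm: "v \<in> objs \<Lambda> \<Longrightarrow> deg \<Lambda> (idm \<Lambda> v) = 0"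
    and deg_cmp: "\<kappa> \<in> mors \<Lambda> \<Longrightarrow> \<mu> \<in> mors \<Lambda> \<Longrightarrow> src \<Lambda> \<kappa> = rng \<Lambda> \<mu> \<Longrightarrow>
      deg \<Lambda> (cmp \<Lambda> \<kappa> \<mu>) = deg \<Lambda> \<kappa> + deg \<Lambda> \<mu>"
    and unique_factorization: "\<kappa> \<in> mors \<Lambda> \<Longrightarrow> deg \<Lambda> \<kappa> = m + n \<Longrightarrow>
      \<exists>!p. fst p \<in> mors \<Lambda> \<and> snd p \<in> mors \<Lambda> \<and> src \<Lambda> (fst p) = rng \<Lambda> (snd p) \<and>
        deg \<Lambda> (fst p) = m \<and> deg \<Lambda> (snd p) = n \<and> \<kappa> = cmp \<Lambda> (fst p) (snd p)"

text \<open>The equivalence relation on \<open>A\<close> generated by a relation \<open>R \<subseteq> A \<times> A\<close>.\<close>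

definition equiv_gen :: "'a set \<Rightarrow> ('a \<times> 'a) set \<Rightarrow> ('a \<times> 'a) set" where
  "equiv_gen A R = (R \<union> R\<inverse>)\<^sup>* \<inter> A \<times> A"

text \<open>The standing assumptions imposed on every k-graph.\<close>

locale standing_k_graph = k_graph +
  assumes nonempty: "objs \<Lambda> \<noteq> {}"
    and connected:
      "equiv_gen (objs \<Lambda>) {(rng \<Lambda> \<kappa>, src \<Lambda> \<kappa>) | \<kappa>. \<kappa> \<in> mors \<Lambda>} = objs \<Lambda> \<times> objs \<Lambda>"
    and row_finite: "v \<in> objs \<Lambda> \<Longrightarrow> finite (mors_to_deg \<Lambda> v n)"
    and no_sources: "v \<in> objs \<Lambda> \<Longrightarrow> mors_to_deg \<Lambda> v n \<noteq> {}"

subsection \<open>Morphisms\<close>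

text \<open>
  A functor is given by total functions whose values outside of \<open>objs\<close> and \<open>mors\<close> are irrelevant;
  accordingly equality of functors is equality on \<open>objs\<close> and \<open>mors\<close>.
\<close>

record ('o, 'm, 'p, 'q) kmor =
  omap :: "'o \<Rightarrow> 'p"
  mmap :: "'m \<Rightarrow> 'q"

definition kmor_comp ::
    "('p, 'q, 'r, 's) kmor \<Rightarrow> ('o, 'm, 'p, 'q) kmor \<Rightarrow> ('o, 'm, 'r, 's) kmor" where
  "kmor_comp \<beta> \<phi> = \<lparr>omap = omap \<beta> \<circ> omap \<phi>, mmap = mmap \<beta> \<circ> mmap \<phi>\<rparr>"

definition kmor_eq_on ::
    "('o, 'm, 'k::finite) kgraph \<Rightarrow> ('o, 'm, 'p, 'q) kmor \<Rightarrow> ('o, 'm, 'p, 'q) kmor \<Rightarrow> bool" where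
  "kmor_eq_on \<Delta> \<alpha> \<beta> \<longleftrightarrow>
     (\<forall>v \<in> objs \<Delta>. omap \<alpha> v = omap \<beta> v) \<and> (\<forall>\<delta> \<in> mors \<Delta>. mmap \<alpha> \<delta> = mmap \<beta> \<delta>)"

definition kgraph_morphism ::
    "('o, 'm, 'k::finite) kgraph \<Rightarrow> ('p, 'q, 'k) kgraph \<Rightarrow> ('o, 'm, 'p, 'q) kmor \<Rightarrow> bool" where
  "kgraph_morphism \<Delta> \<Lambda> \<alpha> \<longleftrightarrow>
     (\<forall>v \<in> objs \<Delta>. omap \<alpha> v \<in> objs \<Lambda> \<and> mmap \<alpha> (idm \<Delta> v) = idm \<Lambda> (omap \<alpha> v)) \<and>
     (\<forall>\<delta> \<in> mors \<Delta>. mmap \<alpha> \<delta> \<in> mors \<Lambda> \<and>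
        src \<Lambda> (mmap \<alpha> \<delta>) = omap \<alpha> (src \<Delta> \<delta>) \<and>
        rng \<Lambda> (mmap \<alpha> \<delta>) = omap \<alpha> (rng \<Delta> \<delta>) \<and>
        deg \<Lambda> (mmap \<alpha> \<delta>) = deg \<Delta> \<delta>) \<and>
     (\<forall>\<delta> \<in> mors \<Delta>. \<forall>\<epsilon> \<in> mors \<Delta>. src \<Delta> \<delta> = rng \<Delta> \<epsilon> \<longrightarrow>
        mmap \<alpha> (cmp \<Delta> \<delta> \<epsilon>) = cmp \<Lambda> (mmap \<alpha> \<delta>) (mmap \<alpha> \<epsilon>))"

subsection \<open>Walks and the fundamental group\<close>

datatype 'm edge = Fwd 'm | Bwd 'm

fun esrc :: "('o, 'm, 'k::finite) kgraph \<Rightarrow> 'm edge \<Rightarrow> 'o" where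
  "esrc \<Lambda> (Fwd \<kappa>) = src \<Lambda> \<kappa>"
| "esrc \<Lambda> (Bwd \<kappa>) = rng \<Lambda> \<kappa>"

fun erng :: "('o, 'm, 'k::finite) kgraph \<Rightarrow> 'm edge \<Rightarrow> 'o" where
  "erng \<Lambda> (Fwd \<kappa>) = rng \<Lambda> \<kappa>"
| "erng \<Lambda> (Bwd \<kappa>) = src \<Lambda> \<kappa>"

definition edges :: "('o, 'm, 'k::finite) kgraph \<Rightarrow> 'm edge set" where
  "edges \<Lambda> = Fwd ` mors \<Lambda> \<union> Bwd ` (mors \<Lambda> - idm \<Lambda> ` objs \<Lambda>)"

text \<open>
  The walk \<open>e\<^sub>n \<cdots> e\<^sub>1\<close> is the list \<open>[e\<^sub>n, \<dots>, e\<^sub>1]\<close>: it starts with the edge at the end of the list,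
  and concatenation of walks is \<open>@\<close>.
\<close>

definition walks :: "('o, 'm, 'k::finite) kgraph \<Rightarrow> 'm edge list set" where
  "walks \<Lambda> = {p. p \<noteq> [] \<and> set p \<subseteq> edges \<Lambda> \<and> successively (\<lambda>e f. esrc \<Lambda> e = erng \<Lambda> f) p}"

definition wsrc :: "('o, 'm, 'k::finite) kgraph \<Rightarrow> 'm edge list \<Rightarrow> 'o" where
  "wsrc \<Lambda> p = esrc \<Lambda> (last p)"

definition wrng :: "('o, 'm, 'k::finite) kgraph \<Rightarrow> 'm edge list \<Rightarrow> 'o" where
  "wrng \<Lambda> p = erng \<Lambda> (hd p)"

definition walks_from :: "('o, 'm, 'k::finite) kgraph \<Rightarrow> 'o \<Rightarrow> 'm edge list set" where
  "walks_from \<Lambda> u = {p \<in> walks \<Lambda>. wsrc \<Lambda> p = u}"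

definition walk_map :: "('o, 'm, 'p, 'q) kmor \<Rightarrow> 'm edge list \<Rightarrow> 'q edge list" where
  "walk_map \<alpha> = map (map_edge (mmap \<alpha>))"

inductive_set basic_replacements :: "('o, 'm, 'k::finite) kgraph \<Rightarrow> ('m edge list \<times> 'm edge list) set"
  for \<Lambda> where
  "\<kappa> \<in> mors \<Lambda> \<Longrightarrow> ([Fwd \<kappa>, Bwd \<kappa>], [Fwd (idm \<Lambda> (rng \<Lambda> \<kappa>))]) \<in> basic_replacements \<Lambda>"
| "\<kappa> \<in> mors \<Lambda> \<Longrightarrow> ([Bwd \<kappa>, Fwd \<kappa>], [Fwd (idm \<Lambda> (src \<Lambda> \<kappa>))]) \<in> basic_replacements \<Lambda>"
| "\<kappa> \<in> mors \<Lambda> \<Longrightarrow> \<mu> \<in> mors \<Lambda> \<Longrightarrow> src \<Lambda> \<kappa> = rng \<Lambda> \<mu> \<Longrightarrow>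
    ([Fwd (cmp \<Lambda> \<kappa> \<mu>)], [Fwd \<kappa>, Fwd \<mu>]) \<in> basic_replacements \<Lambda>"

definition walk_equiv :: "('o, 'm, 'k::finite) kgraph \<Rightarrow> ('m edge list \<times> 'm edge list) set" where
  "walk_equiv \<Lambda> = equiv_gen (walks \<Lambda>)
     {(p @ a @ q, p @ b @ q) | p q a b.
        (a, b) \<in> basic_replacements \<Lambda> \<and> p @ a @ q \<in> walks \<Lambda> \<and> p @ b @ q \<in> walks \<Lambda>}"

text \<open>
  \<open>groupoid_hom \<Lambda> u v\<close> is the set \<open>u\<G>(\<Lambda>)v\<close> of morphisms from \<open>v\<close> to \<open>u\<close> in the fundamental
  groupoid.
\<close>

definition groupoid_hom :: "('o, 'm, 'k::finite) kgraph \<Rightarrow> 'o \<Rightarrow> 'o \<Rightarrow> 'm edge list set set" where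
  "groupoid_hom \<Lambda> u v = {walk_equiv \<Lambda> `` {p} | p. p \<in> walks \<Lambda> \<and> wrng \<Lambda> p = u \<and> wsrc \<Lambda> p = v}"

definition groupoid_comp ::
    "('o, 'm, 'k::finite) kgraph \<Rightarrow> 'm edge list set \<Rightarrow> 'm edge list set \<Rightarrow> 'm edge list set" where
  "groupoid_comp \<Lambda> X Y = (\<Union>p \<in> X. \<Union>q \<in> Y. walk_equiv \<Lambda> `` {p @ q})"

definition fundamental_group :: "('o, 'm, 'k::finite) kgraph \<Rightarrow> 'o \<Rightarrow> 'm edge list set monoid" where
  "fundamental_group \<Lambda> x =
     \<lparr>carrier = groupoid_hom \<Lambda> x x, mult = groupoid_comp \<Lambda>,
      one = walk_equiv \<Lambda> `` {[Fwd (idm \<Lambda> x)]}\<rparr>"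

subsection \<open>Representation graphs\<close>

definition rep_kgraph ::
    "('o, 'm, 'k::finite) kgraph \<Rightarrow> ('p, 'q, 'k) kgraph \<Rightarrow> ('p, 'q, 'o, 'm) kmor \<Rightarrow> bool" where
  "rep_kgraph \<Lambda> \<Delta> \<alpha> \<longleftrightarrow> standing_k_graph \<Delta> \<and> kgraph_morphism \<Delta> \<Lambda> \<alpha> \<and>
     (\<forall>v \<in> objs \<Delta>. bij_betw (mmap \<alpha>) (mors_from \<Delta> v) (mors_from \<Lambda> (omap \<alpha> v)) \<and>
        (\<forall>n. is_singleton (mors_to_deg \<Delta> v n)))"

type_synonym ('p, 'q, 'o, 'm, 'k) rg_object = "('p, 'q, 'k) kgraph \<times> ('p, 'q, 'o, 'm) kmor"

text \<open>
  The small categories underlying the objects of \<open>RG(\<Lambda>)\<close> have their objects and their morphisms in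
  a single type \<open>'u\<close>. An object \<open>(\<Delta>, \<alpha>)\<close> of \<open>RG(\<Lambda>)\<close> satisfies \<open>|\<Delta>| \<le> |\<Lambda>|\<close> (\<open>\<Delta>\<close> is
  connected, each \<open>v\<Delta>\<close> is countable, \<open>\<Delta>v\<close> embeds into \<open>\<Lambda>\<close>, and \<open>\<Lambda>\<close> is infinite), so if \<open>'u\<close> is
  at least as large as \<open>mors \<Lambda>\<close>, nothing is lost up to isomorphism.
\<close>

definition RG ::
    "('o, 'm, 'k::finite) kgraph \<Rightarrow> ('u, 'u, 'o, 'm, 'k) rg_object set" where
  "RG \<Lambda> = {(\<Delta>, \<alpha>). rep_kgraph \<Lambda> \<Delta> \<alpha>}"

definition rg_morphism ::
    "('p, 'q, 'o, 'm, 'k::finite) rg_object \<Rightarrow> ('r, 's, 'o, 'm, 'k) rg_object \<Rightarrow>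
     ('p, 'q, 'r, 's) kmor \<Rightarrow> bool" where
  "rg_morphism X Y \<phi> \<longleftrightarrow> kgraph_morphism (fst X) (fst Y) \<phi> \<and>
     kmor_eq_on (fst X) (kmor_comp (snd Y) \<phi>) (snd X)"

text \<open>A connected component, being a full subcategory, is identified with its class of objects.\<close>

definition rg_components ::
    "('o, 'm, 'k::finite) kgraph \<Rightarrow> ('u, 'u, 'o, 'm, 'k) rg_object set set" where
  "rg_components \<Lambda> =
     RG \<Lambda> // equiv_gen (RG \<Lambda>) {(X, Y). X \<in> RG \<Lambda> \<and> Y \<in> RG \<Lambda> \<and> (\<exists>\<phi>. rg_morphism X Y \<phi>)}"

subsection \<open>The quotient of a representation graph\<close>

definition vertex_sim :: "('p, 'q, 'o, 'm, 'k::finite) rg_object \<Rightarrow> ('p \<times> 'p) set" where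
  "vertex_sim = (\<lambda>(\<Delta>, \<alpha>). {(u, v). u \<in> objs \<Delta> \<and> v \<in> objs \<Delta> \<and>
     walk_map \<alpha> ` walks_from \<Delta> u = walk_map \<alpha> ` walks_from \<Delta> v})"

definition mor_sim :: "('p, 'q, 'o, 'm, 'k::finite) rg_object \<Rightarrow> ('q \<times> 'q) set" where
  "mor_sim = (\<lambda>(\<Delta>, \<alpha>). {(\<delta>, \<epsilon>). \<delta> \<in> mors \<Delta> \<and> \<epsilon> \<in> mors \<Delta> \<and>
     (src \<Delta> \<delta>, src \<Delta> \<epsilon>) \<in> vertex_sim (\<Delta>, \<alpha>) \<and> mmap \<alpha> \<delta> = mmap \<alpha> \<epsilon>})"

text \<open>
  Each operation on classes is applied to all representatives; the results lie in one class
  (respectively are one value, extracted by \<open>the_elem\<close>).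
\<close>

definition quotient_graph ::
    "('p, 'q, 'o, 'm, 'k::finite) rg_object \<Rightarrow> ('p set, 'q set, 'k) kgraph" where
  "quotient_graph = (\<lambda>(\<Delta>, \<alpha>).
     \<lparr>objs = objs \<Delta> // vertex_sim (\<Delta>, \<alpha>),
      mors = mors \<Delta> // mor_sim (\<Delta>, \<alpha>),
      src = (\<lambda>X. \<Union>\<delta> \<in> X. vertex_sim (\<Delta>, \<alpha>) `` {src \<Delta> \<delta>}),
      rng = (\<lambda>X. \<Union>\<delta> \<in> X. vertex_sim (\<Delta>, \<alpha>) `` {rng \<Delta> \<delta>}),
      idm = (\<lambda>U. \<Union>v \<in> U. mor_sim (\<Delta>, \<alpha>) `` {idm \<Delta> v}),
      cmp = (\<lambda>X Y. \<Union>\<delta> \<in> X. \<Union>\<delta>' \<in> Y. mor_sim (\<Delta>, \<alpha>) ``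
        {cmp \<Delta> (THE \<delta>''. \<delta>'' \<in> mors_from \<Delta> (rng \<Delta> \<delta>') \<and> mmap \<alpha> \<delta>'' = mmap \<alpha> \<delta>) \<delta>'}),
      deg = (\<lambda>X. the_elem (deg \<Delta> ` X))\<rparr>)"

definition quotient_map ::
    "('p, 'q, 'o, 'm, 'k::finite) rg_object \<Rightarrow> ('p set, 'q set, 'o, 'm) kmor" where
  "quotient_map = (\<lambda>(\<Delta>, \<alpha>).
     \<lparr>omap = (\<lambda>U. the_elem (omap \<alpha> ` U)), mmap = (\<lambda>X. the_elem (mmap \<alpha> ` X))\<rparr>)"

definition rg_quotient ::
    "('p, 'q, 'o, 'm, 'k::finite) rg_object \<Rightarrow> ('p set, 'q set, 'o, 'm, 'k) rg_object" where
  "rg_quotient X = (quotient_graph X, quotient_map X)"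

subsection \<open>Coverings\<close>

definition covering ::
    "('o, 'm, 'k::finite) kgraph \<Rightarrow> ('p, 'q, 'k) kgraph \<Rightarrow> ('p, 'q, 'o, 'm) kmor \<Rightarrow> bool" where
  "covering \<Delta> \<Omega> \<tau> \<longleftrightarrow> standing_k_graph \<Omega> \<and> kgraph_morphism \<Omega> \<Delta> \<tau> \<and>
     (\<forall>v \<in> objs \<Omega>. bij_betw (mmap \<tau>) (mors_from \<Omega> v) (mors_from \<Delta> (omap \<tau> v)) \<and>
        bij_betw (mmap \<tau>) (mors_to \<Omega> v) (mors_to \<Delta> (omap \<tau> v)))"

text \<open>
  The quantifier over all coverings \<open>(\<Sigma>, \<beta>)\<close> ranges over graphs with objects and morphisms in the
  type \<open>'u\<close> in which \<open>\<Delta>\<close> lives. This loses no covering up to isomorphism provided \<open>'u\<close> is at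
  least as large as the set of walks of \<open>\<Delta>\<close>: coverings are connected with unique walk lifting. As
  \<open>mors \<Delta> :: 'u set\<close> is infinite for a graph without sources, this always holds. Sharing one type for
  objects and morphisms is essential here: \<open>\<Delta>\<close> may have a single object and yet have coverings with
  infinitely many.
\<close>

definition universal_covering ::
    "('u, 'u, 'k::finite) kgraph \<Rightarrow> ('u, 'u, 'k) kgraph \<Rightarrow> ('u, 'u, 'u, 'u) kmor \<Rightarrow> bool" where
  "universal_covering \<Delta> \<Omega> \<tau> \<longleftrightarrow> covering \<Delta> \<Omega> \<tau> \<and>
     (\<forall>(\<Sigma> :: ('u, 'u, 'k) kgraph) \<beta>. covering \<Delta> \<Sigma> \<beta> \<longrightarrow>
        (\<exists>\<phi>. kgraph_morphism \<Omega> \<Sigma> \<phi> \<and> kmor_eq_on \<Omega> (kmor_comp \<beta> \<phi>) \<tau>))"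


section \<open>Algebra over a field\<close>

text \<open>
  The vector space with basis \<open>B :: 'b set\<close> over the field \<open>'a\<close> consists of the finitely supported
  functions \<open>x :: 'b \<Rightarrow>\<^sub>0 'a\<close> with \<open>keys x \<subseteq> B\<close>; the basis vector \<open>b\<close> is \<open>single b 1\<close>.
\<close>

definition free_space :: "'b set \<Rightarrow> ('b \<Rightarrow>\<^sub>0 'a::field) set" where
  "free_space B = {x. Poly_Mapping.keys x \<subseteq> B}"

definition scl :: "'a::field \<Rightarrow> ('b \<Rightarrow>\<^sub>0 'a) \<Rightarrow> ('b \<Rightarrow>\<^sub>0 'a)" where
  "scl c x = Poly_Mapping.map ((*) c) x"

definition lin_extend :: "('b \<Rightarrow> ('c \<Rightarrow>\<^sub>0 'a::field)) \<Rightarrow> ('b \<Rightarrow>\<^sub>0 'a) \<Rightarrow> ('c \<Rightarrow>\<^sub>0 'a)" where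
  "lin_extend f x = (\<Sum>b \<in> Poly_Mapping.keys x. scl (Poly_Mapping.lookup x b) (f b))"

text \<open>The bilinear extension of an operation on basis elements.\<close>

definition convolution ::
    "('b \<Rightarrow> 'b \<Rightarrow> 'b) \<Rightarrow> ('b \<Rightarrow>\<^sub>0 'a::field) \<Rightarrow> ('b \<Rightarrow>\<^sub>0 'a) \<Rightarrow> ('b \<Rightarrow>\<^sub>0 'a)" where
  "convolution f x y = (\<Sum>b \<in> Poly_Mapping.keys x. \<Sum>c \<in> Poly_Mapping.keys y.
     Poly_Mapping.single (f b c) (Poly_Mapping.lookup x b * Poly_Mapping.lookup y c))"

definition group_algebra :: "('g, 'z) monoid_scheme \<Rightarrow> ('g \<Rightarrow>\<^sub>0 'a::field) ring" where
  "group_algebra G =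
     \<lparr>carrier = free_space (carrier G), mult = convolution (mult G),
      one = Poly_Mapping.single (one G) 1, zero = 0, add = (+)\<rparr>"

definition nontrivial_idempotent :: "('r, 'z) ring_scheme \<Rightarrow> 'r \<Rightarrow> bool" where
  "nontrivial_idempotent R e \<longleftrightarrow>
     e \<in> carrier R \<and> e \<otimes>\<^bsub>R\<^esub> e = e \<and> e \<noteq> \<zero>\<^bsub>R\<^esub> \<and> e \<noteq> \<one>\<^bsub>R\<^esub>"

subsection \<open>Kumjian-Pask algebras\<close>

text \<open>Associative algebras over \<open>'a\<close>, possibly without a unit.\<close>

record ('a, 'r) k_algebra = "'r partial_object" +
  aadd :: "'r \<Rightarrow> 'r \<Rightarrow> 'r"
  amult :: "'r \<Rightarrow> 'r \<Rightarrow> 'r"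
  ascale :: "'a \<Rightarrow> 'r \<Rightarrow> 'r"

text \<open>
  \<open>Bwd \<kappa>\<close> is the symbol \<open>\<kappa>\<^sup>*\<close> for \<open>\<kappa>\<close> of nonzero degree, and \<open>ghost \<Lambda> \<kappa>\<close> is \<open>\<kappa>\<^sup>*\<close> for arbitrary \<open>\<kappa>\<close>.
\<close>

definition ghost :: "('o, 'm, 'k::finite) kgraph \<Rightarrow> 'm \<Rightarrow> 'm edge" where
  "ghost \<Lambda> \<kappa> = (if deg \<Lambda> \<kappa> = 0 then Fwd \<kappa> else Bwd \<kappa>)"

definition kp_generators :: "('o, 'm, 'k::finite) kgraph \<Rightarrow> 'm edge set" where
  "kp_generators \<Lambda> = Fwd ` mors \<Lambda> \<union> ghost \<Lambda> ` mors \<Lambda>"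

text \<open>
  The free non-unital algebra on the generators has the nonempty words as a basis, with
  multiplication \<open>convolution (@)\<close>.
\<close>

definition kp_free :: "('o, 'm, 'k::finite) kgraph \<Rightarrow> ('m edge list \<Rightarrow>\<^sub>0 'a::field) set" where
  "kp_free \<Lambda> = free_space {w. w \<noteq> [] \<and> set w \<subseteq> kp_generators \<Lambda>}"

abbreviation word :: "'x list \<Rightarrow> ('x list \<Rightarrow>\<^sub>0 'a::field)" where
  "word w \<equiv> Poly_Mapping.single w 1"

text \<open>The differences of the two sides of the relations (KP1)--(KP4).\<close>

inductive_set kp_relators ::
    "('o, 'm, 'k::finite) kgraph \<Rightarrow> ('m edge list \<Rightarrow>\<^sub>0 'a::field) set"
  for \<Lambda> where
  KP1: "\<kappa> \<in> mors \<Lambda> \<Longrightarrow> \<mu> \<in> mors \<Lambda> \<Longrightarrow>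
    word [Fwd \<kappa>, Fwd \<mu>] - (if src \<Lambda> \<kappa> = rng \<Lambda> \<mu> then word [Fwd (cmp \<Lambda> \<kappa> \<mu>)] else 0)
      \<in> kp_relators \<Lambda>"
| KP2: "\<kappa> \<in> mors \<Lambda> \<Longrightarrow> \<mu> \<in> mors \<Lambda> \<Longrightarrow>
    word [ghost \<Lambda> \<mu>, ghost \<Lambda> \<kappa>] -
      (if src \<Lambda> \<kappa> = rng \<Lambda> \<mu> then word [ghost \<Lambda> (cmp \<Lambda> \<kappa> \<mu>)] else 0) \<in> kp_relators \<Lambda>"
| KP3: "\<kappa> \<in> mors \<Lambda> \<Longrightarrow> \<mu> \<in> mors \<Lambda> \<Longrightarrow> deg \<Lambda> \<kappa> = deg \<Lambda> \<mu> \<Longrightarrow>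
    word [ghost \<Lambda> \<kappa>, Fwd \<mu>] - (if \<kappa> = \<mu> then word [Fwd (idm \<Lambda> (src \<Lambda> \<kappa>))] else 0)
      \<in> kp_relators \<Lambda>"
| KP4: "v \<in> objs \<Lambda> \<Longrightarrow>
    (\<Sum>\<kappa> \<in> mors_to_deg \<Lambda> v n. word [Fwd \<kappa>, ghost \<Lambda> \<kappa>]) - word [Fwd (idm \<Lambda> v)]
      \<in> kp_relators \<Lambda>"

inductive_set kp_ideal :: "('o, 'm, 'k::finite) kgraph \<Rightarrow> ('m edge list \<Rightarrow>\<^sub>0 'a::field) set"
  for \<Lambda> where
  "x \<in> kp_relators \<Lambda> \<Longrightarrow> x \<in> kp_ideal \<Lambda>"
| "0 \<in> kp_ideal \<Lambda>"
| "x \<in> kp_ideal \<Lambda> \<Longrightarrow> y \<in> kp_ideal \<Lambda> \<Longrightarrow> x + y \<in> kp_ideal \<Lambda>"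
| "x \<in> kp_ideal \<Lambda> \<Longrightarrow> scl c x \<in> kp_ideal \<Lambda>"
| "x \<in> kp_ideal \<Lambda> \<Longrightarrow> y \<in> kp_free \<Lambda> \<Longrightarrow> convolution (@) y x \<in> kp_ideal \<Lambda>"
| "x \<in> kp_ideal \<Lambda> \<Longrightarrow> y \<in> kp_free \<Lambda> \<Longrightarrow> convolution (@) x y \<in> kp_ideal \<Lambda>"

definition kp_class ::
    "('o, 'm, 'k::finite) kgraph \<Rightarrow> ('m edge list \<Rightarrow>\<^sub>0 'a::field) \<Rightarrow> ('m edge list \<Rightarrow>\<^sub>0 'a) set" where
  "kp_class \<Lambda> x = {y \<in> kp_free \<Lambda>. y - x \<in> kp_ideal \<Lambda>}"

definition KP ::
    "('o, 'm, 'k::finite) kgraph \<Rightarrow> ('a::field, ('m edge list \<Rightarrow>\<^sub>0 'a) set) k_algebra" where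
  "KP \<Lambda> =
     \<lparr>carrier = kp_class \<Lambda> ` kp_free \<Lambda>,
      aadd = (\<lambda>A B. \<Union>a \<in> A. \<Union>b \<in> B. kp_class \<Lambda> (a + b)),
      amult = (\<lambda>A B. \<Union>a \<in> A. \<Union>b \<in> B. kp_class \<Lambda> (convolution (@) a b)),
      ascale = (\<lambda>c A. \<Union>a \<in> A. kp_class \<Lambda> (scl c a))\<rparr>"

subsection \<open>Modules\<close>

text \<open>
  Left modules whose underlying vector space is a space of finitely supported functions; addition and
  scalar multiplication are the pointwise ones.
\<close>

record ('r, 'v) left_module = "'v partial_object" +
  act :: "'r \<Rightarrow> 'v \<Rightarrow> 'v"

definition submodule_of ::
    "('a::field, 'r, 'y) k_algebra_scheme \<Rightarrow> ('r, 'b \<Rightarrow>\<^sub>0 'a, 'z) left_module_scheme \<Rightarrow>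
     ('b \<Rightarrow>\<^sub>0 'a) set \<Rightarrow> bool" where
  "submodule_of A M U \<longleftrightarrow> U \<subseteq> carrier M \<and> 0 \<in> U \<and>
     (\<forall>x \<in> U. \<forall>y \<in> U. x + y \<in> U) \<and>
     (\<forall>c. \<forall>x \<in> U. scl c x \<in> U) \<and>
     (\<forall>a \<in> carrier A. \<forall>x \<in> U. act M a x \<in> U)"

definition indecomposable_module ::
    "('a::field, 'r, 'y) k_algebra_scheme \<Rightarrow> ('r, 'b \<Rightarrow>\<^sub>0 'a, 'z) left_module_scheme \<Rightarrow> bool" where
  "indecomposable_module A M \<longleftrightarrow> carrier M \<noteq> {0} \<and>
     \<not> (\<exists>U W. submodule_of A M U \<and> submodule_of A M W \<and> U \<noteq> {0} \<and> W \<noteq> {0} \<and>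
          U \<inter> W = {0} \<and> carrier M = {u + w | u w. u \<in> U \<and> w \<in> W})"

subsection \<open>The module of a representation graph\<close>

fun gen_act_basis ::
    "('p, 'q, 'o, 'm, 'k::finite) rg_object \<Rightarrow> 'm edge \<Rightarrow> 'p \<Rightarrow> ('p \<Rightarrow>\<^sub>0 'a::field)" where
  "gen_act_basis (\<Delta>, \<alpha>) (Fwd \<kappa>) v =
     (if \<exists>\<delta> \<in> mors_from \<Delta> v. mmap \<alpha> \<delta> = \<kappa>
      then Poly_Mapping.single (rng \<Delta> (THE \<delta>. \<delta> \<in> mors_from \<Delta> v \<and> mmap \<alpha> \<delta> = \<kappa>)) 1 else 0)"
| "gen_act_basis (\<Delta>, \<alpha>) (Bwd \<kappa>) v =
     (if \<exists>\<delta> \<in> mors_to \<Delta> v. mmap \<alpha> \<delta> = \<kappa>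
      then Poly_Mapping.single (src \<Delta> (THE \<delta>. \<delta> \<in> mors_to \<Delta> v \<and> mmap \<alpha> \<delta> = \<kappa>)) 1 else 0)"

definition word_act ::
    "('p, 'q, 'o, 'm, 'k::finite) rg_object \<Rightarrow> 'm edge list \<Rightarrow> ('p \<Rightarrow>\<^sub>0 'a::field) \<Rightarrow> ('p \<Rightarrow>\<^sub>0 'a)" where
  "word_act X w = foldr (\<lambda>g. lin_extend (gen_act_basis X g)) w"

definition free_act ::
    "('p, 'q, 'o, 'm, 'k::finite) rg_object \<Rightarrow> ('m edge list \<Rightarrow>\<^sub>0 'a::field) \<Rightarrow> ('p \<Rightarrow>\<^sub>0 'a) \<Rightarrow> ('p \<Rightarrow>\<^sub>0 'a)" where
  "free_act X a x = lin_extend (\<lambda>w. word_act X w x) a"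

text \<open>
  A class acts through any of its representatives: \<open>kp_ideal \<Lambda>\<close> acts as zero on \<open>rep_module X\<close>
  for a representation graph \<open>X\<close> of \<open>\<Lambda>\<close>.
\<close>

definition rep_module ::
    "('p, 'q, 'o, 'm, 'k::finite) rg_object \<Rightarrow>
     (('m edge list \<Rightarrow>\<^sub>0 'a::field) set, 'p \<Rightarrow>\<^sub>0 'a) left_module" where
  "rep_module X =
     \<lparr>carrier = free_space (objs (fst X)), act = (\<lambda>A x. free_act X (SOME a. a \<in> A) x)\<rparr>"

end

theory Submission
  imports Defs
begin

text \<open>
  Since \<open>\<Omega>\<close> is simply connected and covers \<open>\<Gamma> = \<Omega>\<^sub>\<sim>\<close>, fixing a vertex \<open>v\<^sub>0\<close> over \<open>y\<close> identifies the
  fundamental group at \<open>y\<close> with the fibre of \<open>\<Omega> \<rightarrow> \<Gamma>\<close> over \<open>y\<close>, that is, with the class of \<open>v\<^sub>0\<close>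
  under \<open>\<sim>\<close>, which acts on \<open>\<Omega>\<close> by deck transformations. A word \<open>w\<close> in the generators of the
  Kumjian-Pask algebra acts on the vertices as a partial injection, so \<open>w\<^sup>*w\<close> is the projection onto
  the vertices at which a walk labelled \<open>w\<close> starts. Hence an endomorphism maps \<open>v\<^sub>0\<close> to a combination
  of vertices \<open>u\<close> with \<open>u \<sim> v\<^sub>0\<close>, and as \<open>v\<^sub>0\<close> generates the module, the endomorphism ring is
  anti-isomorphic to the group algebra. Direct decompositions correspond to idempotents.

  There is one complication: a walk all of whose edges are reversed is equivalent only to itself,
  so that the classes of closed walks do not quite form a group. The additional classes
  are a free semigroup and do not occur in idempotents.
\<close>

text \<open>A universal covering is given only by its universal property, so simple connectedness
  has to be extracted from it: a covering whose vertices are classes of walks from a base point is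
  built by hand, and a morphism from \<Omega> to it turns equality of end points into equivalence of
  walks. This covering must live in the type of \<Delta>, which is why walks are encoded; the
  absence of sources makes that type infinite.

  The map \<zeta> need not be a covering: it lifts forward edges from every vertex, but a reversed
  edge may have no lift. Passing to the quotient repairs this, because vertices related by ~ admit
  the same labels of walks, reversed edges included.

  The endomorphism ring is never formed. An endomorphism is represented by the image
  \<open>e\<close> of \<open>v0\<close>, and idempotency becomes \<open>end_map e e = e\<close>;
  both sides of the theorem are reduced to this equation. Composition turns into multiplication in
  the opposite order, which idempotency does not notice.\<close>

context k_graph
begin

text \<open>A morphism of degree 0 = 0 + 0 factors with an identity on the left and with one on the
  right; uniqueness makes the two factorizations equal.\<close>

lemma deg_0_imp_idm:
  assumes "\<kappa> \<in> mors \<Lambda>" "deg \<Lambda> \<kappa> = 0"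
  shows "\<kappa> = idm \<Lambda> (src \<Lambda> \<kappa>)" "\<kappa> = idm \<Lambda> (rng \<Lambda> \<kappa>)" "src \<Lambda> \<kappa> = rng \<Lambda> \<kappa>"
proof -
  let ?P = "\<lambda>p. fst p \<in> mors \<Lambda> \<and> snd p \<in> mors \<Lambda> \<and> src \<Lambda> (fst p) = rng \<Lambda> (snd p) \<and>
        deg \<Lambda> (fst p) = 0 \<and> deg \<Lambda> (snd p) = 0 \<and> \<kappa> = cmp \<Lambda> (fst p) (snd p)"
  have "\<exists>!p. ?P p" using unique_factorization[of \<kappa> 0 0] assms by simp
  moreover have "?P (\<kappa>, idm \<Lambda> (src \<Lambda> \<kappa>))"
    using assms by (simp add: src_in idm_in rng_idm deg_idm cmp_idm_right)
  moreover have "?P (idm \<Lambda> (rng \<Lambda> \<kappa>), \<kappa>)"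
    using assms by (simp add: rng_in idm_in src_idm deg_idm cmp_idm_left)
  ultimately have "(\<kappa>, idm \<Lambda> (src \<Lambda> \<kappa>)) = (idm \<Lambda> (rng \<Lambda> \<kappa>), \<kappa>)" by blast
  then show *: "\<kappa> = idm \<Lambda> (src \<Lambda> \<kappa>)" "\<kappa> = idm \<Lambda> (rng \<Lambda> \<kappa>)" by simp_all
  show "src \<Lambda> \<kappa> = rng \<Lambda> \<kappa>"
    using *(1) assms(1) rng_idm src_in by metis
qed

lemma idm_iff_deg_0: "\<kappa> \<in> mors \<Lambda> \<Longrightarrow> \<kappa> \<in> idm \<Lambda> ` objs \<Lambda> \<longleftrightarrow> deg \<Lambda> \<kappa> = 0"
  using deg_0_imp_idm(1) deg_idm src_in by (metis image_iff)

lemma unique_factorization_eq: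
  assumes "\<kappa> \<in> mors \<Lambda>" "\<mu> \<in> mors \<Lambda>" "src \<Lambda> \<kappa> = rng \<Lambda> \<mu>"
    and "\<kappa>' \<in> mors \<Lambda>" "\<mu>' \<in> mors \<Lambda>" "src \<Lambda> \<kappa>' = rng \<Lambda> \<mu>'"
    and "deg \<Lambda> \<kappa> = deg \<Lambda> \<kappa>'" "deg \<Lambda> \<mu> = deg \<Lambda> \<mu>'" "cmp \<Lambda> \<kappa> \<mu> = cmp \<Lambda> \<kappa>' \<mu>'"
  shows "\<kappa> = \<kappa>' \<and> \<mu> = \<mu>'"
proof -
  let ?P = "\<lambda>p. fst p \<in> mors \<Lambda> \<and> snd p \<in> mors \<Lambda> \<and> src \<Lambda> (fst p) = rng \<Lambda> (snd p) \<and>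
        deg \<Lambda> (fst p) = deg \<Lambda> \<kappa> \<and> deg \<Lambda> (snd p) = deg \<Lambda> \<mu> \<and> cmp \<Lambda> \<kappa> \<mu> = cmp \<Lambda> (fst p) (snd p)"
  have "\<exists>!p. ?P p" using unique_factorization[OF cmp_in deg_cmp] assms(1-3) by simp
  moreover have "?P (\<kappa>, \<mu>)" "?P (\<kappa>', \<mu>')" using assms by simp_all
  ultimately have "(\<kappa>, \<mu>) = (\<kappa>', \<mu>')" by blast
  then show ?thesis by simp
qed

section \<open>Walks\<close>

lemma edges_eq: "edges \<Lambda> = Fwd ` mors \<Lambda> \<union> ghost \<Lambda> ` mors \<Lambda>"
  unfolding edges_def ghost_def using idm_iff_deg_0 by auto

text \<open>The algebra has no separate star in degree 0, the walk graph has no reversed identities.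
  These conventions agree, so a word in the generators is a sequence of edges, and a label of a walk
  is such a word.\<close>

lemma kp_generators_eq: "kp_generators \<Lambda> = edges \<Lambda>"
  by (simp add: edges_eq kp_generators_def)

lemma Fwd_in_edges [simp]: "Fwd \<kappa> \<in> edges \<Lambda> \<longleftrightarrow> \<kappa> \<in> mors \<Lambda>"
  by (auto simp: edges_def)

lemma Bwd_in_edges: "Bwd \<kappa> \<in> edges \<Lambda> \<longleftrightarrow> \<kappa> \<in> mors \<Lambda> \<and> deg \<Lambda> \<kappa> \<noteq> 0"
  using idm_iff_deg_0 by (auto simp: edges_def)

lemma ghost_in_edges [simp]: "\<kappa> \<in> mors \<Lambda> \<Longrightarrow> ghost \<Lambda> \<kappa> \<in> edges \<Lambda>"
  by (simp add: edges_eq)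

lemma esrc_ghost [simp]: "\<kappa> \<in> mors \<Lambda> \<Longrightarrow> esrc \<Lambda> (ghost \<Lambda> \<kappa>) = rng \<Lambda> \<kappa>"
  and erng_ghost [simp]: "\<kappa> \<in> mors \<Lambda> \<Longrightarrow> erng \<Lambda> (ghost \<Lambda> \<kappa>) = src \<Lambda> \<kappa>"
  by (auto simp: ghost_def deg_0_imp_idm(3))

text \<open>The cases overlap in degree 0, where \<open>ghost\<close> is a forward edge; with
  \<open>Bwd\<close> in the second case, identities would need separate treatment.\<close>

lemma edge_cases [consumes 1, case_names Fwd ghost]:
  assumes "e \<in> edges \<Lambda>"
  obtains \<kappa> where "\<kappa> \<in> mors \<Lambda>" "e = Fwd \<kappa>" | \<kappa> where "\<kappa> \<in> mors \<Lambda>" "e = ghost \<Lambda> \<kappa>"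
  using assms by (auto simp: edges_eq)

lemma esrc_in: "e \<in> edges \<Lambda> \<Longrightarrow> esrc \<Lambda> e \<in> objs \<Lambda>"
  and erng_in: "e \<in> edges \<Lambda> \<Longrightarrow> erng \<Lambda> e \<in> objs \<Lambda>"
  by (auto simp: edges_def src_in rng_in)

end

lemma walks_Cons:
  "e # p \<in> walks \<Lambda> \<longleftrightarrow> e \<in> edges \<Lambda> \<and> (p = [] \<or> p \<in> walks \<Lambda> \<and> esrc \<Lambda> e = wrng \<Lambda> p)"
  by (cases p) (auto simp: walks_def wrng_def)

lemma walks_append:
  assumes "p \<noteq> []" "q \<noteq> []"
  shows "p @ q \<in> walks \<Lambda> \<longleftrightarrow> p \<in> walks \<Lambda> \<and> q \<in> walks \<Lambda> \<and> wsrc \<Lambda> p = wrng \<Lambda> q"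
  using assms by (auto simp: walks_def wrng_def wsrc_def successively_append_iff)

lemma Nil_notin_walks [simp]: "[] \<notin> walks \<Lambda>"
  by (simp add: walks_def)

lemma wsrc_append [simp]: "q \<noteq> [] \<Longrightarrow> wsrc \<Lambda> (p @ q) = wsrc \<Lambda> q"
  and wrng_append [simp]: "p \<noteq> [] \<Longrightarrow> wrng \<Lambda> (p @ q) = wrng \<Lambda> p"
  by (simp_all add: wsrc_def wrng_def)

lemma wsrc_single [simp]: "wsrc \<Lambda> [e] = esrc \<Lambda> e"
  and wrng_Cons [simp]: "wrng \<Lambda> (e # p) = erng \<Lambda> e"
  and wsrc_Cons_Cons [simp]: "wsrc \<Lambda> (e # f # p) = wsrc \<Lambda> (f # p)"
  by (simp_all add: wsrc_def wrng_def)

lemma wsrc_Cons: "p \<noteq> [] \<Longrightarrow> wsrc \<Lambda> (e # p) = wsrc \<Lambda> p"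
  by (simp add: wsrc_def)

lemma walks_not_Nil: "p \<in> walks \<Lambda> \<Longrightarrow> p \<noteq> []"
  by (auto simp: walks_def)

lemma walks_induct [consumes 1, case_names single Cons]:
  assumes "p \<in> walks \<Lambda>"
    and "\<And>e. e \<in> edges \<Lambda> \<Longrightarrow> P [e]"
    and "\<And>e p. e \<in> edges \<Lambda> \<Longrightarrow> p \<in> walks \<Lambda> \<Longrightarrow> esrc \<Lambda> e = wrng \<Lambda> p \<Longrightarrow> P p \<Longrightarrow> P (e # p)"
  shows "P p"
  using assms(1)
proof (induction p)
  case (Cons e p)
  then show ?case using assms(2,3) by (cases "p = []") (auto simp: walks_Cons)
qed simp

lemma sublist_walk:
  assumes "r @ a @ s \<in> walks \<Lambda>" "a \<noteq> []" shows "a \<in> walks \<Lambda>"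
  using assms by (cases "r = []"; cases "s = []") (simp_all add: walks_append)

text \<open>A forward edge is inverted by \<open>ghost\<close>, because \<open>Bwd\<close> of an
  identity is not an edge.\<close>

fun einv :: "('o, 'm, 'k::finite) kgraph \<Rightarrow> 'm edge \<Rightarrow> 'm edge" where
  "einv \<Lambda> (Fwd \<kappa>) = ghost \<Lambda> \<kappa>"
| "einv \<Lambda> (Bwd \<kappa>) = Fwd \<kappa>"

definition winv :: "('o, 'm, 'k::finite) kgraph \<Rightarrow> 'm edge list \<Rightarrow> 'm edge list" where
  "winv \<Lambda> p = rev (map (einv \<Lambda>) p)"

lemma winv_simps [simp]:
  "winv \<Lambda> [] = []" "winv \<Lambda> (e # p) = winv \<Lambda> p @ [einv \<Lambda> e]" "winv \<Lambda> p = [] \<longleftrightarrow> p = []"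
  by (simp_all add: winv_def)

context k_graph
begin

lemma einv_in_edges [simp]: "e \<in> edges \<Lambda> \<Longrightarrow> einv \<Lambda> e \<in> edges \<Lambda>"
  and esrc_einv [simp]: "e \<in> edges \<Lambda> \<Longrightarrow> esrc \<Lambda> (einv \<Lambda> e) = erng \<Lambda> e"
  and erng_einv [simp]: "e \<in> edges \<Lambda> \<Longrightarrow> erng \<Lambda> (einv \<Lambda> e) = esrc \<Lambda> e"
  by (cases e; simp add: Bwd_in_edges)+

lemma wsrc_in: "p \<in> walks \<Lambda> \<Longrightarrow> wsrc \<Lambda> p \<in> objs \<Lambda>"
  by (induction p rule: walks_induct) (auto simp: esrc_in wsrc_Cons walks_not_Nil)

lemma wrng_in: "p \<in> walks \<Lambda> \<Longrightarrow> wrng \<Lambda> p \<in> objs \<Lambda>"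
  by (induction p rule: walks_induct) (auto simp: erng_in)

lemma winv_in:
  assumes "p \<in> walks \<Lambda>"
  shows "winv \<Lambda> p \<in> walks \<Lambda> \<and> wsrc \<Lambda> (winv \<Lambda> p) = wrng \<Lambda> p \<and> wrng \<Lambda> (winv \<Lambda> p) = wsrc \<Lambda> p"
  using assms
  by (induction p rule: walks_induct) (auto simp: walks_Cons walks_append walks_not_Nil wsrc_Cons)

lemma idm_walk [simp]: "v \<in> objs \<Lambda> \<Longrightarrow> [Fwd (idm \<Lambda> v)] \<in> walks \<Lambda>"
  by (simp add: walks_Cons idm_in)

section \<open>Equivalence of walks\<close>

definition wsteps :: "('m edge list \<times> 'm edge list) set" where
  "wsteps = {(p @ a @ q, p @ b @ q) | p q a b.
        (a, b) \<in> basic_replacements \<Lambda> \<and> p @ a @ q \<in> walks \<Lambda> \<and> p @ b @ q \<in> walks \<Lambda>}"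

lemma walk_equiv_eq: "walk_equiv \<Lambda> = (wsteps \<union> wsteps\<inverse>)\<^sup>* \<inter> walks \<Lambda> \<times> walks \<Lambda>"
  by (simp add: walk_equiv_def equiv_gen_def wsteps_def)

lemma wsteps_walks: "(p, q) \<in> wsteps \<Longrightarrow> p \<in> walks \<Lambda> \<and> q \<in> walks \<Lambda>"
  by (auto simp: wsteps_def)

text \<open>Every replacement step joins two walks, so a chain that starts at a walk never leaves
  the set of walks.\<close>

lemma walk_equiv_induct [consumes 1, case_names refl step step_rev]:
  assumes "(p, q) \<in> walk_equiv \<Lambda>"
    and "P p"
    and "\<And>q r. (p, q) \<in> walk_equiv \<Lambda> \<Longrightarrow> P q \<Longrightarrow> (q, r) \<in> wsteps \<Longrightarrow> P r"
    and "\<And>q r. (p, q) \<in> walk_equiv \<Lambda> \<Longrightarrow> P q \<Longrightarrow> (r, q) \<in> wsteps \<Longrightarrow> P r"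
  shows "P q"
proof -
  have p: "p \<in> walks \<Lambda>" and "(p, q) \<in> (wsteps \<union> wsteps\<inverse>)\<^sup>*"
    using assms(1) by (auto simp: walk_equiv_eq)
  from this(2) have "P q \<and> (p, q) \<in> walk_equiv \<Lambda>"
  proof (induction rule: rtrancl_induct)
    case base
    then show ?case using assms(2) p by (auto simp: walk_equiv_eq)
  next
    case (step q r)
    have "r \<in> walks \<Lambda>" using step.hyps(2) wsteps_walks by auto
    then have "(p, r) \<in> walk_equiv \<Lambda>"
      using step.hyps p unfolding walk_equiv_eq by (auto intro: rtrancl_into_rtrancl)
    moreover have "P r" using step.hyps(2) step.IH assms(3,4) by blast
    ultimately show ?case by simp
  qed
  then show ?thesis by simp
qed

lemma equiv_walk_equiv: "equiv (walks \<Lambda>) (walk_equiv \<Lambda>)"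
proof -
  let ?R = "(wsteps \<union> wsteps\<inverse>)\<^sup>*"
  have "sym ?R" by (intro sym_rtrancl sym_Un_converse)
  moreover have "trans ?R" by (rule trans_rtrancl)
  ultimately show ?thesis
    unfolding walk_equiv_eq equiv_def sym_def trans_def refl_on_def by blast
qed

lemma walk_equiv_refl [simp]: "p \<in> walks \<Lambda> \<Longrightarrow> (p, p) \<in> walk_equiv \<Lambda>"
  and walk_equiv_sym: "(p, q) \<in> walk_equiv \<Lambda> \<Longrightarrow> (q, p) \<in> walk_equiv \<Lambda>"
  and walk_equiv_trans [trans]:
    "(p, q) \<in> walk_equiv \<Lambda> \<Longrightarrow> (q, r) \<in> walk_equiv \<Lambda> \<Longrightarrow> (p, r) \<in> walk_equiv \<Lambda>"
  using equiv_walk_equiv unfolding equiv_def refl_on_def sym_def trans_def by blast+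

lemma walk_equiv_walks: "(p, q) \<in> walk_equiv \<Lambda> \<Longrightarrow> p \<in> walks \<Lambda> \<and> q \<in> walks \<Lambda>"
  by (auto simp: walk_equiv_eq)

lemma wstep_equiv: "(p, q) \<in> wsteps \<Longrightarrow> (p, q) \<in> walk_equiv \<Lambda>"
  using wsteps_walks by (auto simp: walk_equiv_eq)

lemma basic_not_Nil: "(a, b) \<in> basic_replacements \<Lambda> \<Longrightarrow> a \<noteq> [] \<and> b \<noteq> []"
  by (auto elim: basic_replacements.cases)

lemma basic_ends:
  "(a, b) \<in> basic_replacements \<Lambda> \<Longrightarrow> wsrc \<Lambda> a = wsrc \<Lambda> b \<and> wrng \<Lambda> a = wrng \<Lambda> b"
  by (induction rule: basic_replacements.induct) (simp_all add: src_idm rng_idm src_in rng_in src_cmp rng_cmp)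

lemma wstep_ends:
  assumes "(p, q) \<in> wsteps" shows "wsrc \<Lambda> p = wsrc \<Lambda> q \<and> wrng \<Lambda> p = wrng \<Lambda> q"
proof -
  obtain r s a b where *: "p = r @ a @ s" "q = r @ b @ s" "(a, b) \<in> basic_replacements \<Lambda>"
    using assms by (auto simp: wsteps_def)
  then show ?thesis
    using basic_ends[OF *(3)] basic_not_Nil[OF *(3)] by (cases "s = []"; cases "r = []") simp_all
qed

lemma walk_equiv_ends:
  "(p, q) \<in> walk_equiv \<Lambda> \<Longrightarrow> wsrc \<Lambda> p = wsrc \<Lambda> q \<and> wrng \<Lambda> p = wrng \<Lambda> q"
  by (induction rule: walk_equiv_induct) (auto dest: wstep_ends)

text \<open>Steps preserve both ends, so a context that fits the old walk also fits the new
  one.\<close>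

lemma wstep_cong:
  assumes "(p, q) \<in> wsteps" "r @ p @ s \<in> walks \<Lambda>"
  shows "(r @ p @ s, r @ q @ s) \<in> wsteps"
proof -
  obtain r' s' a b where *: "p = r' @ a @ s'" "q = r' @ b @ s'" "(a, b) \<in> basic_replacements \<Lambda>"
    using assms by (auto simp: wsteps_def)
  have w: "p \<in> walks \<Lambda>" "q \<in> walks \<Lambda>" using wsteps_walks assms(1) by auto
  have "r @ q @ s \<in> walks \<Lambda>"
    using assms(2) w wstep_ends[OF assms(1)] walks_not_Nil[OF w(1)] walks_not_Nil[OF w(2)]
    by (cases "s = []"; cases "r = []") (simp_all add: walks_append)
  then show ?thesis unfolding wsteps_def using assms(2) *
    by (intro CollectI exI[of _ "r @ r'"] exI[of _ "s' @ s"] exI[of _ a] exI[of _ b]) simp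
qed

lemma wstep_cong_rev:
  assumes "(p, q) \<in> wsteps" "r @ q @ s \<in> walks \<Lambda>"
  shows "(r @ p @ s, r @ q @ s) \<in> wsteps"
proof -
  have w: "p \<in> walks \<Lambda>" "q \<in> walks \<Lambda>" using wsteps_walks assms(1) by auto
  have "r @ p @ s \<in> walks \<Lambda>"
    using assms(2) w wstep_ends[OF assms(1)] walks_not_Nil[OF w(1)] walks_not_Nil[OF w(2)]
    by (cases "s = []"; cases "r = []") (simp_all add: walks_append)
  then show ?thesis using wstep_cong assms by simp
qed

lemma walk_equiv_cong:
  assumes "(p, q) \<in> walk_equiv \<Lambda>" "r @ p @ s \<in> walks \<Lambda>"
  shows "(r @ p @ s, r @ q @ s) \<in> walk_equiv \<Lambda>"
  using assms(1)
proof (induction rule: walk_equiv_induct)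
  case (step q q')
  then show ?case using wstep_cong walk_equiv_walks wstep_equiv walk_equiv_trans by metis
next
  case (step_rev q q')
  then show ?case
    using wstep_cong_rev walk_equiv_walks wstep_equiv walk_equiv_trans walk_equiv_sym by metis
qed (use assms(2) in simp)

lemma walk_equiv_append:
  assumes "(p, p') \<in> walk_equiv \<Lambda>" "(q, q') \<in> walk_equiv \<Lambda>" "wsrc \<Lambda> p = wrng \<Lambda> q"
  shows "(p @ q, p' @ q') \<in> walk_equiv \<Lambda>"
proof -
  have n: "p \<noteq> []" "p' \<noteq> []" "q \<noteq> []"
    using walk_equiv_walks assms(1,2) walks_not_Nil by blast+
  have "(p @ q, p' @ q) \<in> walk_equiv \<Lambda>"
    using walk_equiv_cong[OF assms(1), of "[]" q] assms walk_equiv_walks n by (auto simp: walks_append)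
  moreover have "(p' @ q, p' @ q') \<in> walk_equiv \<Lambda>"
    using walk_equiv_cong[OF assms(2), of p' "[]"] assms walk_equiv_walks[OF assms(1)]
      walk_equiv_walks[OF assms(2)] n walk_equiv_ends[OF assms(1)]
    by (auto simp: walks_append)
  ultimately show ?thesis by (rule walk_equiv_trans)
qed

lemma basic_equiv:
  assumes "(a, b) \<in> basic_replacements \<Lambda>" "a \<in> walks \<Lambda>" "b \<in> walks \<Lambda>"
  shows "(a, b) \<in> walk_equiv \<Lambda>"
  by (rule wstep_equiv, unfold wsteps_def, intro CollectI exI[of _ "[]"] exI[of _ a] exI[of _ b])
    (use assms in simp)

lemma equiv_cmp:
  assumes "\<kappa> \<in> mors \<Lambda>" "\<mu> \<in> mors \<Lambda>" "src \<Lambda> \<kappa> = rng \<Lambda> \<mu>"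
  shows "([Fwd (cmp \<Lambda> \<kappa> \<mu>)], [Fwd \<kappa>, Fwd \<mu>]) \<in> walk_equiv \<Lambda>"
  using assms by (intro basic_equiv basic_replacements.intros) (auto simp: walks_Cons cmp_in)

lemma equiv_idm_Fwd:
  assumes "\<kappa> \<in> mors \<Lambda>"
  shows "([Fwd (idm \<Lambda> (rng \<Lambda> \<kappa>)), Fwd \<kappa>], [Fwd \<kappa>]) \<in> walk_equiv \<Lambda>"
  using walk_equiv_sym[OF equiv_cmp[of "idm \<Lambda> (rng \<Lambda> \<kappa>)" \<kappa>]] assms
  by (simp add: idm_in rng_in src_idm cmp_idm_left)

lemma equiv_Fwd_idm:
  assumes "\<kappa> \<in> mors \<Lambda>"
  shows "([Fwd \<kappa>, Fwd (idm \<Lambda> (src \<Lambda> \<kappa>))], [Fwd \<kappa>]) \<in> walk_equiv \<Lambda>"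
  using walk_equiv_sym[OF equiv_cmp[of \<kappa> "idm \<Lambda> (src \<Lambda> \<kappa>)"]] assms
  by (simp add: idm_in src_in rng_idm cmp_idm_right)

lemma equiv_Fwd_ghost:
  assumes "\<kappa> \<in> mors \<Lambda>"
  shows "([Fwd \<kappa>, ghost \<Lambda> \<kappa>], [Fwd (idm \<Lambda> (rng \<Lambda> \<kappa>))]) \<in> walk_equiv \<Lambda>"
proof (cases "deg \<Lambda> \<kappa> = 0")
  case True
  then show ?thesis
    using equiv_Fwd_idm[OF assms] deg_0_imp_idm[OF assms] by (simp add: ghost_def)
next
  case False
  then show ?thesis using assms unfolding ghost_def
    by (auto intro!: basic_equiv basic_replacements.intros simp: walks_Cons rng_in idm_in Bwd_in_edges)
qed

lemma equiv_ghost_Fwd: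
  assumes "\<kappa> \<in> mors \<Lambda>"
  shows "([ghost \<Lambda> \<kappa>, Fwd \<kappa>], [Fwd (idm \<Lambda> (src \<Lambda> \<kappa>))]) \<in> walk_equiv \<Lambda>"
proof (cases "deg \<Lambda> \<kappa> = 0")
  case True
  then show ?thesis
    using equiv_Fwd_idm[OF assms] deg_0_imp_idm[OF assms] by (simp add: ghost_def)
next
  case False
  then show ?thesis using assms unfolding ghost_def
    by (auto intro!: basic_equiv basic_replacements.intros simp: walks_Cons src_in idm_in Bwd_in_edges)
qed

text \<open>
  No replacement applies to a walk without forward edges, so \<open>1\<close> is not a unit for such walks;
  but \<open>1\<close> can be moved past any edge, and it is absorbed by forward edges.
\<close>

lemma equiv_idm_edge:
  assumes "e \<in> edges \<Lambda>"
  shows "([Fwd (idm \<Lambda> (erng \<Lambda> e)), e], [e, Fwd (idm \<Lambda> (esrc \<Lambda> e))]) \<in> walk_equiv \<Lambda>"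
  using assms
proof (cases rule: edge_cases)
  case (Fwd \<kappa>)
  then show ?thesis
    using walk_equiv_trans[OF equiv_idm_Fwd walk_equiv_sym[OF equiv_Fwd_idm]] by simp
next
  case (ghost \<kappa>)
  \<comment> \<open>The walk star-\<kappa>, \<kappa>, star-\<kappa> collapses in two ways, which
    leave the identity on different sides of the star.\<close>
  have 1: "([ghost \<Lambda> \<kappa>, Fwd \<kappa>] @ [ghost \<Lambda> \<kappa>], [Fwd (idm \<Lambda> (src \<Lambda> \<kappa>))] @ [ghost \<Lambda> \<kappa>]) \<in> walk_equiv \<Lambda>"
    using ghost by (intro walk_equiv_append equiv_ghost_Fwd) (simp_all add: walks_Cons)
  have 2: "([ghost \<Lambda> \<kappa>] @ [Fwd \<kappa>, ghost \<Lambda> \<kappa>], [ghost \<Lambda> \<kappa>] @ [Fwd (idm \<Lambda> (rng \<Lambda> \<kappa>))]) \<in> walk_equiv \<Lambda>"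
    using ghost by (intro walk_equiv_append equiv_Fwd_ghost) (simp_all add: walks_Cons)
  show ?thesis using walk_equiv_trans[OF walk_equiv_sym[OF 1]] 2 ghost by simp
qed

lemma equiv_idm_walk:
  assumes "p \<in> walks \<Lambda>"
  shows "(Fwd (idm \<Lambda> (wrng \<Lambda> p)) # p, p @ [Fwd (idm \<Lambda> (wsrc \<Lambda> p))]) \<in> walk_equiv \<Lambda>"
  using assms
proof (induction p rule: walks_induct)
  case (single e)
  then show ?case using equiv_idm_edge by simp
next
  case (Cons e p)
  have 1: "([Fwd (idm \<Lambda> (erng \<Lambda> e)), e] @ p, [e, Fwd (idm \<Lambda> (esrc \<Lambda> e))] @ p) \<in> walk_equiv \<Lambda>"
    using Cons by (intro walk_equiv_append equiv_idm_edge) simp_all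
  have 2: "([e] @ (Fwd (idm \<Lambda> (wrng \<Lambda> p)) # p), [e] @ (p @ [Fwd (idm \<Lambda> (wsrc \<Lambda> p))])) \<in> walk_equiv \<Lambda>"
    using Cons by (intro walk_equiv_append) (simp_all add: walks_Cons rng_idm wrng_in)
  show ?case
    using walk_equiv_trans[OF 1] 2 Cons by (simp add: wsrc_Cons walks_not_Nil)
qed

text \<open>The identity at the right end is moved to the left through the reversed or forward edges
  of \<open>b\<close> until the edge \<open>Fwd \<kappa>\<close> absorbs it.\<close>

lemma equiv_walk_idm:
  assumes "p \<in> walks \<Lambda>" "Fwd \<kappa> \<in> set p"
  shows "(p @ [Fwd (idm \<Lambda> (wsrc \<Lambda> p))], p) \<in> walk_equiv \<Lambda>"
proof -
  obtain a b where p: "p = a @ Fwd \<kappa> # b" using assms(2) by (auto simp: in_set_conv_decomp)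
  have \<kappa>: "\<kappa> \<in> mors \<Lambda>" using assms by (auto simp: walks_def)
  have q: "(Fwd \<kappa> # b @ [Fwd (idm \<Lambda> (wsrc \<Lambda> p))], Fwd \<kappa> # b) \<in> walk_equiv \<Lambda>"
  proof (cases "b = []")
    case True
    then show ?thesis using p equiv_Fwd_idm[OF \<kappa>] by simp
  next
    case False
    have b: "b \<in> walks \<Lambda>" "src \<Lambda> \<kappa> = wrng \<Lambda> b"
      using assms(1) False unfolding p by (cases "a = []"; simp add: walks_append walks_Cons)+
    have 1: "([Fwd \<kappa>, Fwd (idm \<Lambda> (src \<Lambda> \<kappa>))] @ b, [Fwd \<kappa>] @ b) \<in> walk_equiv \<Lambda>"
      using \<kappa> b by (intro walk_equiv_append equiv_Fwd_idm) (simp_all add: src_idm wrng_in)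
    have 2: "([Fwd \<kappa>] @ Fwd (idm \<Lambda> (wrng \<Lambda> b)) # b,
        [Fwd \<kappa>] @ b @ [Fwd (idm \<Lambda> (wsrc \<Lambda> b))]) \<in> walk_equiv \<Lambda>"
      using \<kappa> b by (intro walk_equiv_append equiv_idm_walk) (simp_all add: walks_Cons rng_idm wrng_in)
    have "([Fwd \<kappa>] @ b @ [Fwd (idm \<Lambda> (wsrc \<Lambda> b))], [Fwd \<kappa>] @ b) \<in> walk_equiv \<Lambda>"
      using walk_equiv_trans[OF walk_equiv_sym[OF 2]] 1 b by simp
    then show ?thesis using False p by (simp add: wsrc_Cons)
  qed
  have w: "wsrc \<Lambda> p \<in> objs \<Lambda>" using assms wsrc_in by simp
  have "p @ [Fwd (idm \<Lambda> (wsrc \<Lambda> p))] \<in> walks \<Lambda>"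
    using assms(1) w by (simp add: walks_append walks_not_Nil rng_idm)
  then have "a @ (Fwd \<kappa> # b @ [Fwd (idm \<Lambda> (wsrc \<Lambda> p))]) @ [] \<in> walks \<Lambda>"
    by (simp add: p)
  from walk_equiv_cong[OF q this] show ?thesis by (simp add: p)
qed

lemma equiv_idm_Cons_walk:
  assumes "p \<in> walks \<Lambda>" "Fwd \<kappa> \<in> set p"
  shows "(Fwd (idm \<Lambda> (wrng \<Lambda> p)) # p, p) \<in> walk_equiv \<Lambda>"
  using walk_equiv_trans[OF equiv_idm_walk equiv_walk_idm] assms by blast

lemma equiv_edge_einv:
  assumes "e \<in> edges \<Lambda>"
  shows "([e, einv \<Lambda> e], [Fwd (idm \<Lambda> (erng \<Lambda> e))]) \<in> walk_equiv \<Lambda>"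
proof (cases e)
  case (Fwd \<kappa>)
  then show ?thesis using equiv_Fwd_ghost assms by simp
next
  case (Bwd \<kappa>)
  then show ?thesis using equiv_ghost_Fwd[of \<kappa>] assms by (simp add: Bwd_in_edges ghost_def)
qed

text \<open>The inverse of a reversed edge is forward. Hence \<open>p @ winv \<Lambda> p\<close>
  contains a forward edge even if \<open>p\<close> has none, and it can be cancelled down to an
  identity.\<close>

lemma equiv_walk_winv:
  assumes "p \<in> walks \<Lambda>"
  shows "(p @ winv \<Lambda> p, [Fwd (idm \<Lambda> (wrng \<Lambda> p))]) \<in> walk_equiv \<Lambda>"
  using assms
proof (induction p rule: walks_induct)
  case (single e)
  then show ?case using equiv_edge_einv by simp
next
  case (Cons e p)
  have r: "wrng \<Lambda> p \<in> objs \<Lambda>" using wrng_in Cons by simp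
  have "([e] @ ((p @ winv \<Lambda> p) @ [einv \<Lambda> e]), [e] @ ([Fwd (idm \<Lambda> (wrng \<Lambda> p))] @ [einv \<Lambda> e])) \<in> walk_equiv \<Lambda>"
    using Cons by (intro walk_equiv_append) (simp_all add: winv_in walks_Cons walks_not_Nil)
  \<comment> \<open>The identity left in the middle is absorbed by \<open>e\<close> or by its
    inverse, whichever is forward.\<close>
  also have "([e] @ ([Fwd (idm \<Lambda> (wrng \<Lambda> p))] @ [einv \<Lambda> e]), [e, einv \<Lambda> e]) \<in> walk_equiv \<Lambda>"
  proof (cases e)
    case (Fwd \<kappa>)
    then have "([Fwd \<kappa>, Fwd (idm \<Lambda> (src \<Lambda> \<kappa>))] @ [einv \<Lambda> e], [Fwd \<kappa>] @ [einv \<Lambda> e]) \<in> walk_equiv \<Lambda>"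
      using Cons(1) by (intro walk_equiv_append equiv_Fwd_idm) (simp_all add: walks_Cons src_idm src_in)
    then show ?thesis using Fwd Cons by simp
  next
    case (Bwd \<kappa>)
    then have "([Bwd \<kappa>] @ [Fwd (idm \<Lambda> (rng \<Lambda> \<kappa>)), Fwd \<kappa>], [Bwd \<kappa>] @ [Fwd \<kappa>]) \<in> walk_equiv \<Lambda>"
      using Cons(1) by (intro walk_equiv_append equiv_idm_Fwd) (simp_all add: walks_Cons rng_idm rng_in Bwd_in_edges)
    then show ?thesis using Bwd Cons by simp
  qed
  also have "([e, einv \<Lambda> e], [Fwd (idm \<Lambda> (erng \<Lambda> e))]) \<in> walk_equiv \<Lambda>"
    using equiv_edge_einv Cons by simp
  finally show ?case by simp
qed

lemma wstep_Fwd: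
  assumes "(p, q) \<in> wsteps" shows "(\<exists>\<kappa>. Fwd \<kappa> \<in> set p) \<and> (\<exists>\<kappa>. Fwd \<kappa> \<in> set q)"
proof -
  obtain r s a b where *: "p = r @ a @ s" "q = r @ b @ s" "(a, b) \<in> basic_replacements \<Lambda>"
    using assms by (auto simp: wsteps_def)
  from *(3) show ?thesis unfolding *(1,2) by cases auto
qed

text \<open>This isolates the exceptional walks: their classes are singletons, so a product of
  classes can equal such a class only if the walk itself is the concatenation.\<close>

lemma walk_equiv_no_Fwd:
  assumes "(p, q) \<in> walk_equiv \<Lambda>" "\<And>\<kappa>. Fwd \<kappa> \<notin> set p"
  shows "q = p"
  using assms(1) by (induction rule: walk_equiv_induct) (use assms(2) wstep_Fwd in blast)+

end

lemma (in standing_k_graph) ex_walk: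
  assumes "u \<in> objs \<Lambda>" "v \<in> objs \<Lambda>"
  shows "\<exists>p \<in> walks \<Lambda>. wsrc \<Lambda> p = u \<and> wrng \<Lambda> p = v"
proof -
  let ?R = "{(rng \<Lambda> \<kappa>, src \<Lambda> \<kappa>) | \<kappa>. \<kappa> \<in> mors \<Lambda>}"
  have "(u, v) \<in> (?R \<union> ?R\<inverse>)\<^sup>*"
    using connected assms unfolding equiv_gen_def by blast
  then show ?thesis
  proof (induction rule: rtrancl_induct)
    case base
    show ?case using assms(1) idm_walk src_idm rng_idm
      by (intro bexI[of _ "[Fwd (idm \<Lambda> u)]"]) simp_all
  next
    case (step v w)
    obtain p where p: "p \<in> walks \<Lambda>" "wsrc \<Lambda> p = u" "wrng \<Lambda> p = v" using step.IH by blast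
    obtain e where e: "e \<in> edges \<Lambda>" "esrc \<Lambda> e = v" "erng \<Lambda> e = w"
      using step.hyps(2) by (fastforce intro: Fwd_in_edges[THEN iffD2] dest: ghost_in_edges esrc_ghost erng_ghost)
    show ?case using p e by (intro bexI[of _ "e # p"]) (auto simp: walks_Cons wsrc_Cons walks_not_Nil)
  qed
qed

section \<open>Coverings\<close>

lemma walk_map_simps [simp]:
  "walk_map \<alpha> [] = []" "walk_map \<alpha> (e # p) = map_edge (mmap \<alpha>) e # walk_map \<alpha> p"
  "walk_map \<alpha> (p @ q) = walk_map \<alpha> p @ walk_map \<alpha> q" "walk_map \<alpha> p = [] \<longleftrightarrow> p = []"
  by (simp_all add: walk_map_def)

lemma map_edge_eq_iff:
  "map_edge f e = Fwd \<kappa> \<longleftrightarrow> (\<exists>\<delta>. e = Fwd \<delta> \<and> f \<delta> = \<kappa>)"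
  "map_edge f e = Bwd \<kappa> \<longleftrightarrow> (\<exists>\<delta>. e = Bwd \<delta> \<and> f \<delta> = \<kappa>)"
  by (cases e; auto)+

section \<open>Morphisms of k-graphs acting on walks\<close>

locale kgraph_hom = dom: k_graph \<Omega> + cod: k_graph \<Gamma>
  for \<Omega> :: "('p, 'q, 'k::finite) kgraph" and \<Gamma> :: "('o, 'm, 'k) kgraph" +
  fixes \<pi> :: "('p, 'q, 'o, 'm) kmor"
  assumes morphism: "kgraph_morphism \<Omega> \<Gamma> \<pi>"
begin

lemma hom_simps [simp]:
  "v \<in> objs \<Omega> \<Longrightarrow> omap \<pi> v \<in> objs \<Gamma>"
  "v \<in> objs \<Omega> \<Longrightarrow> mmap \<pi> (idm \<Omega> v) = idm \<Gamma> (omap \<pi> v)"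
  "\<delta> \<in> mors \<Omega> \<Longrightarrow> mmap \<pi> \<delta> \<in> mors \<Gamma>"
  "\<delta> \<in> mors \<Omega> \<Longrightarrow> src \<Gamma> (mmap \<pi> \<delta>) = omap \<pi> (src \<Omega> \<delta>)"
  "\<delta> \<in> mors \<Omega> \<Longrightarrow> rng \<Gamma> (mmap \<pi> \<delta>) = omap \<pi> (rng \<Omega> \<delta>)"
  "\<delta> \<in> mors \<Omega> \<Longrightarrow> deg \<Gamma> (mmap \<pi> \<delta>) = deg \<Omega> \<delta>"
  "\<delta> \<in> mors \<Omega> \<Longrightarrow> \<epsilon> \<in> mors \<Omega> \<Longrightarrow> src \<Omega> \<delta> = rng \<Omega> \<epsilon> \<Longrightarrow>
     mmap \<pi> (cmp \<Omega> \<delta> \<epsilon>) = cmp \<Gamma> (mmap \<pi> \<delta>) (mmap \<pi> \<epsilon>)"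
  using morphism by (auto simp: kgraph_morphism_def)

abbreviation emap :: "'q edge \<Rightarrow> 'm edge" where "emap \<equiv> map_edge (mmap \<pi>)"

lemma emap_ghost: "\<delta> \<in> mors \<Omega> \<Longrightarrow> emap (ghost \<Omega> \<delta>) = ghost \<Gamma> (mmap \<pi> \<delta>)"
  by (simp add: ghost_def)

lemma emap_in [simp]: "e \<in> edges \<Omega> \<Longrightarrow> emap e \<in> edges \<Gamma>"
  and esrc_emap [simp]: "e \<in> edges \<Omega> \<Longrightarrow> esrc \<Gamma> (emap e) = omap \<pi> (esrc \<Omega> e)"
  and erng_emap [simp]: "e \<in> edges \<Omega> \<Longrightarrow> erng \<Gamma> (emap e) = omap \<pi> (erng \<Omega> e)"
  and einv_emap: "e \<in> edges \<Omega> \<Longrightarrow> einv \<Gamma> (emap e) = emap (einv \<Omega> e)"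
  by (cases e; simp add: dom.Bwd_in_edges cod.Bwd_in_edges emap_ghost)+

lemma walk_map_in:
  assumes "p \<in> walks \<Omega>"
  shows "walk_map \<pi> p \<in> walks \<Gamma> \<and> wsrc \<Gamma> (walk_map \<pi> p) = omap \<pi> (wsrc \<Omega> p) \<and>
    wrng \<Gamma> (walk_map \<pi> p) = omap \<pi> (wrng \<Omega> p)"
  using assms by (induction p rule: walks_induct) (auto simp: walks_Cons wsrc_Cons walks_not_Nil)

lemma walk_map_winv: "set p \<subseteq> edges \<Omega> \<Longrightarrow> walk_map \<pi> (winv \<Omega> p) = winv \<Gamma> (walk_map \<pi> p)"
  by (induction p) (auto simp: einv_emap)

lemma walk_map_basic:
  "(a, b) \<in> basic_replacements \<Omega> \<Longrightarrow> (walk_map \<pi> a, walk_map \<pi> b) \<in> basic_replacements \<Gamma>"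
proof (induction rule: basic_replacements.induct)
  case (1 \<kappa>)
  then show ?case using basic_replacements.intros(1)[of "mmap \<pi> \<kappa>" \<Gamma>] by (simp add: dom.rng_in)
next
  case (2 \<kappa>)
  then show ?case using basic_replacements.intros(2)[of "mmap \<pi> \<kappa>" \<Gamma>] by (simp add: dom.src_in)
next
  case (3 \<kappa> \<mu>)
  then show ?case using basic_replacements.intros(3)[of "mmap \<pi> \<kappa>" \<Gamma> "mmap \<pi> \<mu>"] by simp
qed

lemma walk_map_wstep: "(p, q) \<in> dom.wsteps \<Longrightarrow> (walk_map \<pi> p, walk_map \<pi> q) \<in> cod.wsteps"
proof -
  assume "(p, q) \<in> dom.wsteps"
  then obtain r s a b where *: "p = r @ a @ s" "q = r @ b @ s" "(a, b) \<in> basic_replacements \<Omega>"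
      "p \<in> walks \<Omega>" "q \<in> walks \<Omega>"
    by (auto simp: dom.wsteps_def)
  show ?thesis unfolding cod.wsteps_def
    using walk_map_basic[OF *(3)] walk_map_in[OF *(4)] walk_map_in[OF *(5)] unfolding *(1,2)
    by (intro CollectI exI[of _ "walk_map \<pi> r"] exI[of _ "walk_map \<pi> s"] exI[of _ "walk_map \<pi> a"]
        exI[of _ "walk_map \<pi> b"]) simp
qed

lemma walk_map_equiv:
  assumes "(p, q) \<in> walk_equiv \<Omega>"
  shows "(walk_map \<pi> p, walk_map \<pi> q) \<in> walk_equiv \<Gamma>"
  using assms
proof (induction rule: dom.walk_equiv_induct)
  case refl
  then show ?case using dom.walk_equiv_walks[OF assms] walk_map_in by (simp add: cod.walk_equiv_refl)
next
  case (step q r)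
  then show ?case using walk_map_wstep cod.wstep_equiv cod.walk_equiv_trans by blast
next
  case (step_rev q r)
  then show ?case using walk_map_wstep cod.wstep_equiv cod.walk_equiv_sym cod.walk_equiv_trans by blast
qed

end

text \<open>Local injectivity gives uniqueness of lifts. It is separated from local surjectivity
  because a representation graph has the former at sources and ranges, but the latter only at
  sources.\<close>

locale kgraph_immersion = kgraph_hom +
  assumes inj_from: "\<delta> \<in> mors \<Omega> \<Longrightarrow> \<epsilon> \<in> mors \<Omega> \<Longrightarrow> src \<Omega> \<delta> = src \<Omega> \<epsilon> \<Longrightarrow> mmap \<pi> \<delta> = mmap \<pi> \<epsilon> \<Longrightarrow> \<delta> = \<epsilon>"
    and inj_to: "\<delta> \<in> mors \<Omega> \<Longrightarrow> \<epsilon> \<in> mors \<Omega> \<Longrightarrow> rng \<Omega> \<delta> = rng \<Omega> \<epsilon> \<Longrightarrow> mmap \<pi> \<delta> = mmap \<pi> \<epsilon> \<Longrightarrow> \<delta> = \<epsilon>"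
begin

lemma edge_unique:
  assumes "e \<in> edges \<Omega>" "f \<in> edges \<Omega>" "esrc \<Omega> e = esrc \<Omega> f" "emap e = emap f"
  shows "e = f"
  using assms by (cases e; cases f) (auto simp: dom.Bwd_in_edges dest: inj_from inj_to)

lemma walk_unique:
  assumes "p \<in> walks \<Omega>" "q \<in> walks \<Omega>" "wsrc \<Omega> p = wsrc \<Omega> q" "walk_map \<pi> p = walk_map \<pi> q"
  shows "p = q"
  using assms
proof (induction p arbitrary: q rule: walks_induct)
  case (single e)
  then obtain f where "q = [f]" by (auto simp: walk_map_def)
  then show ?case using single edge_unique by (simp add: walks_Cons)
next
  case (Cons e p)
  then obtain f q' where q: "q = f # q'" by (cases q) auto
  moreover from this have "q' \<noteq> []"
    using Cons.prems(3) walks_not_Nil[OF Cons.hyps(2)] by (cases q') auto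
  ultimately have q: "q = f # q'" "q' \<noteq> []" by simp_all
  have "p = q'"
    using Cons.prems Cons.hyps q walks_not_Nil[OF Cons.hyps(2)]
    by (intro Cons.IH) (simp_all add: walks_Cons wsrc_Cons)
  then show ?case
    using Cons.prems Cons.hyps q by (auto simp: walks_Cons intro: edge_unique)
qed

end

locale kgraph_covering = kgraph_immersion +
  assumes lift_from: "v \<in> objs \<Omega> \<Longrightarrow> \<kappa> \<in> mors \<Gamma> \<Longrightarrow> src \<Gamma> \<kappa> = omap \<pi> v \<Longrightarrow>
      \<exists>\<delta> \<in> mors \<Omega>. src \<Omega> \<delta> = v \<and> mmap \<pi> \<delta> = \<kappa>"
    and lift_to: "v \<in> objs \<Omega> \<Longrightarrow> \<kappa> \<in> mors \<Gamma> \<Longrightarrow> rng \<Gamma> \<kappa> = omap \<pi> v \<Longrightarrow>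
      \<exists>\<delta> \<in> mors \<Omega>. rng \<Omega> \<delta> = v \<and> mmap \<pi> \<delta> = \<kappa>"
begin

lemma edge_lift:
  assumes "v \<in> objs \<Omega>" "g \<in> edges \<Gamma>" "esrc \<Gamma> g = omap \<pi> v"
  shows "\<exists>e \<in> edges \<Omega>. esrc \<Omega> e = v \<and> emap e = g"
proof (cases g)
  case (Fwd \<kappa>)
  then obtain \<delta> where "\<delta> \<in> mors \<Omega>" "src \<Omega> \<delta> = v" "mmap \<pi> \<delta> = \<kappa>"
    using lift_from[of v \<kappa>] assms by auto
  then show ?thesis using Fwd by (intro bexI[of _ "Fwd \<delta>"]) auto
next
  case (Bwd \<kappa>)
  then obtain \<delta> where "\<delta> \<in> mors \<Omega>" "rng \<Omega> \<delta> = v" "mmap \<pi> \<delta> = \<kappa>"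
    using lift_to[of v \<kappa>] assms by (auto simp: cod.Bwd_in_edges)
  then show ?thesis using Bwd assms(2)
    by (intro bexI[of _ "Bwd \<delta>"]) (auto simp: cod.Bwd_in_edges dom.Bwd_in_edges)
qed

lemma walk_lift:
  assumes "P \<in> walks \<Gamma>" "v \<in> objs \<Omega>" "wsrc \<Gamma> P = omap \<pi> v"
  shows "\<exists>p \<in> walks \<Omega>. wsrc \<Omega> p = v \<and> walk_map \<pi> p = P"
  using assms
proof (induction P rule: walks_induct)
  case (single g)
  then obtain e where "e \<in> edges \<Omega>" "esrc \<Omega> e = v" "emap e = g" using edge_lift by auto
  then show ?case by (intro bexI[of _ "[e]"]) (simp_all add: walks_Cons)
next
  case (Cons g P)
  then obtain p where p: "p \<in> walks \<Omega>" "wsrc \<Omega> p = v" "walk_map \<pi> p = P"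
    by (auto simp: wsrc_Cons walks_not_Nil)
  moreover obtain e where "e \<in> edges \<Omega>" "esrc \<Omega> e = wrng \<Omega> p" "emap e = g"
    using edge_lift[of "wrng \<Omega> p" g] Cons p walk_map_in dom.wrng_in by metis
  ultimately show ?case
    by (intro bexI[of _ "e # p"]) (simp_all add: walks_Cons wsrc_Cons walks_not_Nil)
qed

text \<open>In the first two cases the two edges of the lift share an end and a label, so
  injectivity there makes their morphisms equal. A composite is handled by lifting its right factor
  first, then the left one; injectivity at the source identifies the result with the given
  lift.\<close>

lemma basic_lift:
  assumes "(a, b) \<in> basic_replacements \<Gamma>" "a' \<in> walks \<Omega>" "walk_map \<pi> a' = a"
  shows "\<exists>b'. (a', b') \<in> basic_replacements \<Omega> \<and> b' \<in> walks \<Omega> \<and> walk_map \<pi> b' = b"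
  using assms(1)
proof cases
  case (1 \<kappa>)
  then obtain e f where a': "a' = [e, f]" "emap e = Fwd \<kappa>" "emap f = Bwd \<kappa>"
    using assms(3) by (auto simp: walk_map_def)
  then obtain \<delta> \<epsilon> where a': "a' = [Fwd \<delta>, Bwd \<epsilon>]" and *: "mmap \<pi> \<delta> = \<kappa>" "mmap \<pi> \<epsilon> = \<kappa>"
    by (cases e; cases f) simp_all
  then have \<delta>: "\<delta> \<in> mors \<Omega>" and \<epsilon>: "\<epsilon> \<in> mors \<Omega>" "src \<Omega> \<delta> = src \<Omega> \<epsilon>"
    using assms(2) by (simp_all add: walks_Cons dom.Bwd_in_edges)
  have "\<delta> = \<epsilon>" by (rule inj_from[OF \<delta> \<epsilon>]) (simp only: *)
  moreover have "rng \<Gamma> \<kappa> = omap \<pi> (rng \<Omega> \<delta>)" using * \<delta> by auto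
  ultimately show ?thesis using 1 a' * \<delta> basic_replacements.intros(1)[of \<delta> \<Omega>]
    by (intro exI[of _ "[Fwd (idm \<Omega> (rng \<Omega> \<delta>))]"]) (simp add: dom.rng_in)
next
  case (2 \<kappa>)
  then obtain e f where a': "a' = [e, f]" "emap e = Bwd \<kappa>" "emap f = Fwd \<kappa>"
    using assms(3) by (auto simp: walk_map_def)
  then obtain \<delta> \<epsilon> where a': "a' = [Bwd \<epsilon>, Fwd \<delta>]" and *: "mmap \<pi> \<delta> = \<kappa>" "mmap \<pi> \<epsilon> = \<kappa>"
    by (cases e; cases f) simp_all
  then have \<delta>: "\<delta> \<in> mors \<Omega>" and \<epsilon>: "\<epsilon> \<in> mors \<Omega>" "rng \<Omega> \<delta> = rng \<Omega> \<epsilon>"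
    using assms(2) by (simp_all add: walks_Cons dom.Bwd_in_edges)
  have "\<delta> = \<epsilon>" by (rule inj_to[OF \<delta> \<epsilon>]) (simp only: *)
  moreover have "src \<Gamma> \<kappa> = omap \<pi> (src \<Omega> \<delta>)" using * \<delta> by auto
  ultimately show ?thesis using 2 a' * \<delta> basic_replacements.intros(2)[of \<delta> \<Omega>]
    by (intro exI[of _ "[Fwd (idm \<Omega> (src \<Omega> \<delta>))]"]) (simp add: dom.src_in)
next
  case (3 \<kappa> \<mu>)
  then obtain \<delta> where a': "a' = [Fwd \<delta>]" "mmap \<pi> \<delta> = cmp \<Gamma> \<kappa> \<mu>"
    using assms(3) by (auto simp: walk_map_def map_edge_eq_iff)
  then have \<delta>: "\<delta> \<in> mors \<Omega>" using assms(2) by (simp add: walks_Cons)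
  then have "src \<Gamma> \<mu> = omap \<pi> (src \<Omega> \<delta>)" using 3 a' cod.src_cmp hom_simps(4) by metis
  then obtain \<nu> where \<nu>: "\<nu> \<in> mors \<Omega>" "src \<Omega> \<nu> = src \<Omega> \<delta>" "mmap \<pi> \<nu> = \<mu>"
    using lift_from \<delta> dom.src_in 3 by metis
  then obtain \<rho> where \<rho>: "\<rho> \<in> mors \<Omega>" "src \<Omega> \<rho> = rng \<Omega> \<nu>" "mmap \<pi> \<rho> = \<kappa>"
    using lift_from[of "rng \<Omega> \<nu>" \<kappa>] dom.rng_in 3 by auto
  have "cmp \<Omega> \<rho> \<nu> = \<delta>"
    using \<nu> \<rho> a' \<delta> 3 by (intro inj_from) (simp_all add: dom.cmp_in dom.src_cmp)
  then show ?thesis using a' \<nu> \<rho> 3 basic_replacements.intros(3)[of \<rho> \<Omega> \<nu>]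
    by (intro exI[of _ "[Fwd \<rho>, Fwd \<nu>]"]) (simp add: walks_Cons)
qed

text \<open>A lift of an identity has degree 0 and is therefore an identity; \<kappa> is then lifted
  at its range or at its source. That \<open>a\<close> is a walk ensures that \<kappa> has nonzero
  degree, so that the reversed lift is an edge.\<close>

lemma basic_lift_rev:
  assumes "(a, b) \<in> basic_replacements \<Gamma>" "a \<in> walks \<Gamma>" "b' \<in> walks \<Omega>" "walk_map \<pi> b' = b"
  shows "\<exists>a'. (a', b') \<in> basic_replacements \<Omega> \<and> a' \<in> walks \<Omega> \<and> walk_map \<pi> a' = a"
  using assms(1)
proof cases
  case (1 \<kappa>)
  then obtain \<epsilon> where b': "b' = [Fwd \<epsilon>]" "mmap \<pi> \<epsilon> = idm \<Gamma> (rng \<Gamma> \<kappa>)"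
    using assms(4) by (auto simp: walk_map_def map_edge_eq_iff)
  then have \<epsilon>: "\<epsilon> \<in> mors \<Omega>" using assms(3) by (simp add: walks_Cons)
  have "deg \<Omega> \<epsilon> = 0" using b' \<epsilon> hom_simps(6)[OF \<epsilon>] 1 by (simp add: cod.deg_idm cod.rng_in)
  then have \<epsilon>': "\<epsilon> = idm \<Omega> (rng \<Omega> \<epsilon>)" using dom.deg_0_imp_idm(1,2)[OF \<epsilon>] by simp
  have "rng \<Gamma> \<kappa> = omap \<pi> (rng \<Omega> \<epsilon>)"
    using b' \<epsilon> 1 hom_simps(5)[OF \<epsilon>] by (simp add: cod.rng_idm cod.rng_in)
  then obtain \<delta> where \<delta>: "\<delta> \<in> mors \<Omega>" "rng \<Omega> \<delta> = rng \<Omega> \<epsilon>" "mmap \<pi> \<delta> = \<kappa>"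
    using lift_to \<epsilon> dom.rng_in 1 by metis
  have "deg \<Omega> \<delta> \<noteq> 0" using 1 \<delta> assms(2) by (auto simp: walks_Cons cod.Bwd_in_edges)
  then show ?thesis using \<delta> 1 b' \<epsilon>' basic_replacements.intros(1)[OF \<delta>(1)]
    by (intro exI[of _ "[Fwd \<delta>, Bwd \<delta>]"]) (simp add: walks_Cons dom.Bwd_in_edges)
next
  case (2 \<kappa>)
  then obtain \<epsilon> where b': "b' = [Fwd \<epsilon>]" "mmap \<pi> \<epsilon> = idm \<Gamma> (src \<Gamma> \<kappa>)"
    using assms(4) by (auto simp: walk_map_def map_edge_eq_iff)
  then have \<epsilon>: "\<epsilon> \<in> mors \<Omega>" using assms(3) by (simp add: walks_Cons)
  have "deg \<Omega> \<epsilon> = 0" using b' \<epsilon> hom_simps(6)[OF \<epsilon>] 2 by (simp add: cod.deg_idm cod.src_in)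
  then have \<epsilon>': "\<epsilon> = idm \<Omega> (src \<Omega> \<epsilon>)" using dom.deg_0_imp_idm(1,2)[OF \<epsilon>] by simp
  have "src \<Gamma> \<kappa> = omap \<pi> (src \<Omega> \<epsilon>)"
    using b' \<epsilon> 2 hom_simps(4)[OF \<epsilon>] by (simp add: cod.src_idm cod.src_in)
  then obtain \<delta> where \<delta>: "\<delta> \<in> mors \<Omega>" "src \<Omega> \<delta> = src \<Omega> \<epsilon>" "mmap \<pi> \<delta> = \<kappa>"
    using lift_from \<epsilon> dom.src_in 2 by metis
  have "deg \<Omega> \<delta> \<noteq> 0" using 2 \<delta> assms(2) by (auto simp: walks_Cons cod.Bwd_in_edges)
  then show ?thesis using \<delta> 2 b' \<epsilon>' basic_replacements.intros(2)[OF \<delta>(1)]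
    by (intro exI[of _ "[Bwd \<delta>, Fwd \<delta>]"]) (simp add: walks_Cons dom.Bwd_in_edges)
next
  case (3 \<kappa> \<mu>)
  then obtain e f where b': "b' = [e, f]" "emap e = Fwd \<kappa>" "emap f = Fwd \<mu>"
    using assms(4) by (auto simp: walk_map_def)
  then obtain \<delta> \<epsilon> where b': "b' = [Fwd \<delta>, Fwd \<epsilon>]" and *: "mmap \<pi> \<delta> = \<kappa>" "mmap \<pi> \<epsilon> = \<mu>"
    by (cases e; cases f) simp_all
  then have "\<delta> \<in> mors \<Omega>" "\<epsilon> \<in> mors \<Omega>" "src \<Omega> \<delta> = rng \<Omega> \<epsilon>" using assms(3) by (simp_all add: walks_Cons)
  then show ?thesis using b' * 3 basic_replacements.intros(3)[of \<delta> \<Omega> \<epsilon>]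
    by (intro exI[of _ "[Fwd (cmp \<Omega> \<delta> \<epsilon>)]"]) (simp add: walks_Cons dom.cmp_in)
qed

section \<open>Lifting equivalences of walks\<close>

lemma walk_map_split:
  assumes "walk_map \<pi> p = P @ Q"
  obtains p1 p2 where "p = p1 @ p2" "walk_map \<pi> p1 = P" "walk_map \<pi> p2 = Q"
  using assms unfolding walk_map_def by (metis map_eq_append_conv)

lemma wstep_replace:
  assumes "r @ a @ s \<in> walks \<Omega>" "(a, b) \<in> basic_replacements \<Omega> \<or> (b, a) \<in> basic_replacements \<Omega>"
    and "b \<in> walks \<Omega>"
  shows "r @ b @ s \<in> walks \<Omega>" "wsrc \<Omega> (r @ b @ s) = wsrc \<Omega> (r @ a @ s)"
proof -
  have "wsrc \<Omega> a = wsrc \<Omega> b" "wrng \<Omega> a = wrng \<Omega> b" "a \<noteq> []" "b \<noteq> []"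
    using assms(2) dom.basic_ends dom.basic_not_Nil by metis+
  then show "r @ b @ s \<in> walks \<Omega>" "wsrc \<Omega> (r @ b @ s) = wsrc \<Omega> (r @ a @ s)"
    using assms(1,3) by (cases "r = []"; cases "s = []"; simp add: walks_append)+
qed

lemma wstep_lift:
  assumes "(P, Q) \<in> cod.wsteps" "p \<in> walks \<Omega>" "walk_map \<pi> p = P"
  shows "\<exists>q. (p, q) \<in> dom.wsteps \<and> walk_map \<pi> q = Q"
proof -
  obtain R S a b where *: "P = R @ a @ S" "Q = R @ b @ S" "(a, b) \<in> basic_replacements \<Gamma>"
    using assms(1) by (auto simp: cod.wsteps_def)
  obtain r a' s where p: "p = r @ a' @ s" "walk_map \<pi> r = R" "walk_map \<pi> a' = a" "walk_map \<pi> s = S"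
    using assms(3) * by (metis walk_map_split)
  have "a' \<in> walks \<Omega>" using assms(2) p *(3) cod.basic_not_Nil sublist_walk by (metis walk_map_simps(4))
  then obtain b' where b': "(a', b') \<in> basic_replacements \<Omega>" "b' \<in> walks \<Omega>" "walk_map \<pi> b' = b"
    using basic_lift *(3) p by blast
  show ?thesis
    using wstep_replace(1)[of r a' s b'] b' p * assms(2)
    by (intro exI[of _ "r @ b' @ s"]) (auto simp: dom.wsteps_def)
qed

lemma wstep_lift_rev:
  assumes "(P, Q) \<in> cod.wsteps" "q \<in> walks \<Omega>" "walk_map \<pi> q = Q"
  shows "\<exists>p. (p, q) \<in> dom.wsteps \<and> walk_map \<pi> p = P"
proof -
  obtain R S a b where *: "P = R @ a @ S" "Q = R @ b @ S" "(a, b) \<in> basic_replacements \<Gamma>" "P \<in> walks \<Gamma>"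
    using assms(1) by (auto simp: cod.wsteps_def)
  obtain r b' s where q: "q = r @ b' @ s" "walk_map \<pi> r = R" "walk_map \<pi> b' = b" "walk_map \<pi> s = S"
    using assms(3) * by (metis walk_map_split)
  have "b' \<in> walks \<Omega>" using assms(2) q *(3) cod.basic_not_Nil sublist_walk by (metis walk_map_simps(4))
  moreover have "a \<in> walks \<Gamma>" using * cod.basic_not_Nil sublist_walk by metis
  ultimately obtain a' where a': "(a', b') \<in> basic_replacements \<Omega>" "a' \<in> walks \<Omega>" "walk_map \<pi> a' = a"
    using basic_lift_rev *(3) q by blast
  show ?thesis
    using wstep_replace(1)[of r b' s a'] a' q * assms(2)
    by (intro exI[of _ "r @ a' @ s"]) (auto simp: dom.wsteps_def)
qed

text \<open>The analogue of homotopy lifting: the chain of replacements is lifted one step at a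
  time, each at the walk reached so far.\<close>

lemma walk_equiv_lift:
  assumes "(P, Q) \<in> walk_equiv \<Gamma>" "p \<in> walks \<Omega>" "walk_map \<pi> p = P"
  shows "\<exists>q. (p, q) \<in> walk_equiv \<Omega> \<and> walk_map \<pi> q = Q"
  using assms(1)
proof (induction rule: cod.walk_equiv_induct)
  case refl
  then show ?case using assms(2,3) by (intro exI[of _ p]) simp
next
  case (step Q R)
  then obtain q where q: "(p, q) \<in> walk_equiv \<Omega>" "walk_map \<pi> q = Q" by blast
  then obtain r where "(q, r) \<in> dom.wsteps" "walk_map \<pi> r = R"
    using wstep_lift[OF step.hyps(2)] dom.walk_equiv_walks by blast
  then show ?case using q(1) dom.wstep_equiv dom.walk_equiv_trans by blast
next
  case (step_rev Q R)
  then obtain q where q: "(p, q) \<in> walk_equiv \<Omega>" "walk_map \<pi> q = Q" by blast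
  then obtain r where "(r, q) \<in> dom.wsteps" "walk_map \<pi> r = R"
    using wstep_lift_rev[OF step_rev.hyps(2)] dom.walk_equiv_walks by blast
  then show ?case using q(1) dom.wstep_equiv dom.walk_equiv_sym dom.walk_equiv_trans by blast
qed

text \<open>Coverings are faithful on fundamental groupoids: the lifted chain ends at a walk with
  the start and the label of \<open>q\<close>, which is \<open>q\<close> by unique lifting.\<close>

lemma walk_equiv_lift_same_source:
  assumes "(walk_map \<pi> p, walk_map \<pi> q) \<in> walk_equiv \<Gamma>" "p \<in> walks \<Omega>" "q \<in> walks \<Omega>"
    and "wsrc \<Omega> p = wsrc \<Omega> q"
  shows "(p, q) \<in> walk_equiv \<Omega>"
proof -
  obtain r where r: "(p, r) \<in> walk_equiv \<Omega>" "walk_map \<pi> r = walk_map \<pi> q"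
    using walk_equiv_lift assms(1,2) by blast
  then have "r = q"
    using assms(3,4) dom.walk_equiv_walks[OF r(1)] dom.walk_equiv_ends[OF r(1)] by (intro walk_unique) simp_all
  with r(1) show ?thesis by simp
qed

end

lemma covering_imp_kgraph_covering:
  assumes "k_graph \<Delta>" "covering \<Delta> \<Omega> \<tau>"
  shows "kgraph_covering \<Omega> \<Delta> \<tau>"
proof -
  have std: "standing_k_graph \<Omega>" and mor: "kgraph_morphism \<Omega> \<Delta> \<tau>"
    and bij: "\<And>v. v \<in> objs \<Omega> \<Longrightarrow> bij_betw (mmap \<tau>) (mors_from \<Omega> v) (mors_from \<Delta> (omap \<tau> v))"
      "\<And>v. v \<in> objs \<Omega> \<Longrightarrow> bij_betw (mmap \<tau>) (mors_to \<Omega> v) (mors_to \<Delta> (omap \<tau> v))"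
    using assms(2) by (auto simp: covering_def)
  interpret dom: standing_k_graph \<Omega> by (rule std)
  interpret cod: k_graph \<Delta> by (rule assms(1))
  show ?thesis
  proof
    show "kgraph_morphism \<Omega> \<Delta> \<tau>" by (rule mor)
    show "\<delta> = \<epsilon>" if "\<delta> \<in> mors \<Omega>" "\<epsilon> \<in> mors \<Omega>" "src \<Omega> \<delta> = src \<Omega> \<epsilon>" "mmap \<tau> \<delta> = mmap \<tau> \<epsilon>" for \<delta> \<epsilon>
      using bij_betw_imp_inj_on[OF bij(1)[of "src \<Omega> \<delta>"]] that dom.src_in
      by (auto dest!: inj_onD simp: mors_from_def)
    show "\<delta> = \<epsilon>" if "\<delta> \<in> mors \<Omega>" "\<epsilon> \<in> mors \<Omega>" "rng \<Omega> \<delta> = rng \<Omega> \<epsilon>" "mmap \<tau> \<delta> = mmap \<tau> \<epsilon>" for \<delta> \<epsilon>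
      using bij_betw_imp_inj_on[OF bij(2)[of "rng \<Omega> \<delta>"]] that dom.rng_in
      by (auto dest!: inj_onD simp: mors_to_def)
    show "\<exists>\<delta>\<in>mors \<Omega>. src \<Omega> \<delta> = v \<and> mmap \<tau> \<delta> = \<kappa>"
      if "v \<in> objs \<Omega>" "\<kappa> \<in> mors \<Delta>" "src \<Delta> \<kappa> = omap \<tau> v" for v \<kappa>
    proof -
      have "\<kappa> \<in> mmap \<tau> ` mors_from \<Omega> v"
        using bij_betw_imp_surj_on[OF bij(1)[of v]] that by (simp add: mors_from_def)
      then show ?thesis by (auto simp: mors_from_def)
    qed
    show "\<exists>\<delta>\<in>mors \<Omega>. rng \<Omega> \<delta> = v \<and> mmap \<tau> \<delta> = \<kappa>"
      if "v \<in> objs \<Omega>" "\<kappa> \<in> mors \<Delta>" "rng \<Delta> \<kappa> = omap \<tau> v" for v \<kappa>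
    proof -
      have "\<kappa> \<in> mmap \<tau> ` mors_to \<Omega> v"
        using bij_betw_imp_surj_on[OF bij(2)[of v]] that by (simp add: mors_to_def)
      then show ?thesis by (auto simp: mors_to_def)
    qed
  qed
qed

section \<open>The universal covering\<close>

context k_graph
begin

lemma connected_if_walks:
  assumes "x \<in> objs \<Lambda>" "\<And>v. v \<in> objs \<Lambda> \<Longrightarrow> \<exists>p \<in> walks \<Lambda>. wsrc \<Lambda> p = x \<and> wrng \<Lambda> p = v"
  shows "equiv_gen (objs \<Lambda>) {(rng \<Lambda> \<kappa>, src \<Lambda> \<kappa>) | \<kappa>. \<kappa> \<in> mors \<Lambda>} = objs \<Lambda> \<times> objs \<Lambda>"
proof -
  let ?R = "{(rng \<Lambda> \<kappa>, src \<Lambda> \<kappa>) | \<kappa>. \<kappa> \<in> mors \<Lambda>}"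
  have e: "(esrc \<Lambda> e, erng \<Lambda> e) \<in> ?R \<union> ?R\<inverse>" if "e \<in> edges \<Lambda>" for e
    using that by (cases e) (auto simp: Bwd_in_edges)
  have w: "(wsrc \<Lambda> p, wrng \<Lambda> p) \<in> (?R \<union> ?R\<inverse>)\<^sup>*" if "p \<in> walks \<Lambda>" for p
    using that
  proof (induction p rule: walks_induct)
    case (single f)
    then show ?case using e[of f] by (simp add: r_into_rtrancl)
  next
    case (Cons f p)
    then have "(wrng \<Lambda> p, wrng \<Lambda> (f # p)) \<in> ?R \<union> ?R\<inverse>" using e[of f] by simp
    then show ?case
      using rtrancl_into_rtrancl[OF Cons.IH] Cons.hyps by (simp add: wsrc_Cons walks_not_Nil)
  qed
  have s: "sym ((?R \<union> ?R\<inverse>)\<^sup>*)" by (intro sym_rtrancl sym_Un_converse)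
  have "(u, v) \<in> (?R \<union> ?R\<inverse>)\<^sup>*" if uv: "u \<in> objs \<Lambda>" "v \<in> objs \<Lambda>" for u v
  proof -
    obtain p q where "p \<in> walks \<Lambda>" "wsrc \<Lambda> p = x" "wrng \<Lambda> p = u"
      and "q \<in> walks \<Lambda>" "wsrc \<Lambda> q = x" "wrng \<Lambda> q = v"
      using assms(2)[OF uv(1)] assms(2)[OF uv(2)] by blast
    then have "(x, u) \<in> (?R \<union> ?R\<inverse>)\<^sup>*" "(x, v) \<in> (?R \<union> ?R\<inverse>)\<^sup>*"
      using w[of p] w[of q] by simp_all
    then show ?thesis by (rule rtrancl_trans[OF symD[OF s]])
  qed
  then have "objs \<Lambda> \<times> objs \<Lambda> \<subseteq> (?R \<union> ?R\<inverse>)\<^sup>*" by (intro subrelI) (erule SigmaE2)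
  then show ?thesis unfolding equiv_gen_def by (rule Int_absorb1)
qed

end

text \<open>Row-finiteness and absence of sources concern the morphisms into one vertex and pass
  from \<Gamma> to \<Omega> along the bijections there. Connectedness is the one standing assumption
  that is not local.\<close>

lemma (in kgraph_covering) covering_if_connected:
  assumes "standing_k_graph \<Gamma>" "x \<in> objs \<Omega>"
    and "\<And>v. v \<in> objs \<Omega> \<Longrightarrow> \<exists>p \<in> walks \<Omega>. wsrc \<Omega> p = x \<and> wrng \<Omega> p = v"
  shows "covering \<Gamma> \<Omega> \<pi>"
proof -
  interpret std: standing_k_graph \<Gamma> by (rule assms(1))
  have to: "inj_on (mmap \<pi>) (mors_to \<Omega> v)" "mmap \<pi> ` mors_to \<Omega> v = mors_to \<Gamma> (omap \<pi> v)"
    if "v \<in> objs \<Omega>" for v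
  proof -
    show "inj_on (mmap \<pi>) (mors_to \<Omega> v)"
      by (rule inj_onI, rule inj_to) (simp_all add: mors_to_def)
    show "mmap \<pi> ` mors_to \<Omega> v = mors_to \<Gamma> (omap \<pi> v)"
      using lift_to[OF that] by (fastforce simp: mors_to_def)
  qed
  have from': "inj_on (mmap \<pi>) (mors_from \<Omega> v)" "mmap \<pi> ` mors_from \<Omega> v = mors_from \<Gamma> (omap \<pi> v)"
    if "v \<in> objs \<Omega>" for v
  proof -
    show "inj_on (mmap \<pi>) (mors_from \<Omega> v)"
      by (rule inj_onI, rule inj_from) (simp_all add: mors_from_def)
    show "mmap \<pi> ` mors_from \<Omega> v = mors_from \<Gamma> (omap \<pi> v)"
      using lift_from[OF that] by (fastforce simp: mors_from_def)
  qed
  have deg: "mmap \<pi> ` mors_to_deg \<Omega> v n = mors_to_deg \<Gamma> (omap \<pi> v) n" if "v \<in> objs \<Omega>" for v n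
  proof -
    have "mmap \<pi> ` mors_to_deg \<Omega> v n = {\<kappa> \<in> mmap \<pi> ` mors_to \<Omega> v. deg \<Gamma> \<kappa> = n}"
      by (auto simp: mors_to_deg_def mors_to_def)
    then show ?thesis using to(2)[OF that] by (simp add: mors_to_deg_def)
  qed
  have "standing_k_graph \<Omega>"
  proof
    show "objs \<Omega> \<noteq> {}" using assms(2) by auto
    show "equiv_gen (objs \<Omega>) {(rng \<Omega> \<kappa>, src \<Omega> \<kappa>) |\<kappa>. \<kappa> \<in> mors \<Omega>} = objs \<Omega> \<times> objs \<Omega>"
      using assms(2,3) by (rule dom.connected_if_walks)
    fix v n assume v: "v \<in> objs \<Omega>"
    have "inj_on (mmap \<pi>) (mors_to_deg \<Omega> v n)"
      using to(1)[OF v] by (rule inj_on_subset) (auto simp: mors_to_deg_def)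
    then show "finite (mors_to_deg \<Omega> v n)"
      using std.row_finite[of "omap \<pi> v" n] deg[OF v, of n] v finite_image_iff by fastforce
    show "mors_to_deg \<Omega> v n \<noteq> {}"
      using std.no_sources[of "omap \<pi> v" n] deg[OF v, of n] v by auto
  qed
  then show ?thesis
    by (simp add: covering_def bij_betw_def morphism to from')
qed

text \<open>A functorial action of \<Delta> by bijections between the fibres of \<open>t\<close>
  amounts to a covering with vertex set \<open>A\<close> (its category of elements). A morphism is a
  pair of a starting vertex and a morphism of \<Delta>; \<open>J\<close> packs such pairs into a
  prescribed type.\<close>

locale kgraph_action = k_graph \<Delta> for \<Delta> :: "('o, 'm, 'k::finite) kgraph" +
  fixes A :: "'s set" and t :: "'s \<Rightarrow> 'o" and act :: "'m \<Rightarrow> 's \<Rightarrow> 's" and J :: "'s \<times> 'm \<Rightarrow> 'n"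
  assumes inj_J: "inj J"
    and t_in: "a \<in> A \<Longrightarrow> t a \<in> objs \<Delta>"
    and act_in: "\<delta> \<in> mors \<Delta> \<Longrightarrow> a \<in> A \<Longrightarrow> t a = src \<Delta> \<delta> \<Longrightarrow> act \<delta> a \<in> A"
    and t_act: "\<delta> \<in> mors \<Delta> \<Longrightarrow> a \<in> A \<Longrightarrow> t a = src \<Delta> \<delta> \<Longrightarrow> t (act \<delta> a) = rng \<Delta> \<delta>"
    and act_idm: "a \<in> A \<Longrightarrow> act (idm \<Delta> (t a)) a = a"
    and act_cmp: "\<kappa> \<in> mors \<Delta> \<Longrightarrow> \<mu> \<in> mors \<Delta> \<Longrightarrow> src \<Delta> \<kappa> = rng \<Delta> \<mu> \<Longrightarrow> a \<in> A \<Longrightarrow> t a = src \<Delta> \<mu> \<Longrightarrow>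
      act (cmp \<Delta> \<kappa> \<mu>) a = act \<kappa> (act \<mu> a)"
    and act_inj: "\<delta> \<in> mors \<Delta> \<Longrightarrow> a \<in> A \<Longrightarrow> b \<in> A \<Longrightarrow> t a = src \<Delta> \<delta> \<Longrightarrow> t b = src \<Delta> \<delta> \<Longrightarrow>
      act \<delta> a = act \<delta> b \<Longrightarrow> a = b"
    and act_surj: "\<delta> \<in> mors \<Delta> \<Longrightarrow> b \<in> A \<Longrightarrow> t b = rng \<Delta> \<delta> \<Longrightarrow> \<exists>a \<in> A. t a = src \<Delta> \<delta> \<and> act \<delta> a = b"
begin

definition action_graph :: "('s, 'n, 'k) kgraph" where
  "action_graph =
     \<lparr>objs = A, mors = J ` {(a, \<delta>). a \<in> A \<and> \<delta> \<in> mors \<Delta> \<and> t a = src \<Delta> \<delta>},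
      src = (\<lambda>m. fst (inv_into UNIV J m)),
      rng = (\<lambda>m. act (snd (inv_into UNIV J m)) (fst (inv_into UNIV J m))),
      idm = (\<lambda>a. J (a, idm \<Delta> (t a))),
      cmp = (\<lambda>m n. J (fst (inv_into UNIV J n), cmp \<Delta> (snd (inv_into UNIV J m)) (snd (inv_into UNIV J n)))),
      deg = (\<lambda>m. deg \<Delta> (snd (inv_into UNIV J m)))\<rparr>"

definition action_proj :: "('s, 'n, 'o, 'm) kmor" where
  "action_proj = \<lparr>omap = t, mmap = (\<lambda>m. snd (inv_into UNIV J m))\<rparr>"

lemma action_graph_simps [simp]:
  "objs action_graph = A"
  "src action_graph (J (a, \<delta>)) = a"
  "rng action_graph (J (a, \<delta>)) = act \<delta> a"
  "idm action_graph a = J (a, idm \<Delta> (t a))"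
  "cmp action_graph (J (b, \<kappa>)) (J (a, \<mu>)) = J (a, cmp \<Delta> \<kappa> \<mu>)"
  "deg action_graph (J (a, \<delta>)) = deg \<Delta> \<delta>"
  "omap action_proj = t" "mmap action_proj (J (a, \<delta>)) = \<delta>"
  by (simp_all add: action_graph_def action_proj_def inj_J)

lemma J_eq [simp]: "J x = J y \<longleftrightarrow> x = y"
  using inj_J by (auto dest: injD)

lemma action_mors: "m \<in> mors action_graph \<longleftrightarrow> (\<exists>a \<delta>. m = J (a, \<delta>) \<and> a \<in> A \<and> \<delta> \<in> mors \<Delta> \<and> t a = src \<Delta> \<delta>)"
  by (auto simp: action_graph_def)

lemma J_in_mors [simp]: "J (a, \<delta>) \<in> mors action_graph \<longleftrightarrow> a \<in> A \<and> \<delta> \<in> mors \<Delta> \<and> t a = src \<Delta> \<delta>"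
  by (auto simp: action_graph_def)

lemma k_graph_action: "k_graph action_graph"
proof
  fix v assume "v \<in> objs action_graph"
  then show "idm action_graph v \<in> mors action_graph" "src action_graph (idm action_graph v) = v"
    "rng action_graph (idm action_graph v) = v" "deg action_graph (idm action_graph v) = 0"
    by (simp_all add: idm_in t_in src_idm act_idm deg_idm)
next
  fix \<kappa> assume "\<kappa> \<in> mors action_graph"
  then obtain a \<delta> where *: "\<kappa> = J (a, \<delta>)" "a \<in> A" "\<delta> \<in> mors \<Delta>" "t a = src \<Delta> \<delta>"
    by (auto simp: action_mors)
  show "src action_graph \<kappa> \<in> objs action_graph" "rng action_graph \<kappa> \<in> objs action_graph"
    using * by (simp_all add: act_in)
  show "cmp action_graph (idm action_graph (rng action_graph \<kappa>)) \<kappa> = \<kappa>"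
    "cmp action_graph \<kappa> (idm action_graph (src action_graph \<kappa>)) = \<kappa>"
    using * by (simp_all add: t_act cmp_idm_left cmp_idm_right)
next
  fix \<kappa> \<mu> assume "\<kappa> \<in> mors action_graph" "\<mu> \<in> mors action_graph" "src action_graph \<kappa> = rng action_graph \<mu>"
  then obtain b \<delta> a \<epsilon> where *: "\<kappa> = J (b, \<delta>)" "b \<in> A" "\<delta> \<in> mors \<Delta>" "t b = src \<Delta> \<delta>"
      "\<mu> = J (a, \<epsilon>)" "a \<in> A" "\<epsilon> \<in> mors \<Delta>" "t a = src \<Delta> \<epsilon>" "b = act \<epsilon> a"
    by (auto simp: action_mors)
  then have "src \<Delta> \<delta> = rng \<Delta> \<epsilon>" using t_act by metis
  then show "cmp action_graph \<kappa> \<mu> \<in> mors action_graph"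
    "src action_graph (cmp action_graph \<kappa> \<mu>) = src action_graph \<mu>"
    "rng action_graph (cmp action_graph \<kappa> \<mu>) = rng action_graph \<kappa>"
    "deg action_graph (cmp action_graph \<kappa> \<mu>) = deg action_graph \<kappa> + deg action_graph \<mu>"
    using * by (simp_all add: cmp_in src_cmp act_cmp deg_cmp)
next
  fix \<kappa> \<mu> \<nu>
  assume "\<kappa> \<in> mors action_graph" "\<mu> \<in> mors action_graph" "\<nu> \<in> mors action_graph"
    "src action_graph \<kappa> = rng action_graph \<mu>" "src action_graph \<mu> = rng action_graph \<nu>"
  then obtain c \<delta> b \<epsilon> a \<eta> where *: "\<kappa> = J (c, \<delta>)" "\<delta> \<in> mors \<Delta>" "t c = src \<Delta> \<delta>"
      "\<mu> = J (b, \<epsilon>)" "b \<in> A" "\<epsilon> \<in> mors \<Delta>" "t b = src \<Delta> \<epsilon>" "c = act \<epsilon> b"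
      "\<nu> = J (a, \<eta>)" "a \<in> A" "\<eta> \<in> mors \<Delta>" "t a = src \<Delta> \<eta>" "b = act \<eta> a"
    by (auto simp: action_mors)
  then have "src \<Delta> \<delta> = rng \<Delta> \<epsilon>" "src \<Delta> \<epsilon> = rng \<Delta> \<eta>" using t_act by metis+
  then show "cmp action_graph (cmp action_graph \<kappa> \<mu>) \<nu> = cmp action_graph \<kappa> (cmp action_graph \<mu> \<nu>)"
    using * by (simp add: cmp_assoc)
next
  fix \<kappa> m n assume "\<kappa> \<in> mors action_graph" and d: "deg action_graph \<kappa> = m + n"
  then obtain a \<delta> where *: "\<kappa> = J (a, \<delta>)" "a \<in> A" "\<delta> \<in> mors \<Delta>" "t a = src \<Delta> \<delta>"
    by (auto simp: action_mors)
  obtain p where "fst p \<in> mors \<Delta> \<and> snd p \<in> mors \<Delta> \<and> src \<Delta> (fst p) = rng \<Delta> (snd p) \<and>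
        deg \<Delta> (fst p) = m \<and> deg \<Delta> (snd p) = n \<and> \<delta> = cmp \<Delta> (fst p) (snd p)"
    using unique_factorization[of \<delta> m n] * d by auto
  then obtain \<mu> \<nu> where **: "\<mu> \<in> mors \<Delta>" "\<nu> \<in> mors \<Delta>" "src \<Delta> \<mu> = rng \<Delta> \<nu>"
      "deg \<Delta> \<mu> = m" "deg \<Delta> \<nu> = n" "\<delta> = cmp \<Delta> \<mu> \<nu>"
    by blast
  have a: "t a = src \<Delta> \<nu>" using * ** src_cmp by simp
  show "\<exists>!p. fst p \<in> mors action_graph \<and> snd p \<in> mors action_graph \<and>
      src action_graph (fst p) = rng action_graph (snd p) \<and> deg action_graph (fst p) = m \<and>
      deg action_graph (snd p) = n \<and> \<kappa> = cmp action_graph (fst p) (snd p)"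
  \<comment> \<open>The right factor keeps the starting vertex \<open>a\<close>, and the left factor
    starts where the right one ends.\<close>
  proof (rule ex1I[of _ "(J (act \<nu> a, \<mu>), J (a, \<nu>))"])
    fix p assume p: "fst p \<in> mors action_graph \<and> snd p \<in> mors action_graph \<and>
      src action_graph (fst p) = rng action_graph (snd p) \<and> deg action_graph (fst p) = m \<and>
      deg action_graph (snd p) = n \<and> \<kappa> = cmp action_graph (fst p) (snd p)"
    then obtain b' \<mu>' b \<nu>' where p': "fst p = J (b', \<mu>')" "\<mu>' \<in> mors \<Delta>" "t b' = src \<Delta> \<mu>'"
        "snd p = J (b, \<nu>')" "b \<in> A" "\<nu>' \<in> mors \<Delta>" "t b = src \<Delta> \<nu>'"
      by (auto simp: action_mors)
    then have q: "b' = act \<nu>' b" "deg \<Delta> \<mu>' = m" "deg \<Delta> \<nu>' = n" "b = a" "\<delta> = cmp \<Delta> \<mu>' \<nu>'"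
      using p * by simp_all
    have "src \<Delta> \<mu>' = rng \<Delta> \<nu>'" using p' q t_act by metis
    then have "\<mu>' = \<mu> \<and> \<nu>' = \<nu>"
      using p' q ** by (intro unique_factorization_eq) simp_all
    then show "p = (J (act \<nu> a, \<mu>), J (a, \<nu>))" using p' q by (cases p) simp
  qed (use * ** a in \<open>simp add: act_in t_act\<close>)
qed

text \<open>Unique lifts at a source are built into the pairs; those at a range express that the
  action is injective and surjective between fibres.\<close>

lemma action_covering: "kgraph_covering action_graph \<Delta> action_proj"
proof -
  interpret U: k_graph action_graph by (rule k_graph_action)
  show ?thesis
  proof
    show "kgraph_morphism action_graph \<Delta> action_proj"
      unfolding kgraph_morphism_def by (auto simp: action_mors t_in t_act)
    show "\<delta> = \<epsilon>" if "\<delta> \<in> mors action_graph" "\<epsilon> \<in> mors action_graph"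
        "src action_graph \<delta> = src action_graph \<epsilon>" "mmap action_proj \<delta> = mmap action_proj \<epsilon>" for \<delta> \<epsilon>
      using that by (auto simp: action_mors)
    show "\<delta> = \<epsilon>" if D: "\<delta> \<in> mors action_graph" "\<epsilon> \<in> mors action_graph"
        "rng action_graph \<delta> = rng action_graph \<epsilon>" "mmap action_proj \<delta> = mmap action_proj \<epsilon>" for \<delta> \<epsilon>
    proof -
      obtain a \<delta>' b \<epsilon>' where *: "\<delta> = J (a, \<delta>')" "a \<in> A" "\<delta>' \<in> mors \<Delta>" "t a = src \<Delta> \<delta>'"
        "\<epsilon> = J (b, \<epsilon>')" "b \<in> A" "\<epsilon>' \<in> mors \<Delta>" "t b = src \<Delta> \<epsilon>'"
        using D by (auto simp: action_mors)
      then have "\<delta>' = \<epsilon>'" using D by simp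
      moreover have "a = b"
        by (rule act_inj[of \<delta>']) (use * D \<open>\<delta>' = \<epsilon>'\<close> in simp_all)
      ultimately show ?thesis using * by simp
    qed
    show "\<exists>\<delta>\<in>mors action_graph. src action_graph \<delta> = v \<and> mmap action_proj \<delta> = \<kappa>"
      if "v \<in> objs action_graph" "\<kappa> \<in> mors \<Delta>" "src \<Delta> \<kappa> = omap action_proj v" for v \<kappa>
      using that by (intro bexI[of _ "J (v, \<kappa>)"]) simp_all
    show "\<exists>\<delta>\<in>mors action_graph. rng action_graph \<delta> = v \<and> mmap action_proj \<delta> = \<kappa>"
      if D: "v \<in> objs action_graph" "\<kappa> \<in> mors \<Delta>" "rng \<Delta> \<kappa> = omap action_proj v" for v \<kappa>
    proof -
      obtain a where "a \<in> A" "t a = src \<Delta> \<kappa>" "act \<kappa> a = v" using act_surj[of \<kappa> v] D by auto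
      then show ?thesis using D by (intro bexI[of _ "J (a, \<kappa>)"]) simp_all
    qed
  qed
qed

end

text \<open>
  The vertices of the universal covering are the classes of walks that begin with the identity at
  the base point \<open>x\<close>; the latter excludes the walks without forward edges. The class of \<open>p\<close>
  is encoded by the element \<open>walk_code p\<close> of a type into which walks embed.
\<close>

locale based_kgraph = standing_k_graph \<Delta> for \<Delta> :: "('o, 'm, 'k::finite) kgraph" +
  fixes x :: 'o and enc :: "'m edge list \<Rightarrow> 's" and J :: "'s \<times> 'm \<Rightarrow> 'n"
  assumes x_in: "x \<in> objs \<Delta>" and inj_enc: "inj enc" and inj_J: "inj J"
begin

definition based_walks :: "'m edge list set" where
  "based_walks = {p \<in> walks \<Delta>. last p = Fwd (idm \<Delta> x)}"

text \<open>The type \<open>'s\<close> is only required to have room for walks, not for sets of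
  walks. So a class is coded by one chosen member; the choice depends on the class alone.\<close>

definition walk_code :: "'m edge list \<Rightarrow> 's" where
  "walk_code p = enc (SOME q. q \<in> walk_equiv \<Delta> `` {p})"

definition walk_rep :: "'s \<Rightarrow> 'm edge list" where
  "walk_rep a = (SOME p. p \<in> based_walks \<and> walk_code p = a)"

definition code_end :: "'s \<Rightarrow> 'o" where
  "code_end a = wrng \<Delta> (walk_rep a)"

definition code_act :: "'m \<Rightarrow> 's \<Rightarrow> 's" where
  "code_act \<delta> a = walk_code (Fwd \<delta> # walk_rep a)"

lemma walk_code_eq_iff:
  assumes "p \<in> walks \<Delta>" "q \<in> walks \<Delta>"
  shows "walk_code p = walk_code q \<longleftrightarrow> (p, q) \<in> walk_equiv \<Delta>"
proof
  assume "(p, q) \<in> walk_equiv \<Delta>"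
  then have "walk_equiv \<Delta> `` {p} = walk_equiv \<Delta> `` {q}"
    using equiv_class_eq[OF equiv_walk_equiv] by blast
  then show "walk_code p = walk_code q" by (simp add: walk_code_def)
next
  have s: "(r, SOME q. q \<in> walk_equiv \<Delta> `` {r}) \<in> walk_equiv \<Delta>" if "r \<in> walks \<Delta>" for r
    using someI[of "\<lambda>q. q \<in> walk_equiv \<Delta> `` {r}" r] that by auto
  assume "walk_code p = walk_code q"
  then have "(SOME r. r \<in> walk_equiv \<Delta> `` {p}) = (SOME r. r \<in> walk_equiv \<Delta> `` {q})"
    using inj_enc by (auto simp: walk_code_def dest: injD)
  then show "(p, q) \<in> walk_equiv \<Delta>"
    using s[OF assms(1)] s[OF assms(2)] walk_equiv_sym walk_equiv_trans by metis
qed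

lemma based_walk_in: "p \<in> based_walks \<Longrightarrow> p \<in> walks \<Delta>"
  by (simp add: based_walks_def)

lemma based_walks_append:
  assumes "p \<in> walks \<Delta>" "q \<in> based_walks" "wsrc \<Delta> p = wrng \<Delta> q"
  shows "p @ q \<in> based_walks"
  using assms by (auto simp: based_walks_def walks_append walks_not_Nil)

lemma based_walks_Cons:
  assumes "e \<in> edges \<Delta>" "q \<in> based_walks" "esrc \<Delta> e = wrng \<Delta> q"
  shows "e # q \<in> based_walks"
  using based_walks_append[of "[e]" q] assms by (simp add: walks_Cons)

lemma based_walk_Fwd: "p \<in> based_walks \<Longrightarrow> Fwd (idm \<Delta> x) \<in> set p"
  using last_in_set[OF walks_not_Nil[of p \<Delta>]] by (auto simp: based_walks_def)

lemma based_walk_idm: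
  assumes "p \<in> based_walks" "v = wrng \<Delta> p"
  shows "(Fwd (idm \<Delta> v) # p, p) \<in> walk_equiv \<Delta>"
  using assms equiv_idm_Cons_walk[OF based_walk_in based_walk_Fwd] by simp

lemma walk_rep:
  assumes "p \<in> based_walks"
  shows "walk_rep (walk_code p) \<in> based_walks" "(walk_rep (walk_code p), p) \<in> walk_equiv \<Delta>"
proof -
  have *: "walk_rep (walk_code p) \<in> based_walks \<and> walk_code (walk_rep (walk_code p)) = walk_code p"
    unfolding walk_rep_def by (rule someI[of _ p]) (use assms in simp)
  then show "walk_rep (walk_code p) \<in> based_walks" by simp
  show "(walk_rep (walk_code p), p) \<in> walk_equiv \<Delta>"
    using * assms walk_code_eq_iff based_walk_in by blast
qed

lemma code_end: "p \<in> based_walks \<Longrightarrow> code_end (walk_code p) = wrng \<Delta> p"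
  unfolding code_end_def using walk_rep walk_equiv_ends by blast

lemma code_act:
  assumes "p \<in> based_walks" "\<delta> \<in> mors \<Delta>" "src \<Delta> \<delta> = wrng \<Delta> p"
  shows "code_act \<delta> (walk_code p) = walk_code (Fwd \<delta> # p)"
proof -
  have w: "wrng \<Delta> (walk_rep (walk_code p)) = wrng \<Delta> p"
    using walk_rep(2)[OF assms(1)] walk_equiv_ends by blast
  have "([Fwd \<delta>] @ walk_rep (walk_code p), [Fwd \<delta>] @ p) \<in> walk_equiv \<Delta>"
    using assms w walk_rep[OF assms(1)] by (intro walk_equiv_append) (simp_all add: walks_Cons)
  then show ?thesis unfolding code_act_def
    using walk_equiv_walks by (subst walk_code_eq_iff) auto
qed

text \<open>Multiply by the star of \<delta> from the left. The identity that arises in front of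
  \<open>p\<close> is absorbed, since a based walk contains a forward edge.\<close>

lemma based_walk_cancel:
  assumes "p \<in> based_walks" "q \<in> based_walks" "\<delta> \<in> mors \<Delta>" "src \<Delta> \<delta> = wrng \<Delta> p"
    and "(Fwd \<delta> # p, q) \<in> walk_equiv \<Delta>"
  shows "(p, ghost \<Delta> \<delta> # q) \<in> walk_equiv \<Delta>"
proof -
  have r: "wrng \<Delta> q = rng \<Delta> \<delta>" using walk_equiv_ends[OF assms(5)] by simp
  have 1: "([Fwd (idm \<Delta> (src \<Delta> \<delta>))] @ p, p) \<in> walk_equiv \<Delta>"
    using based_walk_idm assms by simp
  have 2: "([ghost \<Delta> \<delta>, Fwd \<delta>] @ p, [Fwd (idm \<Delta> (src \<Delta> \<delta>))] @ p) \<in> walk_equiv \<Delta>"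
    using assms by (intro walk_equiv_append equiv_ghost_Fwd) (simp_all add: based_walk_in)
  have 3: "([ghost \<Delta> \<delta>] @ (Fwd \<delta> # p), [ghost \<Delta> \<delta>] @ q) \<in> walk_equiv \<Delta>"
    using assms by (intro walk_equiv_append) (simp_all add: walks_Cons)
  show ?thesis
    using walk_equiv_trans[OF walk_equiv_sym[OF 1] walk_equiv_trans[OF walk_equiv_sym[OF 2]]] 3 by simp
qed

text \<open>Prepending the star of \<delta> is inverse to prepending \<delta>, which makes the
  action bijective between fibres.\<close>

sublocale act: kgraph_action \<Delta> "walk_code ` based_walks" code_end code_act J
proof
  show "inj J" by (rule inj_J)
  fix a assume "a \<in> walk_code ` based_walks"
  then obtain p where a: "a = walk_code p" and p: "p \<in> based_walks" by auto
  show "code_end a \<in> objs \<Delta>" using p wrng_in by (simp add: a code_end based_walk_in)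
  show "code_act (idm \<Delta> (code_end a)) a = a"
  proof -
    have "wrng \<Delta> p \<in> objs \<Delta>" using p wrng_in by (simp add: based_walk_in)
    then have "code_act (idm \<Delta> (code_end a)) a = walk_code (Fwd (idm \<Delta> (wrng \<Delta> p)) # p)"
      using p by (simp add: a code_end code_act idm_in src_idm)
    also have "\<dots> = walk_code p"
      using based_walk_idm[OF p refl] walk_equiv_walks by (subst walk_code_eq_iff) auto
    finally show ?thesis by (simp add: a)
  qed
  fix \<delta> assume \<delta>: "\<delta> \<in> mors \<Delta>"
  {
    assume "code_end a = src \<Delta> \<delta>"
    then have s: "src \<Delta> \<delta> = wrng \<Delta> p" using a p code_end by simp
    have "Fwd \<delta> # p \<in> based_walks" using \<delta> p s by (intro based_walks_Cons) simp_all
    then show "code_act \<delta> a \<in> walk_code ` based_walks" "code_end (code_act \<delta> a) = rng \<Delta> \<delta>"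
      using a p s \<delta> by (simp_all add: code_act code_end)
  }
  {
    fix \<kappa> assume "\<kappa> \<in> mors \<Delta>" "src \<Delta> \<kappa> = rng \<Delta> \<delta>" "code_end a = src \<Delta> \<delta>"
    then have s: "src \<Delta> \<delta> = wrng \<Delta> p" and \<kappa>: "\<kappa> \<in> mors \<Delta>" "src \<Delta> \<kappa> = rng \<Delta> \<delta>"
      using a p code_end by simp_all
    have \<delta>p: "Fwd \<delta> # p \<in> based_walks" using \<delta> p s by (intro based_walks_Cons) simp_all
    have "([Fwd (cmp \<Delta> \<kappa> \<delta>)] @ p, [Fwd \<kappa>, Fwd \<delta>] @ p) \<in> walk_equiv \<Delta>"
      using \<kappa> \<delta> s p by (intro walk_equiv_append equiv_cmp) (simp_all add: src_cmp based_walk_in)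
    then have "walk_code (Fwd (cmp \<Delta> \<kappa> \<delta>) # p) = walk_code (Fwd \<kappa> # Fwd \<delta> # p)"
      using walk_equiv_walks by (subst walk_code_eq_iff) auto
    then show "code_act (cmp \<Delta> \<kappa> \<delta>) a = code_act \<kappa> (code_act \<delta> a)"
      using \<kappa> \<delta> s p \<delta>p by (simp add: a code_act cmp_in src_cmp)
  }
  {
    fix b assume "b \<in> walk_code ` based_walks" "code_end a = src \<Delta> \<delta>" "code_end b = src \<Delta> \<delta>"
      and eq: "code_act \<delta> a = code_act \<delta> b"
    then obtain q where b: "b = walk_code q" and q: "q \<in> based_walks"
      and s': "code_end a = src \<Delta> \<delta>" "code_end b = src \<Delta> \<delta>"
      by blast
    have s: "src \<Delta> \<delta> = wrng \<Delta> p" using s'(1) code_end[OF p] a by simp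
    have sq: "src \<Delta> \<delta> = wrng \<Delta> q" using s'(2) code_end[OF q] b by simp
    have \<delta>p: "Fwd \<delta> # p \<in> based_walks" using \<delta> p s by (intro based_walks_Cons) simp_all
    have \<delta>q: "Fwd \<delta> # q \<in> based_walks" using \<delta> q sq by (intro based_walks_Cons) simp_all
    have "walk_code (Fwd \<delta> # p) = walk_code (Fwd \<delta> # q)"
      using eq code_act[OF p \<delta> s] code_act[OF q \<delta> sq] by (simp add: a b)
    then have *: "(Fwd \<delta> # p, Fwd \<delta> # q) \<in> walk_equiv \<Delta>"
      using walk_code_eq_iff[OF based_walk_in[OF \<delta>p] based_walk_in[OF \<delta>q]] by simp
    have "(q, ghost \<Delta> \<delta> # Fwd \<delta> # q) \<in> walk_equiv \<Delta>"
      using \<delta>q by (intro based_walk_cancel[OF q \<delta>q \<delta> sq]) (simp add: based_walk_in)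
    then have "(p, q) \<in> walk_equiv \<Delta>"
      using based_walk_cancel[OF p \<delta>q \<delta> s *] walk_equiv_sym walk_equiv_trans by blast
    then show "a = b" using p q by (simp add: a b walk_code_eq_iff based_walk_in)
  }
  {
    assume "code_end a = rng \<Delta> \<delta>"
    then have s: "rng \<Delta> \<delta> = wrng \<Delta> p" using a p code_end by simp
    have g: "ghost \<Delta> \<delta> # p \<in> based_walks" using \<delta> p s by (intro based_walks_Cons) simp_all
    have "([Fwd \<delta>, ghost \<Delta> \<delta>] @ p, [Fwd (idm \<Delta> (rng \<Delta> \<delta>))] @ p) \<in> walk_equiv \<Delta>"
      using \<delta> s p by (intro walk_equiv_append equiv_Fwd_ghost) (simp_all add: based_walk_in)
    then have "(Fwd \<delta> # ghost \<Delta> \<delta> # p, p) \<in> walk_equiv \<Delta>"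
      using based_walk_idm[OF p s] walk_equiv_trans by simp
    then have "walk_code (Fwd \<delta> # ghost \<Delta> \<delta> # p) = a"
      unfolding a using walk_equiv_walks by (subst walk_code_eq_iff) auto
    then show "\<exists>b\<in>walk_code ` based_walks. code_end b = src \<Delta> \<delta> \<and> code_act \<delta> b = a"
      using g \<delta> by (intro bexI[of _ "walk_code (ghost \<Delta> \<delta> # p)"]) (simp_all add: code_end code_act)
  }
qed

abbreviation "ucover \<equiv> act.action_graph"
abbreviation "ucover_proj \<equiv> act.action_proj"

sublocale ucover: kgraph_covering ucover \<Delta> ucover_proj
  by (rule act.action_covering)

text \<open>For a forward edge this is how the action is defined. A reversed edge leads back from
  the class of \<open>Fwd \<delta> # q\<close> to that of \<open>q\<close>, and cancellation
  rewrites \<open>q\<close> with the label of the edge in front.\<close>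

lemma ucover_edge:
  assumes "e \<in> edges ucover" "esrc ucover e = walk_code p" "p \<in> based_walks"
  shows "erng ucover e = walk_code (map_edge (mmap ucover_proj) e # p)"
    "map_edge (mmap ucover_proj) e # p \<in> based_walks"
proof -
  have s: "esrc \<Delta> (map_edge (mmap ucover_proj) e) = wrng \<Delta> p"
    using ucover.esrc_emap[OF assms(1)] assms(2,3) code_end by simp
  then show in': "map_edge (mmap ucover_proj) e # p \<in> based_walks"
    using assms ucover.emap_in by (intro based_walks_Cons) simp_all
  show "erng ucover e = walk_code (map_edge (mmap ucover_proj) e # p)"
  proof (cases e)
    case (Fwd m)
    then obtain a \<delta> where "m = J (a, \<delta>)" "\<delta> \<in> mors \<Delta>" using assms(1) by (auto simp: act.action_mors)
    then show ?thesis using Fwd assms s by (simp add: code_act)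
  next
    case (Bwd m)
    then have "m \<in> mors ucover" "deg ucover m \<noteq> 0" using assms(1) ucover.dom.Bwd_in_edges by auto
    then obtain q \<delta> where m: "m = J (walk_code q, \<delta>)" "\<delta> \<in> mors \<Delta>" "q \<in> based_walks"
        "wrng \<Delta> q = src \<Delta> \<delta>" "deg \<Delta> \<delta> \<noteq> 0"
      by (auto simp: act.action_mors code_end)
    then have "walk_code (Fwd \<delta> # q) = walk_code p"
      using assms(2) Bwd by (simp add: code_act)
    moreover have "Fwd \<delta> # q \<in> based_walks" using m by (intro based_walks_Cons) simp_all
    ultimately have "(Fwd \<delta> # q, p) \<in> walk_equiv \<Delta>"
      using assms(3) walk_code_eq_iff based_walk_in by blast
    then have "(q, ghost \<Delta> \<delta> # p) \<in> walk_equiv \<Delta>"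
      using m assms(3) by (intro based_walk_cancel) simp_all
    then have "walk_code q = walk_code (ghost \<Delta> \<delta> # p)"
      using walk_equiv_walks by (subst walk_code_eq_iff) auto
    then show ?thesis using m Bwd by (simp add: ghost_def)
  qed
qed

text \<open>The end of a walk in this covering records the class of its projection. This is the
  property that forces simple connectedness.\<close>

lemma ucover_walk:
  assumes "q \<in> walks ucover" "wsrc ucover q = walk_code p" "p \<in> based_walks"
  shows "wrng ucover q = walk_code (walk_map ucover_proj q @ p) \<and> walk_map ucover_proj q @ p \<in> based_walks"
  using assms
proof (induction q rule: walks_induct)
  case (single e)
  then show ?case using ucover_edge[of e p] by simp
next
  case (Cons e q)
  then show ?case
    using ucover_edge[of e "walk_map ucover_proj q @ p"] by (simp add: wsrc_Cons walks_not_Nil)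
qed

text \<open>The lift of \<open>p\<close> from the class of the trivial walk ends at the class of
  \<open>p\<close> followed by an identity, and a based walk absorbs that identity.\<close>

lemma ucover_connected:
  assumes "p \<in> based_walks"
  shows "\<exists>q \<in> walks ucover. wsrc ucover q = walk_code [Fwd (idm \<Delta> x)] \<and> wrng ucover q = walk_code p"
proof -
  have x: "[Fwd (idm \<Delta> x)] \<in> based_walks" using x_in by (simp add: based_walks_def)
  have p: "wsrc \<Delta> p = x" using assms x_in by (simp add: based_walks_def wsrc_def src_idm)
  have e: "code_end (walk_code [Fwd (idm \<Delta> x)]) = x" using x x_in by (simp add: code_end rng_idm)
  obtain q where q: "q \<in> walks ucover" "wsrc ucover q = walk_code [Fwd (idm \<Delta> x)]" "walk_map ucover_proj q = p"
    using ucover.walk_lift[of p "walk_code [Fwd (idm \<Delta> x)]"] assms p e x by (auto simp: based_walk_in)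
  have "(p @ [Fwd (idm \<Delta> x)], p) \<in> walk_equiv \<Delta>"
    using equiv_walk_idm[OF based_walk_in based_walk_Fwd, OF assms assms] p by simp
  then have "walk_code (p @ [Fwd (idm \<Delta> x)]) = walk_code p"
    using walk_equiv_walks by (subst walk_code_eq_iff) auto
  then show ?thesis using q ucover_walk[OF q(1,2) x] by auto
qed

lemma ucover_covering: "covering \<Delta> ucover ucover_proj"
proof (rule ucover.covering_if_connected)
  have "[Fwd (idm \<Delta> x)] \<in> based_walks" using x_in by (simp add: based_walks_def)
  then show "walk_code [Fwd (idm \<Delta> x)] \<in> objs ucover" by simp
  show "standing_k_graph \<Delta>" by (rule standing_k_graph_axioms)
  fix v assume "v \<in> objs ucover"
  then obtain p where "v = walk_code p" "p \<in> based_walks" by auto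
  then show "\<exists>q \<in> walks ucover. wsrc ucover q = walk_code [Fwd (idm \<Delta> x)] \<and> wrng ucover q = v"
    using ucover_connected by simp
qed

end

section \<open>Embeddings into infinite types\<close>

lemma inj_pair_if_infinite:
  assumes "infinite (UNIV :: 'u set)"
  shows "\<exists>J :: 'u \<times> 'u \<Rightarrow> 'u. inj J"
  using card_of_Times_same_infinite[OF assms] unfolding card_of_ordIso[symmetric] bij_betw_def
  by (simp only: UNIV_Times_UNIV) blast

text \<open>Iterated pairing is injective on lists of one fixed length; the length itself is
  recorded separately, through an embedding of the natural numbers.\<close>

lemma inj_list_if_infinite:
  assumes "infinite (UNIV :: 'u set)"
  shows "\<exists>f :: 'u list \<Rightarrow> 'u. inj f"
proof -
  obtain J :: "'u \<times> 'u \<Rightarrow> 'u" where J: "inj J" using inj_pair_if_infinite[OF assms] by blast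
  obtain g :: "nat \<Rightarrow> 'u" where g: "inj g" using infinite_countable_subset[OF assms] by blast
  define h :: "'u list \<Rightarrow> 'u" where "h = rec_list (g 0) (\<lambda>a _ r. J (a, r))"
  have "p = q" if "length p = length q" "h p = h q" for p q
    using that by (induction p q rule: list_induct2) (use J in \<open>auto simp: h_def inj_eq\<close>)
  then have "inj (\<lambda>p. J (g (length p), h p))"
    using J g by (auto intro!: injI simp: inj_eq)
  then show ?thesis by blast
qed

lemma inj_edge_list_if_infinite:
  assumes "infinite (UNIV :: 'u set)"
  shows "\<exists>f :: 'u edge list \<Rightarrow> 'u. inj f"
proof -
  obtain J :: "'u \<times> 'u \<Rightarrow> 'u" where J: "inj J" using inj_pair_if_infinite[OF assms] by blast
  obtain f :: "'u list \<Rightarrow> 'u" where f: "inj f" using inj_list_if_infinite[OF assms] by blast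
  obtain g :: "nat \<Rightarrow> 'u" where g: "inj g" using infinite_countable_subset[OF assms] by blast
  define h where "h = case_edge (\<lambda>a. J (a, g 0)) (\<lambda>a. J (a, g 1))"
  have "inj h"
  proof (rule injI)
    fix a b assume "h a = h b"
    then show "a = b" using J g by (cases a; cases b) (auto simp: h_def inj_eq)
  qed
  then have "inj (f \<circ> map h)" using f by (intro inj_compose) simp_all
  then show ?thesis by blast
qed

text \<open>Without sources every degree occurs, and the constant vectors already give infinitely
  many degrees. This makes the type of \<Delta> large enough for the encodings.\<close>

lemma (in standing_k_graph) infinite_mors: "infinite (mors \<Lambda>)"
proof -
  obtain v where v: "v \<in> objs \<Lambda>" using nonempty by auto
  have "\<exists>\<kappa> \<in> mors \<Lambda>. deg \<Lambda> \<kappa> = n" for n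
    using no_sources[OF v, of n] by (auto simp: mors_to_deg_def mors_to_def)
  then have "range (\<lambda>i. \<chi> _. i) \<subseteq> deg \<Lambda> ` mors \<Lambda>" by (metis image_iff image_subsetI)
  moreover have "infinite (range (\<lambda>i. \<chi> _. i) :: (nat ^ 'c) set)"
    by (rule range_inj_infinite) (auto intro!: injI simp: vec_eq_iff)
  ultimately show ?thesis using finite_imageI finite_subset by blast
qed

text \<open>The universal property is applied to the covering by classes of walks. Walks
  \<open>p\<close> and \<open>q\<close> with common ends are sent to walks with a common end there,
  so their projections to \<Delta> become equivalent once a common walk is appended. That walk is
  cancelled and the equivalence lifted to \<Omega>.\<close>

theorem universal_covering_simply_connected:
  fixes \<Delta> \<Omega> :: "('u, 'u, 'k::finite) kgraph"
  assumes "standing_k_graph \<Delta>" "universal_covering \<Delta> \<Omega> \<tau>"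
    and "p \<in> walks \<Omega>" "q \<in> walks \<Omega>" "wsrc \<Omega> p = wsrc \<Omega> q" "wrng \<Omega> p = wrng \<Omega> q"
  shows "(p @ [Fwd (idm \<Omega> (wsrc \<Omega> p))], q @ [Fwd (idm \<Omega> (wsrc \<Omega> p))]) \<in> walk_equiv \<Omega>"
proof -
  interpret \<Delta>: standing_k_graph \<Delta> by (rule assms(1))
  have cov: "covering \<Delta> \<Omega> \<tau>" using assms(2) by (simp add: universal_covering_def)
  interpret \<tau>: kgraph_covering \<Omega> \<Delta> \<tau>
    by (rule covering_imp_kgraph_covering[OF \<Delta>.k_graph_axioms cov])
  have inf: "infinite (UNIV :: 'u set)" by (rule infinite_super[OF subset_UNIV \<Delta>.infinite_mors])
  obtain J :: "'u \<times> 'u \<Rightarrow> 'u" where J: "inj J" using inj_pair_if_infinite[OF inf] by blast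
  obtain enc :: "'u edge list \<Rightarrow> 'u" where enc: "inj enc" using inj_edge_list_if_infinite[OF inf] by blast
  obtain x where x: "x \<in> objs \<Delta>" using \<Delta>.nonempty by blast
  interpret b: based_kgraph \<Delta> x enc J by unfold_locales (rule x enc J)+
  obtain \<phi> where \<phi>: "kgraph_morphism \<Omega> b.ucover \<phi>" "kmor_eq_on \<Omega> (kmor_comp b.ucover_proj \<phi>) \<tau>"
    using assms(2) b.ucover_covering unfolding universal_covering_def by blast
  interpret \<phi>: kgraph_hom \<Omega> b.ucover \<phi> by unfold_locales (rule \<phi>(1))
  have comp: "walk_map b.ucover_proj (walk_map \<phi> r) = walk_map \<tau> r" if "r \<in> walks \<Omega>" for r
  proof -
    have "map_edge (mmap b.ucover_proj) (map_edge (mmap \<phi>) e) = map_edge (mmap \<tau>) e" if "e \<in> edges \<Omega>" for e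
      using that \<phi>(2) by (cases e) (auto simp: kmor_eq_on_def kmor_comp_def \<tau>.dom.Bwd_in_edges)
    then show ?thesis using that by (auto simp: walk_map_def walks_def)
  qed
  define v where "v = wsrc \<Omega> p"
  have v: "v \<in> objs \<Omega>" using assms(3) \<tau>.dom.wsrc_in by (simp add: v_def)
  have "omap \<phi> v \<in> objs b.ucover" using v by (rule \<phi>.hom_simps)
  \<comment> \<open>\<open>r\<close> leads from \<open>x\<close> to the image of \<open>v\<close>.
    It is a common right factor of the walks that code the two end points.\<close>
  then obtain r where r: "omap \<phi> v = b.walk_code r" "r \<in> b.based_walks" by auto
  have rw: "r \<in> walks \<Delta>" using r b.based_walk_in by simp
  have \<tau>v: "omap \<tau> v = wrng \<Delta> r" using \<phi>(2) v r b.code_end by (auto simp: kmor_eq_on_def kmor_comp_def)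
  have *: "wrng b.ucover (walk_map \<phi> s) = b.walk_code (walk_map \<tau> s @ r) \<and> walk_map \<tau> s @ r \<in> b.based_walks"
    if "s \<in> walks \<Omega>" "wsrc \<Omega> s = v" for s
    using b.ucover_walk[of "walk_map \<phi> s" r] \<phi>.walk_map_in[OF that(1)] comp[OF that(1)] that(2) r by simp
  have "b.walk_code (walk_map \<tau> p @ r) = b.walk_code (walk_map \<tau> q @ r)"
    using *[of p] *[of q] assms \<phi>.walk_map_in[OF assms(3)] \<phi>.walk_map_in[OF assms(4)] v_def by simp
  then have eq: "(walk_map \<tau> p @ r, walk_map \<tau> q @ r) \<in> walk_equiv \<Delta>"
    using *[of p] *[of q] assms v_def b.walk_code_eq_iff b.based_walk_in by simp
  \<comment> \<open>Cancelling \<open>r\<close> leaves an identity behind: this is the identity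
    appended in the conclusion, and it cannot be absorbed if \<open>p\<close> or \<open>q\<close>
    has no forward edge.\<close>
  have inv: "(r @ winv \<Delta> r, [Fwd (idm \<Delta> (omap \<tau> v))]) \<in> walk_equiv \<Delta>"
    using \<Delta>.equiv_walk_winv[OF rw] \<tau>v by simp
  have cancel: "(walk_map \<tau> s @ r @ winv \<Delta> r, walk_map \<tau> s @ [Fwd (idm \<Delta> (omap \<tau> v))]) \<in> walk_equiv \<Delta>"
    if "s \<in> walks \<Omega>" "wsrc \<Omega> s = v" for s
    using that inv \<tau>.walk_map_in[OF that(1)] \<tau>v rw walks_not_Nil[OF rw]
    by (intro \<Delta>.walk_equiv_append) simp_all
  have "((walk_map \<tau> p @ r) @ winv \<Delta> r, (walk_map \<tau> q @ r) @ winv \<Delta> r) \<in> walk_equiv \<Delta>"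
    by (rule \<Delta>.walk_equiv_append[OF eq \<Delta>.walk_equiv_refl])
      (simp_all add: \<Delta>.winv_in[OF rw] walks_not_Nil[OF rw])
  then have "(walk_map \<tau> p @ r @ winv \<Delta> r, walk_map \<tau> q @ r @ winv \<Delta> r) \<in> walk_equiv \<Delta>"
    by simp
  also have "(walk_map \<tau> q @ r @ winv \<Delta> r, walk_map \<tau> q @ [Fwd (idm \<Delta> (omap \<tau> v))]) \<in> walk_equiv \<Delta>"
    by (rule cancel) (use assms v_def in simp_all)
  finally have 1: "(walk_map \<tau> p @ r @ winv \<Delta> r, walk_map \<tau> q @ [Fwd (idm \<Delta> (omap \<tau> v))]) \<in> walk_equiv \<Delta>" .
  have "(walk_map \<tau> p @ r @ winv \<Delta> r, walk_map \<tau> p @ [Fwd (idm \<Delta> (omap \<tau> v))]) \<in> walk_equiv \<Delta>"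
    by (rule cancel) (use assms v_def in simp_all)
  from \<Delta>.walk_equiv_trans[OF \<Delta>.walk_equiv_sym[OF this] 1]
  have "(walk_map \<tau> p @ [Fwd (idm \<Delta> (omap \<tau> v))], walk_map \<tau> q @ [Fwd (idm \<Delta> (omap \<tau> v))]) \<in> walk_equiv \<Delta>" .
  then have "(walk_map \<tau> (p @ [Fwd (idm \<Omega> v)]), walk_map \<tau> (q @ [Fwd (idm \<Omega> v)])) \<in> walk_equiv \<Delta>"
    using v by simp
  moreover have "s @ [Fwd (idm \<Omega> v)] \<in> walks \<Omega>" if "s \<in> walks \<Omega>" "wsrc \<Omega> s = v" for s
    using that v walks_not_Nil[OF that(1)] by (simp add: walks_append \<tau>.dom.rng_idm)
  ultimately show ?thesis
    using assms v_def by (intro \<tau>.walk_equiv_lift_same_source) simp_all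
qed

section \<open>The quotient of a representation graph\<close>

text \<open>The axioms hold in the image because composable pairs and triples can be lifted,
  starting with the rightmost factor. Nothing is known beforehand about composites in \<Gamma> other
  than through such lifts.\<close>

lemma k_graph_image:
  fixes \<Omega> :: "('p, 'q, 'k::finite) kgraph" and \<Gamma> :: "('o, 'm, 'k) kgraph"
    and \<pi> :: "('p, 'q, 'o, 'm) kmor"
  assumes "k_graph \<Omega>"
    and objs: "objs \<Gamma> = omap \<pi> ` objs \<Omega>" and mors: "mors \<Gamma> = mmap \<pi> ` mors \<Omega>"
    and src: "\<And>\<delta>. \<delta> \<in> mors \<Omega> \<Longrightarrow> src \<Gamma> (mmap \<pi> \<delta>) = omap \<pi> (src \<Omega> \<delta>)"
    and rng: "\<And>\<delta>. \<delta> \<in> mors \<Omega> \<Longrightarrow> rng \<Gamma> (mmap \<pi> \<delta>) = omap \<pi> (rng \<Omega> \<delta>)"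
    and deg: "\<And>\<delta>. \<delta> \<in> mors \<Omega> \<Longrightarrow> deg \<Gamma> (mmap \<pi> \<delta>) = deg \<Omega> \<delta>"
    and idm: "\<And>v. v \<in> objs \<Omega> \<Longrightarrow> idm \<Gamma> (omap \<pi> v) = mmap \<pi> (idm \<Omega> v)"
    and cmp: "\<And>\<delta> \<epsilon>. \<delta> \<in> mors \<Omega> \<Longrightarrow> \<epsilon> \<in> mors \<Omega> \<Longrightarrow> src \<Omega> \<delta> = rng \<Omega> \<epsilon> \<Longrightarrow>
      cmp \<Gamma> (mmap \<pi> \<delta>) (mmap \<pi> \<epsilon>) = mmap \<pi> (cmp \<Omega> \<delta> \<epsilon>)"
    and lift: "\<And>v \<kappa>. v \<in> objs \<Omega> \<Longrightarrow> \<kappa> \<in> mors \<Gamma> \<Longrightarrow> src \<Gamma> \<kappa> = omap \<pi> v \<Longrightarrow>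
      \<exists>\<delta> \<in> mors \<Omega>. src \<Omega> \<delta> = v \<and> mmap \<pi> \<delta> = \<kappa>"
    and inj: "\<And>\<delta> \<epsilon>. \<delta> \<in> mors \<Omega> \<Longrightarrow> \<epsilon> \<in> mors \<Omega> \<Longrightarrow> src \<Omega> \<delta> = src \<Omega> \<epsilon> \<Longrightarrow>
      mmap \<pi> \<delta> = mmap \<pi> \<epsilon> \<Longrightarrow> \<delta> = \<epsilon>"
  shows "k_graph \<Gamma>"
proof -
  interpret \<Omega>: k_graph \<Omega> by (rule assms(1))
  have pair: "\<exists>\<delta> \<epsilon>. \<delta> \<in> mors \<Omega> \<and> \<epsilon> \<in> mors \<Omega> \<and> src \<Omega> \<delta> = rng \<Omega> \<epsilon> \<and> src \<Omega> \<epsilon> = v \<and>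
      mmap \<pi> \<delta> = \<kappa> \<and> mmap \<pi> \<epsilon> = \<mu>"
    if *: "\<kappa> \<in> mors \<Gamma>" "\<mu> \<in> mors \<Gamma>" "src \<Gamma> \<kappa> = rng \<Gamma> \<mu>" "src \<Gamma> \<mu> = omap \<pi> v" "v \<in> objs \<Omega>" for \<kappa> \<mu> v
  proof -
    obtain \<epsilon> where \<epsilon>: "\<epsilon> \<in> mors \<Omega>" "src \<Omega> \<epsilon> = v" "mmap \<pi> \<epsilon> = \<mu>" using lift[OF *(5,2,4)] by blast
    have "src \<Gamma> \<kappa> = omap \<pi> (rng \<Omega> \<epsilon>)" using rng[OF \<epsilon>(1)] \<epsilon>(3) *(3) by simp
    then obtain \<delta> where "\<delta> \<in> mors \<Omega>" "src \<Omega> \<delta> = rng \<Omega> \<epsilon>" "mmap \<pi> \<delta> = \<kappa>"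
      using lift[OF \<Omega>.rng_in[OF \<epsilon>(1)] *(1)] by blast
    with \<epsilon> show ?thesis by blast
  qed
  have base: "\<exists>v \<in> objs \<Omega>. src \<Gamma> \<mu> = omap \<pi> v" if "\<mu> \<in> mors \<Gamma>" for \<mu>
    using that src \<Omega>.src_in unfolding mors by (metis imageE)
  show ?thesis
  proof
    fix v assume "v \<in> objs \<Gamma>"
    then obtain u where u: "u \<in> objs \<Omega>" "v = omap \<pi> u" using objs by blast
    then show "idm \<Gamma> v \<in> mors \<Gamma>" "src \<Gamma> (idm \<Gamma> v) = v" "rng \<Gamma> (idm \<Gamma> v) = v" "deg \<Gamma> (idm \<Gamma> v) = 0"
      by (simp_all add: mors idm src rng deg \<Omega>.idm_in \<Omega>.src_idm \<Omega>.rng_idm \<Omega>.deg_idm)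
  next
    fix \<kappa> assume "\<kappa> \<in> mors \<Gamma>"
    then obtain \<delta> where \<delta>: "\<delta> \<in> mors \<Omega>" "\<kappa> = mmap \<pi> \<delta>" using mors by blast
    then show "src \<Gamma> \<kappa> \<in> objs \<Gamma>" "rng \<Gamma> \<kappa> \<in> objs \<Gamma>"
      by (simp_all add: objs src rng \<Omega>.src_in \<Omega>.rng_in)
    show "cmp \<Gamma> (idm \<Gamma> (rng \<Gamma> \<kappa>)) \<kappa> = \<kappa>"
      using \<delta> by (simp add: rng idm cmp \<Omega>.idm_in \<Omega>.rng_in \<Omega>.src_idm \<Omega>.cmp_idm_left)
    show "cmp \<Gamma> \<kappa> (idm \<Gamma> (src \<Gamma> \<kappa>)) = \<kappa>"
      using \<delta> by (simp add: src idm cmp \<Omega>.idm_in \<Omega>.src_in \<Omega>.rng_idm \<Omega>.cmp_idm_right)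
  next
    fix \<kappa> \<mu> assume *: "\<kappa> \<in> mors \<Gamma>" "\<mu> \<in> mors \<Gamma>" "src \<Gamma> \<kappa> = rng \<Gamma> \<mu>"
    obtain v where "v \<in> objs \<Omega>" "src \<Gamma> \<mu> = omap \<pi> v" using base[OF *(2)] by blast
    then obtain \<delta> \<epsilon> where "\<delta> \<in> mors \<Omega>" "\<epsilon> \<in> mors \<Omega>" "src \<Omega> \<delta> = rng \<Omega> \<epsilon>"
        "\<kappa> = mmap \<pi> \<delta>" "\<mu> = mmap \<pi> \<epsilon>"
      using pair[OF *] by blast
    then show "cmp \<Gamma> \<kappa> \<mu> \<in> mors \<Gamma>" "src \<Gamma> (cmp \<Gamma> \<kappa> \<mu>) = src \<Gamma> \<mu>" "rng \<Gamma> (cmp \<Gamma> \<kappa> \<mu>) = rng \<Gamma> \<kappa>"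
      "deg \<Gamma> (cmp \<Gamma> \<kappa> \<mu>) = deg \<Gamma> \<kappa> + deg \<Gamma> \<mu>"
      by (simp_all add: mors cmp src rng deg \<Omega>.cmp_in \<Omega>.src_cmp \<Omega>.rng_cmp \<Omega>.deg_cmp)
  next
    fix \<kappa> \<mu> \<nu> assume *: "\<kappa> \<in> mors \<Gamma>" "\<mu> \<in> mors \<Gamma>" "\<nu> \<in> mors \<Gamma>"
      "src \<Gamma> \<kappa> = rng \<Gamma> \<mu>" "src \<Gamma> \<mu> = rng \<Gamma> \<nu>"
    obtain v where "v \<in> objs \<Omega>" "src \<Gamma> \<nu> = omap \<pi> v" using base[OF *(3)] by blast
    then obtain \<epsilon> \<eta> where \<epsilon>: "\<epsilon> \<in> mors \<Omega>" "\<eta> \<in> mors \<Omega>" "src \<Omega> \<epsilon> = rng \<Omega> \<eta>"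
        "\<mu> = mmap \<pi> \<epsilon>" "\<nu> = mmap \<pi> \<eta>"
      using pair[OF *(2,3,5)] by blast
    have "src \<Gamma> \<kappa> = omap \<pi> (rng \<Omega> \<epsilon>)" using rng[OF \<epsilon>(1)] \<epsilon>(4) *(4) by simp
    then obtain \<delta> where "\<delta> \<in> mors \<Omega>" "src \<Omega> \<delta> = rng \<Omega> \<epsilon>" "\<kappa> = mmap \<pi> \<delta>"
      using lift[OF \<Omega>.rng_in[OF \<epsilon>(1)] *(1)] by blast
    with \<epsilon> show "cmp \<Gamma> (cmp \<Gamma> \<kappa> \<mu>) \<nu> = cmp \<Gamma> \<kappa> (cmp \<Gamma> \<mu> \<nu>)"
      by (simp add: cmp \<Omega>.cmp_in \<Omega>.src_cmp \<Omega>.rng_cmp \<Omega>.cmp_assoc)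
  next
    fix \<kappa> m n assume "\<kappa> \<in> mors \<Gamma>" and d: "deg \<Gamma> \<kappa> = m + n"
    then obtain \<delta> where \<delta>: "\<delta> \<in> mors \<Omega>" "\<kappa> = mmap \<pi> \<delta>" using mors by blast
    then have "deg \<Omega> \<delta> = m + n" using d deg by simp
    from ex1_implies_ex[OF \<Omega>.unique_factorization[OF \<delta>(1) this]]
    obtain \<mu> \<nu> where f: "\<mu> \<in> mors \<Omega>" "\<nu> \<in> mors \<Omega>" "src \<Omega> \<mu> = rng \<Omega> \<nu>" "deg \<Omega> \<mu> = m" "deg \<Omega> \<nu> = n"
        "\<delta> = cmp \<Omega> \<mu> \<nu>"
      by auto
    show "\<exists>!p. fst p \<in> mors \<Gamma> \<and> snd p \<in> mors \<Gamma> \<and> src \<Gamma> (fst p) = rng \<Gamma> (snd p) \<and>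
        deg \<Gamma> (fst p) = m \<and> deg \<Gamma> (snd p) = n \<and> \<kappa> = cmp \<Gamma> (fst p) (snd p)"
    proof (rule ex1I[of _ "(mmap \<pi> \<mu>, mmap \<pi> \<nu>)"])
      show "fst (mmap \<pi> \<mu>, mmap \<pi> \<nu>) \<in> mors \<Gamma> \<and> snd (mmap \<pi> \<mu>, mmap \<pi> \<nu>) \<in> mors \<Gamma> \<and>
          src \<Gamma> (fst (mmap \<pi> \<mu>, mmap \<pi> \<nu>)) = rng \<Gamma> (snd (mmap \<pi> \<mu>, mmap \<pi> \<nu>)) \<and>
          deg \<Gamma> (fst (mmap \<pi> \<mu>, mmap \<pi> \<nu>)) = m \<and> deg \<Gamma> (snd (mmap \<pi> \<mu>, mmap \<pi> \<nu>)) = n \<and>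
          \<kappa> = cmp \<Gamma> (fst (mmap \<pi> \<mu>, mmap \<pi> \<nu>)) (snd (mmap \<pi> \<mu>, mmap \<pi> \<nu>))"
        using f \<delta>(2) by (simp add: mors src rng deg cmp)
    next
      fix p assume p: "fst p \<in> mors \<Gamma> \<and> snd p \<in> mors \<Gamma> \<and> src \<Gamma> (fst p) = rng \<Gamma> (snd p) \<and>
        deg \<Gamma> (fst p) = m \<and> deg \<Gamma> (snd p) = n \<and> \<kappa> = cmp \<Gamma> (fst p) (snd p)"
      \<comment> \<open>A first lift of the competing factorization, from any vertex
        \<open>v\<close>, shows that its right factor has the same source as \<kappa>. A second lift
        can then start at the source of \<delta>, where unique factorization in \<Omega>
        applies.\<close>
      then obtain v where v: "v \<in> objs \<Omega>" "src \<Gamma> (snd p) = omap \<pi> v" using base by blast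
      with p pair obtain \<alpha> \<beta> where ab: "\<alpha> \<in> mors \<Omega>" "\<beta> \<in> mors \<Omega>" "src \<Omega> \<alpha> = rng \<Omega> \<beta>" "src \<Omega> \<beta> = v"
          "mmap \<pi> \<alpha> = fst p" "mmap \<pi> \<beta> = snd p"
        by blast
      have "\<kappa> = mmap \<pi> (cmp \<Omega> \<alpha> \<beta>)" using p ab cmp by metis
      then have "src \<Gamma> \<kappa> = omap \<pi> v" using src[of "cmp \<Omega> \<alpha> \<beta>"] ab by (simp add: \<Omega>.cmp_in \<Omega>.src_cmp)
      then have v': "src \<Gamma> (snd p) = omap \<pi> (src \<Omega> \<delta>)" using v \<delta> src by simp
      from p pair[OF _ _ _ v' \<Omega>.src_in[OF \<delta>(1)]]
      obtain \<alpha> \<beta> where ab: "\<alpha> \<in> mors \<Omega>" "\<beta> \<in> mors \<Omega>" "src \<Omega> \<alpha> = rng \<Omega> \<beta>"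
          "src \<Omega> \<beta> = src \<Omega> \<delta>" "mmap \<pi> \<alpha> = fst p" "mmap \<pi> \<beta> = snd p"
        by blast
      have \<kappa>: "mmap \<pi> \<delta> = mmap \<pi> (cmp \<Omega> \<alpha> \<beta>)" using p \<delta> ab cmp by metis
      have "\<delta> = cmp \<Omega> \<alpha> \<beta>"
        by (rule inj) (use \<kappa> \<delta>(1) ab in \<open>simp_all add: \<Omega>.cmp_in \<Omega>.src_cmp\<close>)
      moreover have "deg \<Omega> \<alpha> = m" "deg \<Omega> \<beta> = n"
        using deg[OF ab(1)] deg[OF ab(2)] ab(5,6) p by simp_all
      ultimately have "\<alpha> = \<mu> \<and> \<beta> = \<nu>"
        by (intro \<Omega>.unique_factorization_eq) (use f ab in simp_all)
      then show "p = (mmap \<pi> \<mu>, mmap \<pi> \<nu>)" using ab(5,6) by (cases p) simp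
    qed
  qed
qed

lemma (in kgraph_hom) emap_eq_ghost:
  assumes "e \<in> edges \<Omega>" "emap e = ghost \<Gamma> \<kappa>"
  shows "\<exists>\<delta> \<in> mors \<Omega>. mmap \<pi> \<delta> = \<kappa> \<and> e = ghost \<Omega> \<delta>"
proof (cases e)
  case (Fwd \<delta>)
  then have *: "deg \<Gamma> \<kappa> = 0" "mmap \<pi> \<delta> = \<kappa>" "\<delta> \<in> mors \<Omega>"
    using assms by (auto simp: ghost_def split: if_splits)
  then have "deg \<Omega> \<delta> = 0" using hom_simps(6)[OF *(3)] by simp
  then show ?thesis using * Fwd by (intro bexI[of _ \<delta>]) (simp_all add: ghost_def)
next
  case (Bwd \<delta>)
  then have "mmap \<pi> \<delta> = \<kappa>" using assms(2) by (auto simp: ghost_def split: if_splits)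
  then show ?thesis using assms(1) Bwd
    by (intro bexI[of _ \<delta>]) (simp_all add: ghost_def dom.Bwd_in_edges)
qed

section \<open>Representation graphs as immersions\<close>

locale rep_graph = kgraph_immersion \<Omega> \<Lambda> \<zeta>
  for \<Omega> :: "('p, 'q, 'k::finite) kgraph" and \<Lambda> :: "('o, 'm, 'k) kgraph"
    and \<zeta> :: "('p, 'q, 'o, 'm) kmor" +
  assumes lift_from: "v \<in> objs \<Omega> \<Longrightarrow> \<kappa> \<in> mors \<Lambda> \<Longrightarrow> src \<Lambda> \<kappa> = omap \<zeta> v \<Longrightarrow>
      \<exists>\<delta> \<in> mors \<Omega>. src \<Omega> \<delta> = v \<and> mmap \<zeta> \<delta> = \<kappa>"
    and ex_to: "v \<in> objs \<Omega> \<Longrightarrow> \<exists>\<delta> \<in> mors \<Omega>. rng \<Omega> \<delta> = v \<and> deg \<Omega> \<delta> = n"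
    and unique_to: "\<delta> \<in> mors \<Omega> \<Longrightarrow> \<epsilon> \<in> mors \<Omega> \<Longrightarrow> rng \<Omega> \<delta> = rng \<Omega> \<epsilon> \<Longrightarrow> deg \<Omega> \<delta> = deg \<Omega> \<epsilon> \<Longrightarrow> \<delta> = \<epsilon>"

text \<open>Injectivity at ranges comes from the degree: it is preserved by \<zeta> and determines a
  morphism with given range.\<close>

lemma rep_kgraph_imp_rep_graph:
  assumes "k_graph \<Lambda>" "rep_kgraph \<Lambda> \<Omega> \<zeta>"
  shows "rep_graph \<Omega> \<Lambda> \<zeta>"
proof -
  have std: "standing_k_graph \<Omega>" and mor: "kgraph_morphism \<Omega> \<Lambda> \<zeta>"
    and bij: "\<And>v. v \<in> objs \<Omega> \<Longrightarrow> bij_betw (mmap \<zeta>) (mors_from \<Omega> v) (mors_from \<Lambda> (omap \<zeta> v))"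
    and sing: "\<And>v n. v \<in> objs \<Omega> \<Longrightarrow> is_singleton (mors_to_deg \<Omega> v n)"
    using assms(2) by (auto simp: rep_kgraph_def)
  interpret dom: standing_k_graph \<Omega> by (rule std)
  interpret cod: k_graph \<Lambda> by (rule assms(1))
  interpret h: kgraph_hom \<Omega> \<Lambda> \<zeta> by unfold_locales (rule mor)
  have unique: "\<delta> = \<epsilon>" if D: "\<delta> \<in> mors \<Omega>" "\<epsilon> \<in> mors \<Omega>" "rng \<Omega> \<delta> = rng \<Omega> \<epsilon>" "deg \<Omega> \<delta> = deg \<Omega> \<epsilon>" for \<delta> \<epsilon>
  proof -
    obtain \<eta> where "mors_to_deg \<Omega> (rng \<Omega> \<epsilon>) (deg \<Omega> \<epsilon>) = {\<eta>}"
      using sing[OF dom.rng_in[OF D(2)]] is_singletonE by metis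
    moreover have "\<delta> \<in> mors_to_deg \<Omega> (rng \<Omega> \<epsilon>) (deg \<Omega> \<epsilon>)" "\<epsilon> \<in> mors_to_deg \<Omega> (rng \<Omega> \<epsilon>) (deg \<Omega> \<epsilon>)"
      using that by (simp_all add: mors_to_deg_def mors_to_def)
    ultimately show ?thesis by simp
  qed
  show ?thesis
  proof
    show "\<delta> = \<epsilon>" if "\<delta> \<in> mors \<Omega>" "\<epsilon> \<in> mors \<Omega>" "src \<Omega> \<delta> = src \<Omega> \<epsilon>" "mmap \<zeta> \<delta> = mmap \<zeta> \<epsilon>" for \<delta> \<epsilon>
      using bij_betw_imp_inj_on[OF bij[of "src \<Omega> \<delta>"]] that dom.src_in
      by (auto dest!: inj_onD simp: mors_from_def)
    show "\<delta> = \<epsilon>" if "\<delta> \<in> mors \<Omega>" "\<epsilon> \<in> mors \<Omega>" "rng \<Omega> \<delta> = rng \<Omega> \<epsilon>" "mmap \<zeta> \<delta> = mmap \<zeta> \<epsilon>" for \<delta> \<epsilon>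
    proof -
      have "deg \<Omega> \<delta> = deg \<Omega> \<epsilon>"
        using h.hom_simps(6)[OF that(1)] h.hom_simps(6)[OF that(2)] that(4) by simp
      then show ?thesis using unique that by blast
    qed
    show "\<exists>\<delta>\<in>mors \<Omega>. src \<Omega> \<delta> = v \<and> mmap \<zeta> \<delta> = \<kappa>"
      if "v \<in> objs \<Omega>" "\<kappa> \<in> mors \<Lambda>" "src \<Lambda> \<kappa> = omap \<zeta> v" for v \<kappa>
    proof -
      have "\<kappa> \<in> mmap \<zeta> ` mors_from \<Omega> v"
        using bij_betw_imp_surj_on[OF bij[of v]] that by (simp add: mors_from_def)
      then show ?thesis by (auto simp: mors_from_def)
    qed
    show "\<exists>\<delta>\<in>mors \<Omega>. rng \<Omega> \<delta> = v \<and> deg \<Omega> \<delta> = n" if v: "v \<in> objs \<Omega>" for v n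
    proof -
      obtain \<eta> where "mors_to_deg \<Omega> v n = {\<eta>}" using sing[OF v] is_singletonE by metis
      then have "\<eta> \<in> mors_to_deg \<Omega> v n" by simp
      then show ?thesis by (auto simp: mors_to_deg_def mors_to_def)
    qed
  qed (rule unique)
qed

context rep_graph
begin

abbreviation "vsim \<equiv> vertex_sim (\<Omega>, \<zeta>)"
abbreviation "msim \<equiv> mor_sim (\<Omega>, \<zeta>)"
abbreviation "\<Gamma> \<equiv> quotient_graph (\<Omega>, \<zeta>)"

definition qmap :: "('p, 'q, 'p set, 'q set) kmor" where
  "qmap = \<lparr>omap = (\<lambda>v. vsim `` {v}), mmap = (\<lambda>\<delta>. msim `` {\<delta>})\<rparr>"

lemma vsim_iff: "(u, v) \<in> vsim \<longleftrightarrow> u \<in> objs \<Omega> \<and> v \<in> objs \<Omega> \<and>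
    walk_map \<zeta> ` walks_from \<Omega> u = walk_map \<zeta> ` walks_from \<Omega> v"
  by (simp add: vertex_sim_def)

lemma msim_iff: "(\<delta>, \<epsilon>) \<in> msim \<longleftrightarrow> \<delta> \<in> mors \<Omega> \<and> \<epsilon> \<in> mors \<Omega> \<and>
    (src \<Omega> \<delta>, src \<Omega> \<epsilon>) \<in> vsim \<and> mmap \<zeta> \<delta> = mmap \<zeta> \<epsilon>"
  by (simp add: mor_sim_def)

lemma equiv_vsim: "equiv (objs \<Omega>) vsim"
  by (auto simp: equiv_def refl_on_def sym_def trans_def vsim_iff)

lemma vsim_sym: "(u, v) \<in> vsim \<Longrightarrow> (v, u) \<in> vsim"
  by (simp add: vsim_iff)

lemma equiv_msim: "equiv (mors \<Omega>) msim"
  by (auto simp: equiv_def refl_on_def sym_def trans_def msim_iff vsim_iff dom.src_in)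

lemma qmap_omap_eq: "u \<in> objs \<Omega> \<Longrightarrow> v \<in> objs \<Omega> \<Longrightarrow> omap qmap u = omap qmap v \<longleftrightarrow> (u, v) \<in> vsim"
  by (simp add: qmap_def eq_equiv_class_iff[OF equiv_vsim])

lemma qmap_mmap_eq: "\<delta> \<in> mors \<Omega> \<Longrightarrow> \<epsilon> \<in> mors \<Omega> \<Longrightarrow> mmap qmap \<delta> = mmap qmap \<epsilon> \<longleftrightarrow> (\<delta>, \<epsilon>) \<in> msim"
  by (simp add: qmap_def eq_equiv_class_iff[OF equiv_msim])

lemma vsim_walk:
  assumes "(u, v) \<in> vsim" "p \<in> walks \<Omega>" "wsrc \<Omega> p = u"
  shows "\<exists>q \<in> walks \<Omega>. wsrc \<Omega> q = v \<and> walk_map \<zeta> q = walk_map \<zeta> p"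
proof -
  have "walk_map \<zeta> p \<in> walk_map \<zeta> ` walks_from \<Omega> v"
    using assms unfolding vsim_iff by (auto simp: walks_from_def)
  then show ?thesis by (auto simp: walks_from_def)
qed

text \<open>The label of the identity walk at \<open>u\<close> is also the label of a walk from
  \<open>v\<close>, and its source is the image of both.\<close>

lemma vsim_omap: assumes "(u, v) \<in> vsim" shows "omap \<zeta> u = omap \<zeta> v"
proof -
  have u: "u \<in> objs \<Omega>" using assms by (simp add: vsim_iff)
  then obtain q where q: "q \<in> walks \<Omega>" "wsrc \<Omega> q = v" "walk_map \<zeta> q = walk_map \<zeta> [Fwd (idm \<Omega> u)]"
    using vsim_walk[OF assms, of "[Fwd (idm \<Omega> u)]"] by (auto simp: dom.src_idm)
  then show ?thesis
    using walk_map_in[OF q(1)] walk_map_in[OF dom.idm_walk[OF u]] u by (simp add: dom.src_idm)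
qed

text \<open>A continuation \<open>r\<close> of \<open>p\<close> gives the label of
  \<open>r @ p\<close>, which also occurs from the start of \<open>q\<close>. By unique lifting the
  first portion of that walk is \<open>q\<close>, and the rest continues it with the label of
  \<open>r\<close>.\<close>

lemma vsim_walk_end:
  assumes "(wsrc \<Omega> p, wsrc \<Omega> q) \<in> vsim" "p \<in> walks \<Omega>" "q \<in> walks \<Omega>" "walk_map \<zeta> p = walk_map \<zeta> q"
  shows "(wrng \<Omega> p, wrng \<Omega> q) \<in> vsim"
proof -
  have *: "walk_map \<zeta> ` walks_from \<Omega> (wrng \<Omega> p) \<subseteq> walk_map \<zeta> ` walks_from \<Omega> (wrng \<Omega> q)"
    if A: "(wsrc \<Omega> p, wsrc \<Omega> q) \<in> vsim" "p \<in> walks \<Omega>" "q \<in> walks \<Omega>" "walk_map \<zeta> p = walk_map \<zeta> q" for p q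
  proof clarify
    fix r assume "r \<in> walks_from \<Omega> (wrng \<Omega> p)"
    then have r: "r \<in> walks \<Omega>" "wsrc \<Omega> r = wrng \<Omega> p" by (auto simp: walks_from_def)
    have n: "p \<noteq> []" "q \<noteq> []" "r \<noteq> []" using that r walks_not_Nil by auto
    then have "r @ p \<in> walks \<Omega>" "wsrc \<Omega> (r @ p) = wsrc \<Omega> p" using r that by (simp_all add: walks_append)
    then obtain s where s: "s \<in> walks \<Omega>" "wsrc \<Omega> s = wsrc \<Omega> q" "walk_map \<zeta> s = walk_map \<zeta> r @ walk_map \<zeta> p"
      using vsim_walk[OF A(1), of "r @ p"] unfolding walk_map_simps(3) by blast
    then obtain s1 s2 where s12: "s = s1 @ s2" "walk_map \<zeta> s1 = walk_map \<zeta> r" "walk_map \<zeta> s2 = walk_map \<zeta> p"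
      unfolding walk_map_def by (auto simp: map_eq_append_conv)
    then have n': "s1 \<noteq> []" "s2 \<noteq> []" using n walk_map_simps(4) by metis+
    then have "s2 = q" using s s12 that by (intro walk_unique) (simp_all add: walks_append)
    then have "s1 \<in> walks_from \<Omega> (wrng \<Omega> q)" using s s12 n n' by (simp add: walks_from_def walks_append)
    then show "walk_map \<zeta> r \<in> walk_map \<zeta> ` walks_from \<Omega> (wrng \<Omega> q)" using s12(2) by (metis image_eqI)
  qed
  show ?thesis unfolding vsim_iff
    using *[OF assms] *[OF vsim_sym[OF assms(1)] assms(3,2) assms(4)[symmetric]] assms dom.wrng_in by blast
qed

lemma msim_rng: assumes "(\<delta>, \<epsilon>) \<in> msim" shows "(rng \<Omega> \<delta>, rng \<Omega> \<epsilon>) \<in> vsim"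
  using vsim_walk_end[of "[Fwd \<delta>]" "[Fwd \<epsilon>]"] assms by (simp add: msim_iff walks_Cons)

text \<open>All representatives contribute the same class, so the union in the definition collapses
  to it. The other operations are computed in the same way.\<close>

lemma quotient_src:
  assumes "\<delta> \<in> mors \<Omega>" shows "src \<Gamma> (mmap qmap \<delta>) = omap qmap (src \<Omega> \<delta>)"
proof -
  have *: "vsim `` {src \<Omega> \<epsilon>} = vsim `` {src \<Omega> \<delta>}" if "\<epsilon> \<in> msim `` {\<delta>}" for \<epsilon>
    using that by (intro equiv_class_eq[OF equiv_vsim]) (auto simp: msim_iff vsim_sym)
  have "(\<Union>\<epsilon> \<in> msim `` {\<delta>}. vsim `` {src \<Omega> \<epsilon>}) = vsim `` {src \<Omega> \<delta>}"
    by (rule UN_constant_eq[OF equiv_class_self[OF equiv_msim assms]], rule ballI, erule *)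
  then show ?thesis by (simp add: quotient_graph_def qmap_def)
qed

lemma quotient_rng:
  assumes "\<delta> \<in> mors \<Omega>" shows "rng \<Gamma> (mmap qmap \<delta>) = omap qmap (rng \<Omega> \<delta>)"
proof -
  have *: "vsim `` {rng \<Omega> \<epsilon>} = vsim `` {rng \<Omega> \<delta>}" if "\<epsilon> \<in> msim `` {\<delta>}" for \<epsilon>
    using that by (intro equiv_class_eq[OF equiv_vsim]) (auto intro: vsim_sym msim_rng)
  have "(\<Union>\<epsilon> \<in> msim `` {\<delta>}. vsim `` {rng \<Omega> \<epsilon>}) = vsim `` {rng \<Omega> \<delta>}"
    by (rule UN_constant_eq[OF equiv_class_self[OF equiv_msim assms]], rule ballI, erule *)
  then show ?thesis by (simp add: quotient_graph_def qmap_def)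
qed

lemma quotient_deg:
  assumes "\<delta> \<in> mors \<Omega>" shows "deg \<Gamma> (mmap qmap \<delta>) = deg \<Omega> \<delta>"
proof -
  have *: "deg \<Omega> \<epsilon> = deg \<Omega> \<delta>" if "\<epsilon> \<in> msim `` {\<delta>}" for \<epsilon>
    using that hom_simps(6)[of \<epsilon>] hom_simps(6)[of \<delta>] by (auto simp: msim_iff)
  have "deg \<Omega> ` (msim `` {\<delta>}) = (\<lambda>_. deg \<Omega> \<delta>) ` (msim `` {\<delta>})"
    by (rule image_cong[OF refl *])
  also have "\<dots> = {deg \<Omega> \<delta>}"
    by (rule image_constant[OF equiv_class_self[OF equiv_msim assms]])
  finally have "deg \<Omega> ` (msim `` {\<delta>}) = {deg \<Omega> \<delta>}" .
  then show ?thesis unfolding quotient_graph_def qmap_def by simp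
qed

lemma quotient_idm:
  assumes "v \<in> objs \<Omega>" shows "idm \<Gamma> (omap qmap v) = mmap qmap (idm \<Omega> v)"
proof -
  have *: "msim `` {idm \<Omega> u} = msim `` {idm \<Omega> v}" if "u \<in> vsim `` {v}" for u
  proof (rule equiv_class_eq[OF equiv_msim])
    have "(u, v) \<in> vsim" "u \<in> objs \<Omega>" using that by (auto intro: vsim_sym simp: vsim_iff)
    then show "(idm \<Omega> u, idm \<Omega> v) \<in> msim"
      using assms vsim_omap by (simp add: msim_iff dom.idm_in dom.src_idm)
  qed
  have "(\<Union>u \<in> vsim `` {v}. msim `` {idm \<Omega> u}) = msim `` {idm \<Omega> v}"
    by (rule UN_constant_eq[OF equiv_class_self[OF equiv_vsim assms]], rule ballI, erule *)
  then show ?thesis by (simp add: quotient_graph_def qmap_def)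
qed

text \<open>Representatives of composable classes need not be composable. Moving the label of the
  left one to the range of the right one gives a composite with the label of
  \<open>cmp \<Omega> \<delta> \<epsilon>\<close> and a related source.\<close>

lemma quotient_cmp:
  assumes "\<delta> \<in> mors \<Omega>" "\<epsilon> \<in> mors \<Omega>" "src \<Omega> \<delta> = rng \<Omega> \<epsilon>"
  shows "cmp \<Gamma> (mmap qmap \<delta>) (mmap qmap \<epsilon>) = mmap qmap (cmp \<Omega> \<delta> \<epsilon>)"
proof -
  let ?T = "\<lambda>\<delta>' \<epsilon>'. THE \<eta>. \<eta> \<in> mors_from \<Omega> (rng \<Omega> \<epsilon>') \<and> mmap \<zeta> \<eta> = mmap \<zeta> \<delta>'"
  have *: "msim `` {cmp \<Omega> (?T \<delta>' \<epsilon>') \<epsilon>'} = msim `` {cmp \<Omega> \<delta> \<epsilon>}"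
    if \<delta>': "(\<delta>, \<delta>') \<in> msim" and \<epsilon>': "(\<epsilon>, \<epsilon>') \<in> msim" for \<delta>' \<epsilon>'
  proof -
    have m: "\<delta>' \<in> mors \<Omega>" "\<epsilon>' \<in> mors \<Omega>" "mmap \<zeta> \<delta>' = mmap \<zeta> \<delta>" "mmap \<zeta> \<epsilon>' = mmap \<zeta> \<epsilon>"
      using \<delta>' \<epsilon>' by (simp_all add: msim_iff)
    have "omap \<zeta> (rng \<Omega> \<epsilon>') = omap \<zeta> (src \<Omega> \<delta>)" using vsim_omap[OF msim_rng[OF \<epsilon>']] assms(3) by simp
    then have "src \<Lambda> (mmap \<zeta> \<delta>) = omap \<zeta> (rng \<Omega> \<epsilon>')" using assms(1) by simp
    then obtain \<eta> where \<eta>: "\<eta> \<in> mors \<Omega>" "src \<Omega> \<eta> = rng \<Omega> \<epsilon>'" "mmap \<zeta> \<eta> = mmap \<zeta> \<delta>"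
      using lift_from[OF dom.rng_in[OF m(2)] hom_simps(3)[OF assms(1)]] by blast
    have "?T \<delta>' \<epsilon>' = \<eta>"
    proof (rule the_equality)
      show "\<eta> \<in> mors_from \<Omega> (rng \<Omega> \<epsilon>') \<and> mmap \<zeta> \<eta> = mmap \<zeta> \<delta>'" using \<eta> m by (simp add: mors_from_def)
      show "\<theta> = \<eta>" if "\<theta> \<in> mors_from \<Omega> (rng \<Omega> \<epsilon>') \<and> mmap \<zeta> \<theta> = mmap \<zeta> \<delta>'" for \<theta>
        by (rule inj_from) (use that \<eta> m in \<open>simp_all add: mors_from_def\<close>)
    qed
    moreover have "(cmp \<Omega> \<eta> \<epsilon>', cmp \<Omega> \<delta> \<epsilon>) \<in> msim"
      using \<eta> m assms \<epsilon>' by (simp add: msim_iff dom.cmp_in dom.src_cmp vsim_sym)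
    ultimately show ?thesis using equiv_class_eq[OF equiv_msim] by simp
  qed
  have "(\<Union>\<delta>' \<in> msim `` {\<delta>}. \<Union>\<epsilon>' \<in> msim `` {\<epsilon>}. msim `` {cmp \<Omega> (?T \<delta>' \<epsilon>') \<epsilon>'}) = msim `` {cmp \<Omega> \<delta> \<epsilon>}"
    by (rule UN_constant_eq[OF equiv_class_self[OF equiv_msim assms(1)]], rule ballI,
        rule UN_constant_eq[OF equiv_class_self[OF equiv_msim assms(2)]], rule ballI, rule *) simp_all
  then show ?thesis by (simp add: quotient_graph_def qmap_def)
qed

lemma quotient_objs: "objs \<Gamma> = omap qmap ` objs \<Omega>"
  and quotient_mors: "mors \<Gamma> = mmap qmap ` mors \<Omega>"
  by (auto simp: quotient_graph_def qmap_def quotient_def)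

lemma quotient_lift_from:
  assumes "v \<in> objs \<Omega>" "\<kappa> \<in> mors \<Gamma>" "src \<Gamma> \<kappa> = omap qmap v"
  shows "\<exists>\<delta> \<in> mors \<Omega>. src \<Omega> \<delta> = v \<and> mmap qmap \<delta> = \<kappa>"
proof -
  obtain \<delta> where \<delta>: "\<delta> \<in> mors \<Omega>" "\<kappa> = mmap qmap \<delta>" using assms(2) quotient_mors by auto
  then have s: "(src \<Omega> \<delta>, v) \<in> vsim"
    using assms(1,3) quotient_src qmap_omap_eq dom.src_in by simp
  then obtain \<epsilon> where \<epsilon>: "\<epsilon> \<in> mors \<Omega>" "src \<Omega> \<epsilon> = v" "mmap \<zeta> \<epsilon> = mmap \<zeta> \<delta>"
    using lift_from[OF assms(1) hom_simps(3)[OF \<delta>(1)]] vsim_omap[OF s] \<delta>(1) by auto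
  then have "(\<epsilon>, \<delta>) \<in> msim" using s \<delta> by (simp add: msim_iff vsim_sym)
  then show ?thesis using \<epsilon> \<delta> qmap_mmap_eq by blast
qed

text \<open>Here ~ does its work: the reversed morphism is a walk with one edge from the range of
  \<delta>, so a walk with the same label starts at \<open>v\<close>, although \<zeta> has no
  lifting at ranges in general.\<close>

lemma quotient_lift_to:
  assumes "v \<in> objs \<Omega>" "\<kappa> \<in> mors \<Gamma>" "rng \<Gamma> \<kappa> = omap qmap v"
  shows "\<exists>\<delta> \<in> mors \<Omega>. rng \<Omega> \<delta> = v \<and> mmap qmap \<delta> = \<kappa>"
proof -
  obtain \<delta> where \<delta>: "\<delta> \<in> mors \<Omega>" "\<kappa> = mmap qmap \<delta>" using assms(2) quotient_mors by auto
  then have s: "(rng \<Omega> \<delta>, v) \<in> vsim"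
    using assms(1,3) quotient_rng qmap_omap_eq dom.rng_in by simp
  have g: "[ghost \<Omega> \<delta>] \<in> walks \<Omega>" "wsrc \<Omega> [ghost \<Omega> \<delta>] = rng \<Omega> \<delta>"
    using \<delta> by (simp_all add: walks_Cons)
  then obtain q where q: "q \<in> walks \<Omega>" "wsrc \<Omega> q = v" "walk_map \<zeta> q = walk_map \<zeta> [ghost \<Omega> \<delta>]"
    using vsim_walk[OF s] by blast
  then obtain e where e: "q = [e]" "emap e = emap (ghost \<Omega> \<delta>)" by (auto simp: walk_map_def)
  then have ee: "e \<in> edges \<Omega>" using q by (simp add: walks_Cons)
  have "\<exists>\<epsilon> \<in> mors \<Omega>. mmap \<zeta> \<epsilon> = mmap \<zeta> \<delta> \<and> e = ghost \<Omega> \<epsilon>"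
    using emap_eq_ghost[OF ee] e(2) emap_ghost[OF \<delta>(1)] by simp
  then obtain \<epsilon> where \<epsilon>: "\<epsilon> \<in> mors \<Omega>" "mmap \<zeta> \<epsilon> = mmap \<zeta> \<delta>" "e = ghost \<Omega> \<epsilon>" by blast
  have r: "rng \<Omega> \<epsilon> = v" using q e \<epsilon> by simp
  have "(wrng \<Omega> q, wrng \<Omega> [ghost \<Omega> \<delta>]) \<in> vsim"
    using vsim_walk_end[OF _ q(1) g(1) q(3)] q(2) g(2) vsim_sym[OF s] by simp
  then have "(\<epsilon>, \<delta>) \<in> msim" using \<epsilon> e \<delta> by (simp add: msim_iff)
  then show ?thesis using \<epsilon> r \<delta> qmap_mmap_eq by blast
qed

text \<open>Related morphisms have the same image under \<zeta>, so the quotient map inherits the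
  local injectivity of \<zeta>.\<close>

sublocale quot: kgraph_covering \<Omega> \<Gamma> qmap
proof -
  have inj_from': "\<delta> = \<epsilon>" if "\<delta> \<in> mors \<Omega>" "\<epsilon> \<in> mors \<Omega>" "src \<Omega> \<delta> = src \<Omega> \<epsilon>" "mmap qmap \<delta> = mmap qmap \<epsilon>" for \<delta> \<epsilon>
    by (rule inj_from) (use that qmap_mmap_eq msim_iff in simp_all)
  have "k_graph \<Gamma>"
    by (rule k_graph_image[where \<pi> = qmap, OF dom.k_graph_axioms quotient_objs quotient_mors quotient_src
          quotient_rng quotient_deg quotient_idm quotient_cmp quotient_lift_from inj_from'])
  then interpret \<Gamma>: k_graph \<Gamma> .
  show "kgraph_covering \<Omega> \<Gamma> qmap"
  proof
    show "kgraph_morphism \<Omega> \<Gamma> qmap" unfolding kgraph_morphism_def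
      by (simp add: quotient_objs quotient_mors quotient_src quotient_rng quotient_deg quotient_idm quotient_cmp)
    show "\<delta> = \<epsilon>" if "\<delta> \<in> mors \<Omega>" "\<epsilon> \<in> mors \<Omega>" "rng \<Omega> \<delta> = rng \<Omega> \<epsilon>" "mmap qmap \<delta> = mmap qmap \<epsilon>" for \<delta> \<epsilon>
      by (rule inj_to) (use that qmap_mmap_eq msim_iff in simp_all)
  qed (fact inj_from' quotient_lift_from quotient_lift_to)+
qed

end

section \<open>Linear maps between free vector spaces\<close>

lemma lookup_scl [simp]: "Poly_Mapping.lookup (scl c x) k = c * Poly_Mapping.lookup x k"
  by (simp add: scl_def Poly_Mapping.map.rep_eq when_def)

lemma scl_simps [simp]:
  "scl c 0 = 0" "scl 0 x = 0" "scl 1 x = x"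
  "scl c (Poly_Mapping.single k a) = Poly_Mapping.single k (c * a)"
  by (rule poly_mapping_eqI; simp add: lookup_single when_def)+

lemma scl_add: "scl c (x + y) = scl c x + scl c y"
  and scl_add_left: "scl (c + d) x = scl c x + scl d x"
  and scl_scl: "scl c (scl d x) = scl (c * d) x"
  by (rule poly_mapping_eqI; simp add: lookup_add algebra_simps)+

lemma scl_sum: "scl c (sum f S) = (\<Sum>s\<in>S. scl c (f s))"
  by (rule poly_mapping_eqI) (simp add: lookup_sum sum_distrib_left)

definition lin :: "(('b \<Rightarrow>\<^sub>0 'a::field) \<Rightarrow> ('c \<Rightarrow>\<^sub>0 'a)) \<Rightarrow> bool" where
  "lin f \<longleftrightarrow> (\<forall>x y. f (x + y) = f x + f y) \<and> (\<forall>c x. f (scl c x) = scl c (f x))"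

lemma lin_add: "lin f \<Longrightarrow> f (x + y) = f x + f y"
  and lin_scl: "lin f \<Longrightarrow> f (scl c x) = scl c (f x)"
  by (simp_all add: lin_def)

lemma lin_0: "lin f \<Longrightarrow> f 0 = 0"
  using lin_scl[of f 0 0] by simp

lemma lin_diff: "lin f \<Longrightarrow> f (x - y) = f x - f y"
  using lin_add[of f "x - y" y] by (simp add: algebra_simps)

lemma lin_sum: "lin f \<Longrightarrow> f (sum g S) = (\<Sum>s\<in>S. f (g s))"
  by (induction S rule: infinite_finite_induct) (simp_all add: lin_0 lin_add)

lemma lin_comp: "lin f \<Longrightarrow> lin g \<Longrightarrow> lin (\<lambda>x. f (g x))"
  by (simp add: lin_def)

lemma lin_id: "lin (\<lambda>x. x)"
  by (simp add: lin_def)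

lemma lin_extend_superset:
  assumes "finite S" "Poly_Mapping.keys x \<subseteq> S"
  shows "lin_extend f x = (\<Sum>b\<in>S. scl (Poly_Mapping.lookup x b) (f b))"
  unfolding lin_extend_def using assms by (intro sum.mono_neutral_left) (auto simp: in_keys_iff)

lemma lin_lin_extend [simp]: "lin (lin_extend f)"
proof -
  have "lin_extend f (x + y) = lin_extend f x + lin_extend f y" for x y
  proof -
    let ?S = "Poly_Mapping.keys x \<union> Poly_Mapping.keys y"
    have "Poly_Mapping.keys (x + y) \<subseteq> ?S" by (rule keys_add)
    then show ?thesis
      by (simp add: lin_extend_superset[of ?S] lookup_add scl_add_left sum.distrib)
  qed
  moreover have "lin_extend f (scl c x) = scl c (lin_extend f x)" for c x
  proof -
    have "Poly_Mapping.keys (scl c x) \<subseteq> Poly_Mapping.keys x" by (auto simp: in_keys_iff)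
    then show ?thesis
      by (simp add: lin_extend_superset[of "Poly_Mapping.keys x"] scl_sum scl_scl)
  qed
  ultimately show ?thesis by (simp add: lin_def)
qed

lemma lin_extend_single [simp]: "lin_extend f (Poly_Mapping.single b c) = scl c (f b)"
  by (simp add: lin_extend_superset[of "{b}"])

lemma lin_extend_0 [simp]: "lin_extend f 0 = 0"
  by (simp add: lin_0)

lemma poly_mapping_eq_lin_extend: "x = lin_extend (\<lambda>b. Poly_Mapping.single b 1) x"
  by (rule poly_mapping_eqI)
    (auto simp: lin_extend_def lookup_sum lookup_single when_def in_keys_iff sum.delta')

text \<open>Agreement is demanded on the support of \<open>x\<close> only, since many identities
  below hold just for vertices of \<Omega> or for words in the generators.\<close>

lemma lin_eqI:
  fixes f g :: "('b \<Rightarrow>\<^sub>0 'a::field) \<Rightarrow> ('c \<Rightarrow>\<^sub>0 'a)"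
  assumes "lin f" "lin g"
    and "\<And>b. b \<in> Poly_Mapping.keys x \<Longrightarrow> f (Poly_Mapping.single b 1) = g (Poly_Mapping.single b 1)"
  shows "f x = g x"
proof -
  have "h x = (\<Sum>b\<in>Poly_Mapping.keys x. scl (Poly_Mapping.lookup x b) (h (Poly_Mapping.single b 1)))"
    if "lin h" for h :: "('b \<Rightarrow>\<^sub>0 'a) \<Rightarrow> ('c \<Rightarrow>\<^sub>0 'a)"
  proof -
    have "h x = h (\<Sum>b\<in>Poly_Mapping.keys x. scl (Poly_Mapping.lookup x b) (Poly_Mapping.single b 1))"
      using poly_mapping_eq_lin_extend[of x] by (simp add: lin_extend_def)
    also have "\<dots> = (\<Sum>b\<in>Poly_Mapping.keys x. h (scl (Poly_Mapping.lookup x b) (Poly_Mapping.single b 1)))"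
      by (rule lin_sum[OF that])
    finally show ?thesis by (simp only: lin_scl[OF that])
  qed
  from this[OF assms(1)] this[OF assms(2)] show ?thesis using assms(3) by simp
qed

text \<open>Linearity in the values of the basis map, while \<open>y\<close> carries the
  coefficients; with \<open>lin_lin_extend\<close> this makes such expressions bilinear.\<close>

lemma lin_extend_lin: "lin (\<lambda>x. lin_extend (\<lambda>b. F b x) y)" if "\<And>b. lin (F b)"
  using that by (auto simp: lin_def lin_extend_def scl_add sum.distrib scl_sum scl_scl mult.commute)

lemma convolution_eq_lin_extend:
  "convolution op x y = lin_extend (\<lambda>b. lin_extend (\<lambda>c. Poly_Mapping.single (op b c) 1) y) x"
  by (simp add: convolution_def lin_extend_def scl_sum)

lemma lin_convolution_left: "lin (\<lambda>x. convolution op x y)"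
  by (simp add: convolution_eq_lin_extend)

lemma lin_convolution_right: "lin (convolution op x)"
  unfolding convolution_eq_lin_extend by (rule lin_extend_lin) simp

lemma convolution_single [simp]:
  "convolution op (Poly_Mapping.single b s) (Poly_Mapping.single c t) = Poly_Mapping.single (op b c) (s * t)"
  by (simp add: convolution_eq_lin_extend)

lemma free_space_iff: "x \<in> free_space B \<longleftrightarrow> Poly_Mapping.keys x \<subseteq> B"
  by (simp add: free_space_def)

lemma free_space_0 [simp]: "0 \<in> free_space B"
  and free_space_single [simp]: "Poly_Mapping.single b c \<in> free_space B \<longleftrightarrow> b \<in> B \<or> c = 0"
  by (simp_all add: free_space_iff)

lemma free_space_add: "x \<in> free_space B \<Longrightarrow> y \<in> free_space B \<Longrightarrow> x + y \<in> free_space B"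
  using keys_add[of x y] by (auto simp: free_space_iff)

lemma free_space_scl: "x \<in> free_space B \<Longrightarrow> scl c x \<in> free_space B"
  by (auto simp: free_space_iff in_keys_iff subset_iff)

lemma free_space_diff: "x \<in> free_space B \<Longrightarrow> y \<in> free_space B \<Longrightarrow> x - y \<in> free_space B"
  by (auto simp: free_space_iff in_keys_iff subset_iff lookup_minus) (metis diff_zero)

lemma free_space_sum: "(\<And>s. s \<in> S \<Longrightarrow> f s \<in> free_space B) \<Longrightarrow> sum f S \<in> free_space B"
  by (induction S rule: infinite_finite_induct) (simp_all add: free_space_add)

lemma free_space_lin_extend:
  assumes "x \<in> free_space A" "\<And>b. b \<in> A \<Longrightarrow> f b \<in> free_space B"
  shows "lin_extend f x \<in> free_space B"
  unfolding lin_extend_def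
  by (rule free_space_sum, rule free_space_scl, rule assms(2)) (use assms(1) in \<open>auto simp: free_space_iff\<close>)

lemma keys_convolution:
  "Poly_Mapping.keys (convolution f x z) \<subseteq>
    {f b c | b c. b \<in> Poly_Mapping.keys x \<and> c \<in> Poly_Mapping.keys z}"
  unfolding free_space_iff[symmetric] convolution_eq_lin_extend
proof (rule free_space_lin_extend[where A = "Poly_Mapping.keys x"])
  fix b assume b: "b \<in> Poly_Mapping.keys x"
  show "lin_extend (\<lambda>c. Poly_Mapping.single (f b c) 1) z \<in>
      free_space {f b c | b c. b \<in> Poly_Mapping.keys x \<and> c \<in> Poly_Mapping.keys z}"
    by (rule free_space_lin_extend[where A = "Poly_Mapping.keys z"]) (use b in \<open>auto simp: free_space_iff\<close>)
qed (simp add: free_space_iff)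

lemma lookup_lin_extend_restrict:
  "Poly_Mapping.lookup (lin_extend (\<lambda>u. if u \<in> D then Poly_Mapping.single u 1 else 0) x) k =
    (if k \<in> D then Poly_Mapping.lookup x k else 0)"
proof -
  have "Poly_Mapping.lookup (lin_extend (\<lambda>u. if u \<in> D then Poly_Mapping.single u 1 else 0) x) k =
      (\<Sum>u\<in>Poly_Mapping.keys x. if u = k then (if k \<in> D then Poly_Mapping.lookup x k else 0) else 0)"
    unfolding lin_extend_def lookup_sum
    by (intro sum.cong refl) (auto simp: lookup_single when_def)
  then show ?thesis by (simp add: in_keys_iff)
qed

lemma lin_eqI_free:
  assumes "lin f" "lin g" "e \<in> free_space B"
    and "\<And>b. b \<in> B \<Longrightarrow> f (Poly_Mapping.single b 1) = g (Poly_Mapping.single b 1)"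
  shows "f e = g e"
  by (rule lin_eqI[OF assms(1,2)], rule assms(4)) (use assms(3) in \<open>auto simp: free_space_iff\<close>)

section \<open>The module of a representation graph\<close>

declare gen_act_basis.simps [simp del]

text \<open>The type argument fixes the field of coefficients.\<close>

locale rep_graph_over = rep_graph \<Omega> \<Lambda> \<zeta>
  for \<Omega> :: "('p, 'q, 'k::finite) kgraph" and \<Lambda> :: "('o, 'm, 'k) kgraph"
    and \<zeta> :: "('p, 'q, 'o, 'm) kmor" +
  fixes K :: "'a::field itself"
begin

abbreviation "rg \<equiv> (\<Omega>, \<zeta>)"

abbreviation vec :: "'p \<Rightarrow> ('p \<Rightarrow>\<^sub>0 'a)" where
  "vec v \<equiv> Poly_Mapping.single v 1"

abbreviation gen_act :: "'m edge \<Rightarrow> 'p \<Rightarrow> ('p \<Rightarrow>\<^sub>0 'a)" where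
  "gen_act \<equiv> gen_act_basis rg"

abbreviation wact :: "'m edge list \<Rightarrow> ('p \<Rightarrow>\<^sub>0 'a) \<Rightarrow> ('p \<Rightarrow>\<^sub>0 'a)" where
  "wact \<equiv> word_act rg"

abbreviation aact :: "('m edge list \<Rightarrow>\<^sub>0 'a) \<Rightarrow> ('p \<Rightarrow>\<^sub>0 'a) \<Rightarrow> ('p \<Rightarrow>\<^sub>0 'a)" where
  "aact \<equiv> free_act rg"

lemma gen_act_edge:
  assumes "e \<in> edges \<Omega>"
  shows "gen_act (emap e) (esrc \<Omega> e) = vec (erng \<Omega> e)"
proof (cases e)
  case (Fwd \<delta>)
  then have "(THE \<epsilon>. \<epsilon> \<in> mors_from \<Omega> (src \<Omega> \<delta>) \<and> mmap \<zeta> \<epsilon> = mmap \<zeta> \<delta>) = \<delta>"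
    using assms inj_from by (intro the_equality) (auto simp: mors_from_def)
  then show ?thesis using Fwd assms by (auto simp: gen_act_basis.simps mors_from_def)
next
  case (Bwd \<delta>)
  then have "(THE \<epsilon>. \<epsilon> \<in> mors_to \<Omega> (rng \<Omega> \<delta>) \<and> mmap \<zeta> \<epsilon> = mmap \<zeta> \<delta>) = \<delta>"
    using assms inj_to by (intro the_equality) (auto simp: mors_to_def dom.Bwd_in_edges)
  then show ?thesis using Bwd assms by (auto simp: gen_act_basis.simps mors_to_def dom.Bwd_in_edges)
qed

lemma gen_act_0:
  assumes "g \<in> edges \<Lambda>" "\<not> (\<exists>e \<in> edges \<Omega>. esrc \<Omega> e = v \<and> emap e = g)"
  shows "gen_act g v = 0"
proof (cases g)
  case (Fwd \<kappa>)
  have "\<not> (\<exists>\<delta> \<in> mors_from \<Omega> v. mmap \<zeta> \<delta> = \<kappa>)"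
  proof
    assume "\<exists>\<delta> \<in> mors_from \<Omega> v. mmap \<zeta> \<delta> = \<kappa>"
    then obtain \<delta> where "\<delta> \<in> mors \<Omega>" "src \<Omega> \<delta> = v" "mmap \<zeta> \<delta> = \<kappa>" by (auto simp: mors_from_def)
    then have "Fwd \<delta> \<in> edges \<Omega> \<and> esrc \<Omega> (Fwd \<delta>) = v \<and> emap (Fwd \<delta>) = g" using Fwd by simp
    then show False using assms(2) by blast
  qed
  then show ?thesis unfolding Fwd by (simp only: gen_act_basis.simps if_False)
next
  case (Bwd \<kappa>)
  have "\<not> (\<exists>\<delta> \<in> mors_to \<Omega> v. mmap \<zeta> \<delta> = \<kappa>)"
  proof
    assume "\<exists>\<delta> \<in> mors_to \<Omega> v. mmap \<zeta> \<delta> = \<kappa>"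
    then obtain \<delta> where *: "\<delta> \<in> mors \<Omega>" "rng \<Omega> \<delta> = v" "mmap \<zeta> \<delta> = \<kappa>" by (auto simp: mors_to_def)
    \<comment> \<open>The action of \<open>Bwd \<kappa>\<close> is defined by lifts of \<kappa>, but
      only a lift of nonzero degree gives a reversed edge of \<Omega>.\<close>
    have "deg \<Omega> \<delta> \<noteq> 0" using assms(1) * Bwd hom_simps(6)[OF *(1)] by (simp add: cod.Bwd_in_edges)
    then have "Bwd \<delta> \<in> edges \<Omega> \<and> esrc \<Omega> (Bwd \<delta>) = v \<and> emap (Bwd \<delta>) = g"
      using Bwd * by (simp add: dom.Bwd_in_edges)
    then show False using assms(2) by blast
  qed
  then show ?thesis unfolding Bwd by (simp only: gen_act_basis.simps if_False)
qed

lemma word_act_simps [simp]: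
  "wact [] x = x"
  "wact (g # w) x = lin_extend (gen_act g) (wact w x)"
  by (simp_all add: word_act_def)

lemma word_act_append: "wact (v @ w) x = wact v (wact w x)"
  by (induction v) simp_all

lemma lin_word_act: "lin (wact w)"
proof (induction w)
  case Nil
  then show ?case by (simp add: lin_def)
next
  case (Cons g w)
  have "lin (\<lambda>x. lin_extend (gen_act g) (wact w x))"
    by (rule lin_comp[OF lin_lin_extend Cons])
  then show ?case by (simp add: lin_def)
qed

lemma word_act_walk:
  assumes "p \<in> walks \<Omega>"
  shows "wact (walk_map \<zeta> p) (vec (wsrc \<Omega> p)) = vec (wrng \<Omega> p)"
  using assms
proof (induction p rule: walks_induct)
  case (single e)
  then show ?case using gen_act_edge[of e] by simp
next
  case (Cons e p)
  then show ?case using gen_act_edge[of e] by (simp add: wsrc_Cons walks_not_Nil)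
qed

text \<open>Either the tail of the word already annihilates the vertex, or it leads along its lift
  to one vertex, at which the next letter has no lift.\<close>

lemma word_act_0:
  assumes "w \<noteq> []" "set w \<subseteq> edges \<Lambda>"
    and "\<not> (\<exists>p \<in> walks \<Omega>. wsrc \<Omega> p = v \<and> walk_map \<zeta> p = w)"
  shows "wact w (vec v) = (0 :: 'p \<Rightarrow>\<^sub>0 'a)"
  using assms
proof (induction w)
  case (Cons g w)
  show ?case
  proof (cases "w = []")
    case True
    have "\<not> (\<exists>e \<in> edges \<Omega>. esrc \<Omega> e = v \<and> emap e = g)"
    proof
      assume "\<exists>e \<in> edges \<Omega>. esrc \<Omega> e = v \<and> emap e = g"
      then obtain e where "e \<in> edges \<Omega>" "esrc \<Omega> e = v" "emap e = g" by blast
      then have "[e] \<in> walks \<Omega> \<and> wsrc \<Omega> [e] = v \<and> walk_map \<zeta> [e] = g # w"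
        using True by (simp add: walks_Cons)
      then show False using Cons.prems(3) by blast
    qed
    then show ?thesis using gen_act_0 Cons.prems True by simp
  next
    case False
    show ?thesis
    proof (cases "\<exists>p \<in> walks \<Omega>. wsrc \<Omega> p = v \<and> walk_map \<zeta> p = w")
      case True
      then obtain p where p: "p \<in> walks \<Omega>" "wsrc \<Omega> p = v" "walk_map \<zeta> p = w" by blast
      have "\<not> (\<exists>e \<in> edges \<Omega>. esrc \<Omega> e = wrng \<Omega> p \<and> emap e = g)"
      proof
        assume "\<exists>e \<in> edges \<Omega>. esrc \<Omega> e = wrng \<Omega> p \<and> emap e = g"
        then obtain e where "e \<in> edges \<Omega>" "esrc \<Omega> e = wrng \<Omega> p" "emap e = g" by blast
        then have "e # p \<in> walks \<Omega> \<and> wsrc \<Omega> (e # p) = v \<and> walk_map \<zeta> (e # p) = g # w"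
          using p by (simp add: walks_Cons wsrc_Cons walks_not_Nil)
        then show False using Cons.prems(3) by blast
      qed
      then have "gen_act g (wrng \<Omega> p) = (0 :: 'p \<Rightarrow>\<^sub>0 'a)" using gen_act_0 Cons.prems by simp
      then show ?thesis using word_act_walk[OF p(1)] p by simp
    next
      case no: False
      have "wact w (vec v) = (0 :: 'p \<Rightarrow>\<^sub>0 'a)"
        by (rule Cons.IH[OF False _ no]) (use Cons.prems in simp)
      then show ?thesis by simp
    qed
  qed
qed simp

lemma word_act_vec_free:
  assumes "set w \<subseteq> edges \<Lambda>" "v \<in> objs \<Omega>"
  shows "wact w (vec v) \<in> free_space (objs \<Omega>)"
proof (cases "w = [] \<or> (\<exists>p \<in> walks \<Omega>. wsrc \<Omega> p = v \<and> walk_map \<zeta> p = w)")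
  case True
  then show ?thesis
  proof
    assume "\<exists>p \<in> walks \<Omega>. wsrc \<Omega> p = v \<and> walk_map \<zeta> p = w"
    then obtain p where "p \<in> walks \<Omega>" "wsrc \<Omega> p = v" "walk_map \<zeta> p = w" by blast
    then show ?thesis using word_act_walk[of p] dom.wrng_in[of p] by simp
  qed (use assms(2) in simp)
next
  case False
  then show ?thesis using word_act_0[of w v] assms(1) by auto
qed

lemma word_act_free:
  assumes "set w \<subseteq> edges \<Lambda>" "x \<in> free_space (objs \<Omega>)"
  shows "wact w x \<in> free_space (objs \<Omega>)"
proof -
  have "wact w x = lin_extend (\<lambda>b. wact w (vec b)) x"
    by (rule lin_eqI[OF lin_word_act lin_lin_extend]) simp
  also have "\<dots> \<in> free_space (objs \<Omega>)"
    by (rule free_space_lin_extend[OF assms(2) word_act_vec_free[OF assms(1)]])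
  finally show ?thesis .
qed

lemma lin_free_act: "lin (aact a)"
proof -
  have "lin (\<lambda>x. lin_extend (\<lambda>w. wact w x) a)" by (rule lin_extend_lin) (rule lin_word_act)
  then show ?thesis by (simp add: lin_def free_act_def)
qed

lemma lin_free_act_left: "lin (\<lambda>a. aact a x)"
  by (simp add: free_act_def)

lemma free_act_word [simp]: "aact (Poly_Mapping.single w c) x = scl c (wact w x)"
  by (simp add: free_act_def)

lemma free_act_free:
  assumes "a \<in> kp_free \<Lambda>" "x \<in> free_space (objs \<Omega>)"
  shows "aact a x \<in> free_space (objs \<Omega>)"
  unfolding free_act_def
  by (rule free_space_lin_extend[OF assms(1)[unfolded kp_free_def]])
    (use word_act_free assms(2) cod.kp_generators_eq in auto)

lemma free_act_convolution:
  "aact (convolution (@) a b) x = aact a (aact b x)"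
proof (rule lin_eqI[where x = a])
  show "lin (\<lambda>a. aact (convolution (@) a b) x)"
    by (rule lin_comp[OF lin_free_act_left lin_convolution_left])
  show "lin (\<lambda>a. aact a (aact b x))" by (rule lin_free_act_left)
  fix v
  show "aact (convolution (@) (word v) b) x = aact (word v) (aact b x)"
  proof (rule lin_eqI[where x = b])
    show "lin (\<lambda>b. aact (convolution (@) (word v) b) x)"
      by (rule lin_comp[OF lin_free_act_left lin_convolution_right])
    show "lin (\<lambda>b. aact (word v) (aact b x))"
      by (rule lin_comp[OF lin_free_act lin_free_act_left])
  qed (simp add: word_act_append)
qed

lemma act_Fwd:
  assumes "\<delta> \<in> mors \<Omega>" shows "gen_act (Fwd (mmap \<zeta> \<delta>)) (src \<Omega> \<delta>) = vec (rng \<Omega> \<delta>)"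
  using gen_act_edge[of "Fwd \<delta>"] assms by simp

lemma act_Fwd_0:
  assumes "\<kappa> \<in> mors \<Lambda>" "src \<Lambda> \<kappa> \<noteq> omap \<zeta> v"
  shows "gen_act (Fwd \<kappa>) v = 0"
proof (rule gen_act_0)
  show "\<not> (\<exists>e\<in>edges \<Omega>. esrc \<Omega> e = v \<and> emap e = Fwd \<kappa>)"
  proof
    assume "\<exists>e\<in>edges \<Omega>. esrc \<Omega> e = v \<and> emap e = Fwd \<kappa>"
    then obtain e where "e \<in> edges \<Omega>" "esrc \<Omega> e = v" "emap e = Fwd \<kappa>" by blast
    then show False using assms(2) esrc_emap[of e] by simp
  qed
qed (use assms in simp)

lemma act_ghost:
  assumes "\<delta> \<in> mors \<Omega>" shows "gen_act (ghost \<Lambda> (mmap \<zeta> \<delta>)) (rng \<Omega> \<delta>) = vec (src \<Omega> \<delta>)"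
  using gen_act_edge[of "ghost \<Omega> \<delta>"] assms by (simp add: emap_ghost)

lemma act_ghost_0:
  assumes "\<kappa> \<in> mors \<Lambda>" "\<not> (\<exists>\<delta> \<in> mors \<Omega>. rng \<Omega> \<delta> = v \<and> mmap \<zeta> \<delta> = \<kappa>)"
  shows "gen_act (ghost \<Lambda> \<kappa>) v = 0"
proof (rule gen_act_0)
  show "\<not> (\<exists>e\<in>edges \<Omega>. esrc \<Omega> e = v \<and> emap e = ghost \<Lambda> \<kappa>)"
  proof
    assume "\<exists>e\<in>edges \<Omega>. esrc \<Omega> e = v \<and> emap e = ghost \<Lambda> \<kappa>"
    then obtain e where e: "e \<in> edges \<Omega>" "esrc \<Omega> e = v" "emap e = ghost \<Lambda> \<kappa>" by blast
    then obtain \<delta> where "\<delta> \<in> mors \<Omega>" "mmap \<zeta> \<delta> = \<kappa>" "e = ghost \<Omega> \<delta>" using emap_eq_ghost by blast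
    then show False using assms(2) e(2) by auto
  qed
qed (use assms in simp)

lemma act_idm:
  assumes "a \<in> objs \<Lambda>" "v \<in> objs \<Omega>"
  shows "gen_act (Fwd (idm \<Lambda> a)) v = (if omap \<zeta> v = a then vec v else 0)"
proof (cases "omap \<zeta> v = a")
  case True
  then show ?thesis
    using act_Fwd[OF dom.idm_in[OF assms(2)]] assms by (simp add: dom.src_idm dom.rng_idm)
next
  case False
  then show ?thesis using act_Fwd_0[of "idm \<Lambda> a" v] assms by (simp add: cod.idm_in cod.src_idm)
qed

section \<open>The Kumjian-Pask relations on the module\<close>

lemma lift_cmp:
  assumes "\<eta> \<in> mors \<Omega>" "\<kappa> \<in> mors \<Lambda>" "\<mu> \<in> mors \<Lambda>" "src \<Lambda> \<kappa> = rng \<Lambda> \<mu>" "mmap \<zeta> \<eta> = cmp \<Lambda> \<kappa> \<mu>"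
  shows "\<exists>\<delta> \<in> mors \<Omega>. \<exists>\<epsilon> \<in> mors \<Omega>. \<eta> = cmp \<Omega> \<delta> \<epsilon> \<and> src \<Omega> \<delta> = rng \<Omega> \<epsilon> \<and>
    mmap \<zeta> \<delta> = \<kappa> \<and> mmap \<zeta> \<epsilon> = \<mu>"
proof -
  have "src \<Lambda> \<mu> = omap \<zeta> (src \<Omega> \<eta>)"
    using hom_simps(4)[OF assms(1)] assms(5) cod.src_cmp[OF assms(2-4)] by simp
  then obtain \<epsilon> where \<epsilon>: "\<epsilon> \<in> mors \<Omega>" "src \<Omega> \<epsilon> = src \<Omega> \<eta>" "mmap \<zeta> \<epsilon> = \<mu>"
    using lift_from[OF dom.src_in[OF assms(1)] assms(3)] by blast
  have "src \<Lambda> \<kappa> = omap \<zeta> (rng \<Omega> \<epsilon>)" using hom_simps(5)[OF \<epsilon>(1)] \<epsilon>(3) assms(4) by simp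
  then obtain \<delta> where \<delta>: "\<delta> \<in> mors \<Omega>" "src \<Omega> \<delta> = rng \<Omega> \<epsilon>" "mmap \<zeta> \<delta> = \<kappa>"
    using lift_from[OF dom.rng_in[OF \<epsilon>(1)] assms(2)] by blast
  have "\<eta> = cmp \<Omega> \<delta> \<epsilon>"
    by (rule inj_from) (use \<delta> \<epsilon> assms in \<open>simp_all add: dom.cmp_in dom.src_cmp\<close>)
  then show ?thesis using \<delta> \<epsilon> by blast
qed

lemma act_KP1:
  assumes "\<kappa> \<in> mors \<Lambda>" "\<mu> \<in> mors \<Lambda>" "v \<in> objs \<Omega>"
  shows "wact [Fwd \<kappa>, Fwd \<mu>] (vec v :: 'p \<Rightarrow>\<^sub>0 'a) =
    (if src \<Lambda> \<kappa> = rng \<Lambda> \<mu> then wact [Fwd (cmp \<Lambda> \<kappa> \<mu>)] (vec v) else 0)"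
proof (cases "src \<Lambda> \<mu> = omap \<zeta> v")
  case True
  then obtain \<epsilon> where \<epsilon>: "\<epsilon> \<in> mors \<Omega>" "src \<Omega> \<epsilon> = v" "mmap \<zeta> \<epsilon> = \<mu>"
    using lift_from[OF assms(3,2)] by blast
  then have 1: "gen_act (Fwd \<mu>) v = vec (rng \<Omega> \<epsilon>)" using act_Fwd[OF \<epsilon>(1)] by simp
  have r: "rng \<Lambda> \<mu> = omap \<zeta> (rng \<Omega> \<epsilon>)" using \<epsilon> hom_simps(5)[OF \<epsilon>(1)] by simp
  show ?thesis
  proof (cases "src \<Lambda> \<kappa> = rng \<Lambda> \<mu>")
    case c: True
    then obtain \<delta> where \<delta>: "\<delta> \<in> mors \<Omega>" "src \<Omega> \<delta> = rng \<Omega> \<epsilon>" "mmap \<zeta> \<delta> = \<kappa>"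
      using lift_from[OF dom.rng_in[OF \<epsilon>(1)] assms(1)] r by auto
    have 2: "gen_act (Fwd \<kappa>) (rng \<Omega> \<epsilon>) = vec (rng \<Omega> \<delta>)" using act_Fwd[OF \<delta>(1)] \<delta> by simp
    have "gen_act (Fwd (cmp \<Lambda> \<kappa> \<mu>)) v = vec (rng \<Omega> \<delta>)"
      using act_Fwd[of "cmp \<Omega> \<delta> \<epsilon>"] \<delta> \<epsilon> by (simp add: dom.cmp_in dom.src_cmp dom.rng_cmp)
    then show ?thesis using 1 2 c by simp
  next
    case False
    then have "gen_act (Fwd \<kappa>) (rng \<Omega> \<epsilon>) = (0 :: 'p \<Rightarrow>\<^sub>0 'a)" using act_Fwd_0[OF assms(1)] r by simp
    then show ?thesis using 1 False by simp
  qed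
next
  case False
  then show ?thesis
    using act_Fwd_0[OF assms(2) False] act_Fwd_0[of "cmp \<Lambda> \<kappa> \<mu>" v] assms
    by (simp add: cod.cmp_in cod.src_cmp)
qed

text \<open>Both sides are nonzero exactly when \<open>v\<close> is the range of a composable pair
  of lifts of \<kappa> and \<mu>; a lift of the composite splits into such a pair.\<close>

lemma act_KP2:
  assumes "\<kappa> \<in> mors \<Lambda>" "\<mu> \<in> mors \<Lambda>"
  shows "wact [ghost \<Lambda> \<mu>, ghost \<Lambda> \<kappa>] (vec v :: 'p \<Rightarrow>\<^sub>0 'a) =
    (if src \<Lambda> \<kappa> = rng \<Lambda> \<mu> then wact [ghost \<Lambda> (cmp \<Lambda> \<kappa> \<mu>)] (vec v) else 0)"
proof (cases "\<exists>\<delta> \<in> mors \<Omega>. \<exists>\<epsilon> \<in> mors \<Omega>. rng \<Omega> \<delta> = v \<and> src \<Omega> \<delta> = rng \<Omega> \<epsilon> \<and> mmap \<zeta> \<delta> = \<kappa> \<and> mmap \<zeta> \<epsilon> = \<mu>")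
  case True
  then obtain \<delta> \<epsilon> where *: "\<delta> \<in> mors \<Omega>" "\<epsilon> \<in> mors \<Omega>" "rng \<Omega> \<delta> = v" "src \<Omega> \<delta> = rng \<Omega> \<epsilon>"
      "mmap \<zeta> \<delta> = \<kappa>" "mmap \<zeta> \<epsilon> = \<mu>" by blast
  have 1: "src \<Lambda> \<kappa> = rng \<Lambda> \<mu>" using * hom_simps(4)[OF *(1)] hom_simps(5)[OF *(2)] by simp
  have 2: "gen_act (ghost \<Lambda> \<kappa>) v = vec (rng \<Omega> \<epsilon>)" using act_ghost[OF *(1)] * by simp
  have 3: "gen_act (ghost \<Lambda> \<mu>) (rng \<Omega> \<epsilon>) = vec (src \<Omega> \<epsilon>)" using act_ghost[OF *(2)] * by simp
  have 4: "gen_act (ghost \<Lambda> (cmp \<Lambda> \<kappa> \<mu>)) v = vec (src \<Omega> \<epsilon>)"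
    using act_ghost[of "cmp \<Omega> \<delta> \<epsilon>"] * by (simp add: dom.cmp_in dom.src_cmp dom.rng_cmp)
  show ?thesis using 1 2 3 4 by simp
next
  case no: False
  have 1: "gen_act (ghost \<Lambda> (cmp \<Lambda> \<kappa> \<mu>)) v = 0" if c: "src \<Lambda> \<kappa> = rng \<Lambda> \<mu>"
  proof (rule act_ghost_0)
    show "\<not> (\<exists>\<eta> \<in> mors \<Omega>. rng \<Omega> \<eta> = v \<and> mmap \<zeta> \<eta> = cmp \<Lambda> \<kappa> \<mu>)"
    proof
      assume "\<exists>\<eta> \<in> mors \<Omega>. rng \<Omega> \<eta> = v \<and> mmap \<zeta> \<eta> = cmp \<Lambda> \<kappa> \<mu>"
      then obtain \<eta> where \<eta>: "\<eta> \<in> mors \<Omega>" "rng \<Omega> \<eta> = v" "mmap \<zeta> \<eta> = cmp \<Lambda> \<kappa> \<mu>" by blast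
      then obtain \<delta> \<epsilon> where *: "\<delta> \<in> mors \<Omega>" "\<epsilon> \<in> mors \<Omega>" "\<eta> = cmp \<Omega> \<delta> \<epsilon>" "src \<Omega> \<delta> = rng \<Omega> \<epsilon>"
          "mmap \<zeta> \<delta> = \<kappa>" "mmap \<zeta> \<epsilon> = \<mu>"
        using lift_cmp[OF \<eta>(1) assms c \<eta>(3)] by blast
      then have "rng \<Omega> \<delta> = v" using \<eta>(2) dom.rng_cmp by simp
      then show False using no * by blast
    qed
  qed (use assms c in \<open>simp add: cod.cmp_in\<close>)
  have 2: "wact [ghost \<Lambda> \<mu>, ghost \<Lambda> \<kappa>] (vec v) = (0 :: 'p \<Rightarrow>\<^sub>0 'a)"
  proof (cases "\<exists>\<delta> \<in> mors \<Omega>. rng \<Omega> \<delta> = v \<and> mmap \<zeta> \<delta> = \<kappa>")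
    case True
    then obtain \<delta> where \<delta>: "\<delta> \<in> mors \<Omega>" "rng \<Omega> \<delta> = v" "mmap \<zeta> \<delta> = \<kappa>" by blast
    then have "\<not> (\<exists>\<epsilon> \<in> mors \<Omega>. rng \<Omega> \<epsilon> = src \<Omega> \<delta> \<and> mmap \<zeta> \<epsilon> = \<mu>)" using no by metis
    then have "gen_act (ghost \<Lambda> \<mu>) (src \<Omega> \<delta>) = (0 :: 'p \<Rightarrow>\<^sub>0 'a)" using act_ghost_0[OF assms(2)] by blast
    moreover have "gen_act (ghost \<Lambda> \<kappa>) v = (vec (src \<Omega> \<delta>) :: 'p \<Rightarrow>\<^sub>0 'a)"
      using act_ghost[OF \<delta>(1)] \<delta> by simp
    ultimately show ?thesis by simp
  next
    case False
    then show ?thesis using act_ghost_0[OF assms(1)] by simp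
  qed
  show ?thesis using 1 2 by simp
qed

text \<open>The range of a lift \<epsilon> of \<mu> is reached by a single morphism of that degree,
  namely \<epsilon>. So the star of \<kappa> kills it unless \<kappa> = \<mu>.\<close>

lemma act_KP3:
  assumes "\<kappa> \<in> mors \<Lambda>" "\<mu> \<in> mors \<Lambda>" "deg \<Lambda> \<kappa> = deg \<Lambda> \<mu>" "v \<in> objs \<Omega>"
  shows "wact [ghost \<Lambda> \<kappa>, Fwd \<mu>] (vec v :: 'p \<Rightarrow>\<^sub>0 'a) =
    (if \<kappa> = \<mu> then wact [Fwd (idm \<Lambda> (src \<Lambda> \<kappa>))] (vec v) else 0)"
proof (cases "src \<Lambda> \<mu> = omap \<zeta> v")
  case True
  then obtain \<epsilon> where \<epsilon>: "\<epsilon> \<in> mors \<Omega>" "src \<Omega> \<epsilon> = v" "mmap \<zeta> \<epsilon> = \<mu>"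
    using lift_from[OF assms(4,2)] by blast
  then have 1: "gen_act (Fwd \<mu>) v = vec (rng \<Omega> \<epsilon>)" using act_Fwd[OF \<epsilon>(1)] by simp
  show ?thesis
  proof (cases "\<kappa> = \<mu>")
    case eq: True
    have "gen_act (ghost \<Lambda> \<kappa>) (rng \<Omega> \<epsilon>) = vec v" using act_ghost[OF \<epsilon>(1)] \<epsilon> eq by simp
    moreover have "gen_act (Fwd (idm \<Lambda> (src \<Lambda> \<mu>))) v = vec v"
      using act_idm[OF cod.src_in[OF assms(2)] assms(4)] True by simp
    ultimately show ?thesis using 1 eq by simp
  next
    case False
    have "\<not> (\<exists>\<delta> \<in> mors \<Omega>. rng \<Omega> \<delta> = rng \<Omega> \<epsilon> \<and> mmap \<zeta> \<delta> = \<kappa>)"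
    proof
      assume "\<exists>\<delta> \<in> mors \<Omega>. rng \<Omega> \<delta> = rng \<Omega> \<epsilon> \<and> mmap \<zeta> \<delta> = \<kappa>"
      then obtain \<delta> where \<delta>: "\<delta> \<in> mors \<Omega>" "rng \<Omega> \<delta> = rng \<Omega> \<epsilon>" "mmap \<zeta> \<delta> = \<kappa>" by blast
      then have "deg \<Omega> \<delta> = deg \<Omega> \<epsilon>" using hom_simps(6)[OF \<delta>(1)] hom_simps(6)[OF \<epsilon>(1)] \<epsilon> assms(3) by simp
      then have "\<delta> = \<epsilon>" using \<delta> \<epsilon> by (intro unique_to) simp_all
      then show False using False \<delta> \<epsilon> by simp
    qed
    then have "gen_act (ghost \<Lambda> \<kappa>) (rng \<Omega> \<epsilon>) = (0 :: 'p \<Rightarrow>\<^sub>0 'a)" by (rule act_ghost_0[OF assms(1)])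
    then show ?thesis using 1 False by simp
  qed
next
  case False
  then have "gen_act (Fwd \<mu>) v = (0 :: 'p \<Rightarrow>\<^sub>0 'a)" by (rule act_Fwd_0[OF assms(2)])
  moreover have "gen_act (Fwd (idm \<Lambda> (src \<Lambda> \<mu>))) v = (0 :: 'p \<Rightarrow>\<^sub>0 'a)"
    using act_idm[OF cod.src_in[OF assms(2)] assms(4)] False by simp
  ultimately show ?thesis by simp
qed

text \<open>Exactly one morphism \<delta> of degree \<open>n\<close> ends at \<open>v\<close>, so at
  most the summand of its label survives. That label occurs in the sum exactly when \<open>v\<close>
  lies over \<open>a\<close>.\<close>

lemma act_KP4:
  assumes "a \<in> objs \<Lambda>" "v \<in> objs \<Omega>" "finite (mors_to_deg \<Lambda> a n)"
  shows "(\<Sum>\<kappa>\<in>mors_to_deg \<Lambda> a n. wact [Fwd \<kappa>, ghost \<Lambda> \<kappa>] (vec v :: 'p \<Rightarrow>\<^sub>0 'a)) =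
    wact [Fwd (idm \<Lambda> a)] (vec v)"
proof -
  obtain \<delta> where \<delta>: "\<delta> \<in> mors \<Omega>" "rng \<Omega> \<delta> = v" "deg \<Omega> \<delta> = n" using ex_to[OF assms(2)] by blast
  have summand: "wact [Fwd \<kappa>, ghost \<Lambda> \<kappa>] (vec v) = (if \<kappa> = mmap \<zeta> \<delta> then vec v else (0 :: 'p \<Rightarrow>\<^sub>0 'a))"
    if \<kappa>: "\<kappa> \<in> mors \<Lambda>" "deg \<Lambda> \<kappa> = n" for \<kappa>
  proof (cases "\<kappa> = mmap \<zeta> \<delta>")
    case True
    have 1: "gen_act (ghost \<Lambda> \<kappa>) v = (vec (src \<Omega> \<delta>) :: 'p \<Rightarrow>\<^sub>0 'a)"
      using act_ghost[OF \<delta>(1)] \<delta> True by simp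
    have 2: "gen_act (Fwd \<kappa>) (src \<Omega> \<delta>) = (vec v :: 'p \<Rightarrow>\<^sub>0 'a)"
      using act_Fwd[OF \<delta>(1)] \<delta> True by simp
    show ?thesis using True 1 2 by simp
  next
    case False
    have "\<not> (\<exists>\<epsilon> \<in> mors \<Omega>. rng \<Omega> \<epsilon> = v \<and> mmap \<zeta> \<epsilon> = \<kappa>)"
    proof
      assume "\<exists>\<epsilon> \<in> mors \<Omega>. rng \<Omega> \<epsilon> = v \<and> mmap \<zeta> \<epsilon> = \<kappa>"
      then obtain \<epsilon> where \<epsilon>: "\<epsilon> \<in> mors \<Omega>" "rng \<Omega> \<epsilon> = v" "mmap \<zeta> \<epsilon> = \<kappa>" by blast
      have "deg \<Omega> \<epsilon> = n" using hom_simps(6)[OF \<epsilon>(1)] \<epsilon>(3) \<kappa>(2) by simp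
      then have "\<epsilon> = \<delta>" using \<delta> \<epsilon> by (intro unique_to) simp_all
      then show False using False \<epsilon> by simp
    qed
    then have "gen_act (ghost \<Lambda> \<kappa>) v = (0 :: 'p \<Rightarrow>\<^sub>0 'a)" by (rule act_ghost_0[OF \<kappa>(1)])
    then show ?thesis using False by simp
  qed
  have "(\<Sum>\<kappa>\<in>mors_to_deg \<Lambda> a n. wact [Fwd \<kappa>, ghost \<Lambda> \<kappa>] (vec v)) =
      (\<Sum>\<kappa>\<in>mors_to_deg \<Lambda> a n. if \<kappa> = mmap \<zeta> \<delta> then vec v else (0 :: 'p \<Rightarrow>\<^sub>0 'a))"
    by (rule sum.cong[OF refl]) (rule summand; simp add: mors_to_deg_def mors_to_def)
  also have "\<dots> = (if mmap \<zeta> \<delta> \<in> mors_to_deg \<Lambda> a n then vec v else 0)"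
    using assms(3) by (rule sum.delta)
  also have "mmap \<zeta> \<delta> \<in> mors_to_deg \<Lambda> a n \<longleftrightarrow> omap \<zeta> v = a"
    using \<delta> by (simp add: mors_to_deg_def mors_to_def)
  finally show ?thesis using act_idm[OF assms(1,2)] by simp
qed

lemma relators_act_0:
  fixes x :: "'p \<Rightarrow>\<^sub>0 'a"
  assumes "standing_k_graph \<Lambda>" "r \<in> kp_relators \<Lambda>" "x \<in> free_space (objs \<Omega>)"
  shows "aact r x = 0"
proof -
  interpret std: standing_k_graph \<Lambda> by (rule assms(1))
  have *: "aact r (vec v) = (0 :: 'p \<Rightarrow>\<^sub>0 'a)" if v: "v \<in> objs \<Omega>" for v
    using assms(2)
  proof cases
    case (KP1 \<kappa> \<mu>)
    then show ?thesis
      using act_KP1[OF KP1(2,3) v] unfolding KP1(1) lin_diff[OF lin_free_act_left]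
      by (simp add: free_act_def del: word_act_simps)
  next
    case (KP2 \<kappa> \<mu>)
    then show ?thesis
      using act_KP2[OF KP2(2,3)] unfolding KP2(1) lin_diff[OF lin_free_act_left]
      by (simp add: free_act_def del: word_act_simps)
  next
    case (KP3 \<kappa> \<mu>)
    then show ?thesis
      using act_KP3[OF KP3(2-4) v] unfolding KP3(1) lin_diff[OF lin_free_act_left]
      by (simp add: free_act_def del: word_act_simps)
  next
    case (KP4 a n)
    then show ?thesis
      using act_KP4[OF KP4(2) v std.row_finite[OF KP4(2)]]
      unfolding KP4(1) lin_diff[OF lin_free_act_left] lin_sum[OF lin_free_act_left]
      by (simp del: word_act_simps)
  qed
  show ?thesis
  proof (rule lin_eqI[OF lin_free_act, of "\<lambda>_. 0"])
    show "lin (\<lambda>_ :: 'p \<Rightarrow>\<^sub>0 'a. 0 :: 'p \<Rightarrow>\<^sub>0 'a)" by (simp add: lin_def)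
    show "aact r (vec v) = 0" if "v \<in> Poly_Mapping.keys x" for v
      by (rule *) (use that assms(3) in \<open>auto simp: free_space_iff\<close>)
  qed
qed

text \<open>The vector is generalized in the induction because a right multiple of \<open>r\<close>
  acts on \<open>x\<close> as \<open>r\<close> acts on another vector.\<close>

lemma ideal_act_0:
  assumes "standing_k_graph \<Lambda>" "r \<in> kp_ideal \<Lambda>" "x \<in> free_space (objs \<Omega>)"
  shows "aact r x = 0"
  using assms(2,3)
proof (induction arbitrary: x rule: kp_ideal.induct)
  case (1 r)
  then show ?case using relators_act_0[OF assms(1)] by blast
next
  case 2
  then show ?case by (simp add: free_act_def)
next
  case (3 r s)
  then show ?case by (simp add: lin_add[OF lin_free_act_left])
next
  case (4 r c)
  then show ?case by (simp add: lin_scl[OF lin_free_act_left])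
next
  case (5 r a)
  then show ?case by (simp add: free_act_convolution lin_0[OF lin_free_act])
next
  case (6 r a)
  then show ?case by (simp add: free_act_convolution free_act_free)
qed

lemma act_kp_class:
  assumes "standing_k_graph \<Lambda>" "a \<in> kp_free \<Lambda>" "x \<in> free_space (objs \<Omega>)"
  shows "act (rep_module rg) (kp_class \<Lambda> a) x = aact a x"
proof -
  have "a \<in> kp_class \<Lambda> a" using assms(2) by (simp add: kp_class_def kp_ideal.intros(2))
  then have "(SOME b. b \<in> kp_class \<Lambda> a) \<in> kp_class \<Lambda> a" by (rule someI)
  then have "(SOME b. b \<in> kp_class \<Lambda> a) - a \<in> kp_ideal \<Lambda>" by (simp add: kp_class_def)
  then have "aact ((SOME b. b \<in> kp_class \<Lambda> a) - a) x = 0"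
    using ideal_act_0[OF assms(1) _ assms(3)] by blast
  then show ?thesis by (simp add: rep_module_def lin_diff[OF lin_free_act_left])
qed

end

section \<open>Endomorphisms and the group algebra\<close>

text \<open>
  The vertices over \<open>y\<close> form a group through the deck transformations \<open>\<phi> w\<close>, and \<open>end_map e\<close> is the
  endomorphism given by the element \<open>e\<close> of the algebra of this group.
\<close>

locale simply_connected_rep = rep_graph_over \<Omega> \<Lambda> \<zeta> K
  for \<Omega> :: "('p, 'q, 'k::finite) kgraph" and \<Lambda> :: "('o, 'm, 'k) kgraph"
    and \<zeta> :: "('p, 'q, 'o, 'm) kmor" and K :: "'a::field itself" +
  fixes v0 :: 'p
  assumes standing: "standing_k_graph \<Lambda>"
    and ex_walk: "u \<in> objs \<Omega> \<Longrightarrow> v \<in> objs \<Omega> \<Longrightarrow> \<exists>p \<in> walks \<Omega>. wsrc \<Omega> p = u \<and> wrng \<Omega> p = v"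
    and simply_connected: "p \<in> walks \<Omega> \<Longrightarrow> q \<in> walks \<Omega> \<Longrightarrow> wsrc \<Omega> p = wsrc \<Omega> q \<Longrightarrow>
      wrng \<Omega> p = wrng \<Omega> q \<Longrightarrow>
      (p @ [Fwd (idm \<Omega> (wsrc \<Omega> p))], q @ [Fwd (idm \<Omega> (wsrc \<Omega> p))]) \<in> walk_equiv \<Omega>"
    and v0_in [simp]: "v0 \<in> objs \<Omega>"
begin

abbreviation "\<pi> \<equiv> omap qmap"

definition y :: "'p set" where "y = \<pi> v0"

definition fib :: "'p set" where "fib = {v \<in> objs \<Omega>. \<pi> v = y}"

lemma fib_iff: "v \<in> fib \<longleftrightarrow> v \<in> objs \<Omega> \<and> \<pi> v = y"
  by (simp add: fib_def)

lemma v0_fib [simp]: "v0 \<in> fib"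
  by (simp add: fib_iff y_def)

lemma y_in [simp]: "y \<in> objs \<Gamma>"
  unfolding y_def by simp

section \<open>Transport between fibres along walks of the quotient\<close>

definition tr :: "'q set edge list \<Rightarrow> 'p \<Rightarrow> 'p" where
  "tr P v = wrng \<Omega> (THE p. p \<in> walks \<Omega> \<and> wsrc \<Omega> p = v \<and> walk_map qmap p = P)"

lemma tr_walk:
  assumes "p \<in> walks \<Omega>" shows "tr (walk_map qmap p) (wsrc \<Omega> p) = wrng \<Omega> p"
proof -
  have "(THE q. q \<in> walks \<Omega> \<and> wsrc \<Omega> q = wsrc \<Omega> p \<and> walk_map qmap q = walk_map qmap p) = p"
    using assms quot.walk_unique by (intro the_equality) simp_all
  then show ?thesis by (simp add: tr_def)
qed

lemma tr_lift:
  assumes "P \<in> walks \<Gamma>" "v \<in> objs \<Omega>" "wsrc \<Gamma> P = \<pi> v"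
  obtains p where "p \<in> walks \<Omega>" "wsrc \<Omega> p = v" "walk_map qmap p = P" "wrng \<Omega> p = tr P v"
  using quot.walk_lift[OF assms] tr_walk by auto

lemma tr_in:
  assumes "P \<in> walks \<Gamma>" "v \<in> objs \<Omega>" "wsrc \<Gamma> P = \<pi> v"
  shows "tr P v \<in> objs \<Omega>" "\<pi> (tr P v) = wrng \<Gamma> P"
proof -
  obtain p where p: "p \<in> walks \<Omega>" "wsrc \<Omega> p = v" "walk_map qmap p = P" "wrng \<Omega> p = tr P v"
    using tr_lift[OF assms] .
  show "tr P v \<in> objs \<Omega>" using dom.wrng_in[OF p(1)] p by simp
  show "\<pi> (tr P v) = wrng \<Gamma> P" using quot.walk_map_in[OF p(1)] p by simp
qed

lemma tr_append:
  assumes "P \<in> walks \<Gamma>" "Q \<in> walks \<Gamma>" "wsrc \<Gamma> P = wrng \<Gamma> Q" "v \<in> objs \<Omega>" "wsrc \<Gamma> Q = \<pi> v"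
  shows "tr (P @ Q) v = tr P (tr Q v)"
proof -
  obtain q where q: "q \<in> walks \<Omega>" "wsrc \<Omega> q = v" "walk_map qmap q = Q" "wrng \<Omega> q = tr Q v"
    using tr_lift[OF assms(2,4,5)] .
  obtain p where p: "p \<in> walks \<Omega>" "wsrc \<Omega> p = tr Q v" "walk_map qmap p = P" "wrng \<Omega> p = tr P (tr Q v)"
    using tr_lift[of P "tr Q v"] assms tr_in[OF assms(2,4,5)] by metis
  have "p @ q \<in> walks \<Omega>" using p q by (simp add: walks_append walks_not_Nil)
  then show ?thesis
    using tr_walk[of "p @ q"] p q walks_not_Nil[OF p(1)] walks_not_Nil[OF q(1)] by simp
qed

text \<open>An equivalence in \<Gamma> lifts to one in \<Omega> starting at the same lift, and
  equivalent walks have the same end.\<close>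

lemma tr_equiv:
  assumes "(P, Q) \<in> walk_equiv \<Gamma>" "v \<in> objs \<Omega>" "wsrc \<Gamma> P = \<pi> v"
  shows "tr P v = tr Q v"
proof -
  have P: "P \<in> walks \<Gamma>" using quot.cod.walk_equiv_walks assms(1) by blast
  obtain p where p: "p \<in> walks \<Omega>" "wsrc \<Omega> p = v" "walk_map qmap p = P" "wrng \<Omega> p = tr P v"
    using tr_lift[OF P assms(2,3)] .
  obtain q where q: "(p, q) \<in> walk_equiv \<Omega>" "walk_map qmap q = Q"
    using quot.walk_equiv_lift[OF assms(1) p(1,3)] by blast
  have "wsrc \<Omega> q = v" "wrng \<Omega> q = wrng \<Omega> p" "q \<in> walks \<Omega>"
    using dom.walk_equiv_walks[OF q(1)] dom.walk_equiv_ends[OF q(1)] p(2) by simp_all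
  then have "tr Q v = wrng \<Omega> p" using tr_walk[of q] q(2) by simp
  with p(4) show ?thesis by simp
qed

abbreviation "one_walk \<equiv> [Fwd (idm \<Gamma> y)]"

lemma one_walk: "one_walk \<in> walks \<Gamma>" "wsrc \<Gamma> one_walk = y" "wrng \<Gamma> one_walk = y"
  by (simp_all add: quot.cod.src_idm quot.cod.rng_idm)

lemma tr_one:
  assumes "w \<in> fib" shows "tr one_walk w = w"
proof -
  have w: "w \<in> objs \<Omega>" "\<pi> w = y" using assms by (simp_all add: fib_iff)
  show ?thesis
    using tr_walk[OF dom.idm_walk[OF w(1)]] w by (simp add: dom.src_idm dom.rng_idm)
qed

text \<open>The lifts from \<open>v0\<close> have common ends, so simple connectedness of \<Omega>
  makes them equivalent up to an appended identity; project this to \<Gamma>.\<close>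

lemma tr_eq_imp_equiv:
  assumes "P \<in> walks \<Gamma>" "Q \<in> walks \<Gamma>" "wsrc \<Gamma> P = y" "wsrc \<Gamma> Q = y" "tr P v0 = tr Q v0"
  shows "(P @ one_walk, Q @ one_walk) \<in> walk_equiv \<Gamma>"
proof -
  obtain p where p: "p \<in> walks \<Omega>" "wsrc \<Omega> p = v0" "walk_map qmap p = P" "wrng \<Omega> p = tr P v0"
    using tr_lift[of P v0] assms y_def by auto
  obtain q where q: "q \<in> walks \<Omega>" "wsrc \<Omega> q = v0" "walk_map qmap q = Q" "wrng \<Omega> q = tr Q v0"
    using tr_lift[of Q v0] assms y_def by auto
  have "(p @ [Fwd (idm \<Omega> v0)], q @ [Fwd (idm \<Omega> v0)]) \<in> walk_equiv \<Omega>"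
    using simply_connected[OF p(1) q(1)] p q assms(5) by simp
  from quot.walk_map_equiv[OF this] show ?thesis using p q by (simp add: y_def)
qed

text \<open>What happens at \<open>v0\<close> decides the whole fibre: it yields an equivalence in
  \<Gamma>, which can be lifted at any vertex over \<open>y\<close>. The appended identity does not
  move the fibre.\<close>

lemma tr_determined:
  assumes "P \<in> walks \<Gamma>" "Q \<in> walks \<Gamma>" "wsrc \<Gamma> P = y" "wsrc \<Gamma> Q = y" "tr P v0 = tr Q v0" "w \<in> fib"
  shows "tr P w = tr Q w"
proof -
  have w: "w \<in> objs \<Omega>" "\<pi> w = y" using assms(6) by (simp_all add: fib_iff)
  have *: "tr (R @ one_walk) w = tr R w" if "R \<in> walks \<Gamma>" "wsrc \<Gamma> R = y" for R
    using tr_append[OF that(1) one_walk(1) _ w(1)] that(2) w(2) one_walk tr_one[OF assms(6)] by simp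
  have "tr (P @ one_walk) w = tr (Q @ one_walk) w"
    using tr_equiv[OF tr_eq_imp_equiv[OF assms(1-5)] w(1)] w(2) one_walk(2) by simp
  then show ?thesis using * assms by simp
qed

lemma ex_tr:
  assumes "u \<in> objs \<Omega>"
  shows "\<exists>P. P \<in> walks \<Gamma> \<and> wsrc \<Gamma> P = y \<and> tr P v0 = u"
proof -
  obtain p where p: "p \<in> walks \<Omega>" "wsrc \<Omega> p = v0" "wrng \<Omega> p = u" using ex_walk assms v0_in by blast
  then show ?thesis
    using quot.walk_map_in[OF p(1)] tr_walk[OF p(1)] by (intro exI[of _ "walk_map qmap p"]) (simp add: y_def)
qed

text \<open>For \<open>w\<close> over \<open>y\<close>, \<open>\<phi> w\<close> is the deck
  transformation taking \<open>v0\<close> to \<open>w\<close>: a walk from \<open>v0\<close> to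
  \<open>u\<close> is projected to \<Gamma> and followed from \<open>w\<close> instead.\<close>

definition \<phi> :: "'p \<Rightarrow> 'p \<Rightarrow> 'p" where
  "\<phi> w u = tr (SOME P. P \<in> walks \<Gamma> \<and> wsrc \<Gamma> P = y \<and> tr P v0 = u) w"

lemma phi_tr:
  assumes "P \<in> walks \<Gamma>" "wsrc \<Gamma> P = y" "w \<in> fib"
  shows "\<phi> w (tr P v0) = tr P w"
proof -
  let ?Q = "SOME Q. Q \<in> walks \<Gamma> \<and> wsrc \<Gamma> Q = y \<and> tr Q v0 = tr P v0"
  have Q: "?Q \<in> walks \<Gamma> \<and> wsrc \<Gamma> ?Q = y \<and> tr ?Q v0 = tr P v0"
    by (rule someI[of _ P]) (use assms in simp)
  show ?thesis unfolding \<phi>_def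
    by (rule tr_determined[OF _ assms(1) _ assms(2) _ assms(3)]) (use Q in blast)+
qed

lemma phi_in:
  assumes "w \<in> fib" "u \<in> objs \<Omega>" shows "\<phi> w u \<in> objs \<Omega>" "\<pi> (\<phi> w u) = \<pi> u"
proof -
  obtain P where P: "P \<in> walks \<Gamma>" "wsrc \<Gamma> P = y" "tr P v0 = u" using ex_tr[OF assms(2)] by blast
  have w: "w \<in> objs \<Omega>" "wsrc \<Gamma> P = \<pi> w" using assms(1) P(2) by (simp_all add: fib_iff)
  have *: "\<phi> w u = tr P w" using phi_tr[OF P(1,2) assms(1)] P(3) by simp
  show "\<phi> w u \<in> objs \<Omega>" using tr_in(1)[OF P(1) w] * by simp
  have "\<pi> u = wrng \<Gamma> P" using tr_in(2)[OF P(1) v0_in] P by (simp add: y_def)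
  then show "\<pi> (\<phi> w u) = \<pi> u" using tr_in(2)[OF P(1) w] * by simp
qed

lemma phi_v0: "w \<in> fib \<Longrightarrow> \<phi> w v0 = w"
  using phi_tr[OF one_walk(1,2)] tr_one by simp

lemma phi_by_v0: "u \<in> objs \<Omega> \<Longrightarrow> \<phi> v0 u = u"
  using ex_tr[of u] phi_tr[of _ v0] by auto

text \<open>If \<open>P\<close> leads from \<open>v0\<close> to \<open>u\<close>, then
  \<open>Q @ P\<close> leads to the transport of \<open>u\<close> along \<open>Q\<close>, and it may
  be used to compute \<phi> there.\<close>

lemma phi_equivariant:
  assumes "w \<in> fib" "u \<in> objs \<Omega>" "Q \<in> walks \<Gamma>" "wsrc \<Gamma> Q = \<pi> u"
  shows "\<phi> w (tr Q u) = tr Q (\<phi> w u)"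
proof -
  obtain P where P: "P \<in> walks \<Gamma>" "wsrc \<Gamma> P = y" "tr P v0 = u" using ex_tr[OF assms(2)] by blast
  have w: "w \<in> objs \<Omega>" "wsrc \<Gamma> P = \<pi> w" using assms(1) P(2) by (simp_all add: fib_iff)
  have c: "wsrc \<Gamma> Q = wrng \<Gamma> P" using tr_in(2)[OF P(1) v0_in] P assms(4) by (simp add: y_def)
  have "Q @ P \<in> walks \<Gamma>" "wsrc \<Gamma> (Q @ P) = y"
    using assms(3) P c by (simp_all add: walks_append walks_not_Nil)
  then have "\<phi> w (tr (Q @ P) v0) = tr (Q @ P) w" using assms(1) by (rule phi_tr)
  moreover have "tr (Q @ P) v0 = tr Q u" using tr_append[OF assms(3) P(1) c v0_in] P by (simp add: y_def)
  moreover have "tr (Q @ P) w = tr Q (\<phi> w u)"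
    using tr_append[OF assms(3) P(1) c w] phi_tr[OF P(1,2) assms(1)] P(3) by simp
  ultimately show ?thesis by simp
qed

text \<open>The map \<zeta> factors through the quotient, so lifts of one walk of \<Gamma> carry the
  same word as label.\<close>

lemma walk_map_qmap_eq:
  assumes "p \<in> walks \<Omega>" "q \<in> walks \<Omega>" "walk_map qmap p = walk_map qmap q"
  shows "walk_map \<zeta> p = walk_map \<zeta> q"
proof -
  have e: "map_edge (mmap \<zeta>) e = map_edge (mmap \<zeta>) f"
    if "e \<in> edges \<Omega>" "f \<in> edges \<Omega>" "map_edge (mmap qmap) e = map_edge (mmap qmap) f" for e f
    using that by (cases e; cases f) (auto simp: dom.Bwd_in_edges qmap_mmap_eq msim_iff)
  have "set p \<subseteq> edges \<Omega>" "set q \<subseteq> edges \<Omega>" using assms(1,2) by (auto simp: walks_def)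
  with assms(3) show ?thesis
  proof (induction p arbitrary: q)
    case (Cons a p)
    then obtain b q' where "q = b # q'" by (cases q) auto
    then show ?case using Cons.prems Cons.IH[of q'] e[of a b] by simp
  qed (simp add: walk_map_def)
qed

section \<open>Endomorphisms of the module given by fibre elements\<close>

definition end_map :: "('p \<Rightarrow>\<^sub>0 'a) \<Rightarrow> ('p \<Rightarrow>\<^sub>0 'a) \<Rightarrow> ('p \<Rightarrow>\<^sub>0 'a)" where
  "end_map e x = lin_extend (\<lambda>u. lin_extend (\<lambda>w. vec (\<phi> w u)) e) x"

lemma lin_end_map: "lin (end_map e)"
  using lin_lin_extend[of "\<lambda>u. lin_extend (\<lambda>w. vec (\<phi> w u)) e"] by (simp add: lin_def end_map_def)

lemma lin_end_map_left: "lin (\<lambda>e. end_map e x)"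
  unfolding end_map_def by (rule lin_extend_lin) (rule lin_lin_extend)

lemma end_map_vec [simp]: "end_map (vec w) (vec u) = vec (\<phi> w u)"
  by (simp add: end_map_def)

lemma end_map_free:
  assumes "e \<in> free_space fib" "x \<in> free_space (objs \<Omega>)"
  shows "end_map e x \<in> free_space (objs \<Omega>)"
  unfolding end_map_def
  by (rule free_space_lin_extend[OF assms(2)], rule free_space_lin_extend[OF assms(1)]) (simp add: phi_in)

lemma end_map_v0: "e \<in> free_space fib \<Longrightarrow> end_map e (vec v0) = e"
  by (rule lin_eqI_free[OF lin_end_map_left lin_id], assumption) (simp only: end_map_vec phi_v0)

lemma end_map_by_v0: "x \<in> free_space (objs \<Omega>) \<Longrightarrow> end_map (vec v0) x = x"
  by (rule lin_eqI_free[OF lin_end_map lin_id], assumption) (simp only: end_map_vec phi_by_v0)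

text \<open>A deck transformation moves \<open>u\<close> within its ~-class, so a word has a lift at
  both vertices or at neither. In the first case the lifts correspond by equivariance, in the second
  both sides vanish.\<close>

lemma wact_phi:
  assumes "w \<in> fib" "u \<in> objs \<Omega>" "set ws \<subseteq> edges \<Lambda>"
  shows "wact ws (vec (\<phi> w u)) = end_map (vec w) (wact ws (vec u))"
proof (cases "ws = []")
  case False
  have "(\<phi> w u, u) \<in> vsim" using phi_in[OF assms(1,2)] assms(2) qmap_omap_eq by simp
  then have s: "(u, \<phi> w u) \<in> vsim" by (rule vsim_sym)
  show ?thesis
  proof (cases "\<exists>p \<in> walks \<Omega>. wsrc \<Omega> p = u \<and> walk_map \<zeta> p = ws")
    case True
    then obtain p where p: "p \<in> walks \<Omega>" "wsrc \<Omega> p = u" "walk_map \<zeta> p = ws" by blast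
    have P: "walk_map qmap p \<in> walks \<Gamma>" "wsrc \<Gamma> (walk_map qmap p) = \<pi> u"
      using quot.walk_map_in[OF p(1)] p by simp_all
    have t: "tr (walk_map qmap p) u = wrng \<Omega> p" using tr_walk[OF p(1)] p by simp
    obtain q where q: "q \<in> walks \<Omega>" "wsrc \<Omega> q = \<phi> w u" "walk_map qmap q = walk_map qmap p"
        "wrng \<Omega> q = tr (walk_map qmap p) (\<phi> w u)"
      using tr_lift[OF P(1)] phi_in[OF assms(1,2)] P(2) by metis
    have "walk_map \<zeta> q = ws" using walk_map_qmap_eq[OF q(1) p(1) q(3)] p by simp
    then have "wact ws (vec (\<phi> w u)) = vec (tr (walk_map qmap p) (\<phi> w u))"
      using word_act_walk[OF q(1)] q by simp
    also have "\<dots> = vec (\<phi> w (wrng \<Omega> p))" using phi_equivariant[OF assms(1,2) P] t by simp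
    finally show ?thesis using word_act_walk[OF p(1)] p by simp
  next
    case no: False
    have no': "\<not> (\<exists>p \<in> walks \<Omega>. wsrc \<Omega> p = \<phi> w u \<and> walk_map \<zeta> p = ws)"
    proof
      assume "\<exists>p \<in> walks \<Omega>. wsrc \<Omega> p = \<phi> w u \<and> walk_map \<zeta> p = ws"
      then obtain p where p: "p \<in> walks \<Omega>" "wsrc \<Omega> p = \<phi> w u" "walk_map \<zeta> p = ws" by blast
      then show False using vsim_walk[OF vsim_sym[OF s] p(1,2)] no by auto
    qed
    show ?thesis
      using word_act_0[OF False assms(3) no] word_act_0[OF False assms(3) no'] lin_0[OF lin_end_map] by simp
  qed
qed simp

lemma wact_end_map:
  assumes "e \<in> free_space fib" "x \<in> free_space (objs \<Omega>)" "set ws \<subseteq> edges \<Lambda>"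
  shows "wact ws (end_map e x) = end_map e (wact ws x)"
proof (rule lin_eqI_free[OF _ _ assms(2)])
  show "lin (\<lambda>x. wact ws (end_map e x))" by (rule lin_comp[OF lin_word_act lin_end_map])
  show "lin (\<lambda>x. end_map e (wact ws x))" by (rule lin_comp[OF lin_end_map lin_word_act])
  fix u assume u: "u \<in> objs \<Omega>"
  show "wact ws (end_map e (vec u)) = end_map e (wact ws (vec u))"
  proof (rule lin_eqI_free[OF _ _ assms(1)])
    show "lin (\<lambda>e. wact ws (end_map e (vec u)))" by (rule lin_comp[OF lin_word_act lin_end_map_left])
    show "lin (\<lambda>e. end_map e (wact ws (vec u)))" by (rule lin_end_map_left)
  qed (simp add: wact_phi u assms(3))
qed

lemma aact_end_map:
  assumes "e \<in> free_space fib" "x \<in> free_space (objs \<Omega>)" "r \<in> kp_free \<Lambda>"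
  shows "aact r (end_map e x) = end_map e (aact r x)"
proof (rule lin_eqI[where x = r])
  show "lin (\<lambda>r. aact r (end_map e x))" by (rule lin_free_act_left)
  show "lin (\<lambda>r. end_map e (aact r x))" by (rule lin_comp[OF lin_end_map lin_free_act_left])
  fix ws assume "ws \<in> Poly_Mapping.keys r"
  then have "set ws \<subseteq> edges \<Lambda>" using assms(3) by (auto simp: kp_free_def free_space_iff cod.kp_generators_eq)
  then show "aact (word ws) (end_map e x) = end_map e (aact (word ws) x)"
    using wact_end_map[OF assms(1,2)] by simp
qed

text \<open>The module is cyclic: \<open>v0\<close> generates it, and a single word suffices for
  each vertex.\<close>

lemma vec_eq_wact:
  assumes "u \<in> objs \<Omega>"
  obtains p where "p \<in> walks \<Omega>" "wsrc \<Omega> p = v0" "vec u = wact (walk_map \<zeta> p) (vec v0)"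
    "set (walk_map \<zeta> p) \<subseteq> edges \<Lambda>" "walk_map \<zeta> p \<noteq> []"
proof -
  obtain p where p: "p \<in> walks \<Omega>" "wsrc \<Omega> p = v0" "wrng \<Omega> p = u" using ex_walk[OF v0_in assms] by blast
  show thesis
    by (rule that[OF p(1,2)])
      (use word_act_walk[OF p(1)] p walk_map_in[OF p(1)] walks_not_Nil[OF p(1)] in \<open>auto simp: walks_def\<close>)
qed

text \<open>Since \<open>end_map e\<close> commutes with words and \<open>v0\<close> generates,
  idempotency is a condition at \<open>v0\<close> alone; as \<open>v0\<close> is sent to
  \<open>e\<close>, the condition is the second hypothesis.\<close>

lemma end_map_idempotent:
  assumes "e \<in> free_space fib" "end_map e e = e" "x \<in> free_space (objs \<Omega>)"
  shows "end_map e (end_map e x) = end_map e x"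
proof (rule lin_eqI_free[OF _ lin_end_map assms(3)])
  show "lin (\<lambda>x. end_map e (end_map e x))" by (rule lin_comp[OF lin_end_map lin_end_map])
  fix u assume "u \<in> objs \<Omega>"
  then obtain p where p: "vec u = wact (walk_map \<zeta> p) (vec v0)" "set (walk_map \<zeta> p) \<subseteq> edges \<Lambda>"
    using vec_eq_wact by metis
  have e: "e \<in> free_space (objs \<Omega>)" using assms(1) by (auto simp: free_space_iff fib_iff)
  have "end_map e (vec u) = wact (walk_map \<zeta> p) e"
    unfolding p(1) using wact_end_map[OF assms(1) _ p(2), of "vec v0"] end_map_v0[OF assms(1)] by simp
  moreover have "end_map e (wact (walk_map \<zeta> p) e) = wact (walk_map \<zeta> p) e"
    using wact_end_map[OF assms(1) e p(2)] assms(2) by simp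
  ultimately show "end_map e (end_map e (vec u)) = end_map e (vec u)" by simp
qed

subsection \<open>Decompositions of the module\<close>

abbreviation "V \<equiv> (rep_module rg :: (('m edge list \<Rightarrow>\<^sub>0 'a) set, 'p \<Rightarrow>\<^sub>0 'a) left_module)"
abbreviation "A \<equiv> (KP \<Lambda> :: ('a, ('m edge list \<Rightarrow>\<^sub>0 'a) set) k_algebra)"

lemma carrier_V: "carrier V = free_space (objs \<Omega>)"
  by (simp add: rep_module_def)

lemma submodule_iff:
  "submodule_of A V U \<longleftrightarrow> U \<subseteq> free_space (objs \<Omega>) \<and> 0 \<in> U \<and> (\<forall>x \<in> U. \<forall>z \<in> U. x + z \<in> U) \<and>
     (\<forall>c. \<forall>x \<in> U. scl c x \<in> U) \<and> (\<forall>r \<in> kp_free \<Lambda>. \<forall>x \<in> U. aact r x \<in> U)"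
proof -
  have "(\<forall>a \<in> carrier A. \<forall>x \<in> U. act V a x \<in> U) \<longleftrightarrow> (\<forall>r \<in> kp_free \<Lambda>. \<forall>x \<in> U. aact r x \<in> U)"
    if "U \<subseteq> free_space (objs \<Omega>)"
    using that act_kp_class[OF standing] by (auto simp: KP_def subset_iff)
  then show ?thesis unfolding submodule_of_def carrier_V by blast
qed

lemma submoduleD:
  assumes "submodule_of A V U"
  shows "x \<in> U \<Longrightarrow> x \<in> free_space (objs \<Omega>)" "0 \<in> U" "x \<in> U \<Longrightarrow> z \<in> U \<Longrightarrow> x + z \<in> U"
    "x \<in> U \<Longrightarrow> scl c x \<in> U" "x \<in> U \<Longrightarrow> r \<in> kp_free \<Lambda> \<Longrightarrow> aact r x \<in> U"
  using assms[unfolded submodule_iff] by blast+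

lemma submodule_wact:
  assumes "submodule_of A V U" "ws \<noteq> []" "set ws \<subseteq> edges \<Lambda>" "x \<in> U"
  shows "wact ws x \<in> U"
proof -
  have "word ws \<in> (kp_free \<Lambda> :: ('m edge list \<Rightarrow>\<^sub>0 'a) set)"
    using assms(2,3) by (simp add: kp_free_def cod.kp_generators_eq)
  with assms(1,4) have "aact (word ws) x \<in> U" by (rule submoduleD(5))
  then show ?thesis by simp
qed

lemma submodule_diff:
  assumes "submodule_of A V U" "x \<in> U" "z \<in> U" shows "x - z \<in> U"
proof -
  have "x + scl (-1) z \<in> U" by (intro submoduleD(3,4)[OF assms(1)] assms)
  moreover have "x + scl (-1) z = x - z" by (rule poly_mapping_eqI) (simp add: lookup_add lookup_minus)
  ultimately show ?thesis by simp
qed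

lemma submodule_lin_extend:
  assumes "submodule_of A V U" "x \<in> free_space B" "\<And>b. b \<in> B \<Longrightarrow> f (Poly_Mapping.single b 1) \<in> U"
    and "lin f"
  shows "f x \<in> U"
proof -
  have "f x = lin_extend (\<lambda>b. f (Poly_Mapping.single b 1)) x"
    by (rule lin_eqI[OF assms(4) lin_lin_extend]) simp
  moreover have "(\<Sum>b\<in>S. scl (c b) (f (Poly_Mapping.single b 1))) \<in> U" if "S \<subseteq> B" for S and c :: "'b \<Rightarrow> 'a"
    using that
  proof (induction S rule: infinite_finite_induct)
    case (insert b S)
    then show ?case using assms(3) submoduleD[OF assms(1)] by simp
  qed (simp_all add: submoduleD(2)[OF assms(1)])
  ultimately show ?thesis using assms(2) by (simp add: lin_extend_def free_space_iff)
qed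

lemma wact_winv:
  assumes "ws \<noteq> []" "set ws \<subseteq> edges \<Lambda>"
  shows "wact (winv \<Lambda> ws @ ws) (vec u) =
    (if \<exists>p \<in> walks \<Omega>. wsrc \<Omega> p = u \<and> walk_map \<zeta> p = ws then vec u else 0)"
proof (cases "\<exists>p \<in> walks \<Omega>. wsrc \<Omega> p = u \<and> walk_map \<zeta> p = ws")
  case True
  then obtain p where p: "p \<in> walks \<Omega>" "wsrc \<Omega> p = u" "walk_map \<zeta> p = ws" by blast
  have 1: "wact ws (vec u) = vec (wrng \<Omega> p)" using word_act_walk[OF p(1)] p by simp
  have i: "winv \<Omega> p \<in> walks \<Omega>" "wsrc \<Omega> (winv \<Omega> p) = wrng \<Omega> p" "wrng \<Omega> (winv \<Omega> p) = u"
    using dom.winv_in[OF p(1)] p by simp_all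
  have "walk_map \<zeta> (winv \<Omega> p) = winv \<Lambda> ws" using walk_map_winv[of p] p by (simp add: walks_def)
  then have 2: "wact (winv \<Lambda> ws) (vec (wrng \<Omega> p)) = vec u" using word_act_walk[OF i(1)] i by simp
  show ?thesis using True 1 2 by (simp add: word_act_append)
next
  case False
  show ?thesis unfolding if_not_P[OF False]
    using word_act_0[OF assms False] lin_0[OF lin_word_act] by (simp add: word_act_append)
qed

lemma wact_winv_lookup:
  assumes "ws \<noteq> []" "set ws \<subseteq> edges \<Lambda>"
  shows "Poly_Mapping.lookup (wact (winv \<Lambda> ws @ ws) x) u =
    (if \<exists>p \<in> walks \<Omega>. wsrc \<Omega> p = u \<and> walk_map \<zeta> p = ws then Poly_Mapping.lookup x u else 0)"
proof -
  let ?D = "{u. \<exists>p \<in> walks \<Omega>. wsrc \<Omega> p = u \<and> walk_map \<zeta> p = ws}"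
  have "wact (winv \<Lambda> ws @ ws) x = lin_extend (\<lambda>u. if u \<in> ?D then vec u else 0) x"
    by (rule lin_eqI[OF lin_word_act lin_lin_extend]) (simp add: wact_winv[OF assms])
  then show ?thesis using lookup_lin_extend_restrict[of ?D x u] by simp
qed

lemma edges_winv: "set ws \<subseteq> edges \<Lambda> \<Longrightarrow> set (winv \<Lambda> ws) \<subseteq> edges \<Lambda>"
  by (induction ws) auto

text \<open>The operator of \<open>winv \<Lambda> ws @ ws\<close> preserves both submodules and
  either fixes or kills \<open>v0\<close>. As the sum is direct it does the same to the component
  \<open>a\<close>, and being a coordinate projection, to each vertex in the support of
  \<open>a\<close>. Such a vertex therefore admits the same words as \<open>v0\<close>.\<close>

lemma summand_keys:
  assumes U: "submodule_of A V U" and W: "submodule_of A V W" and UW: "U \<inter> W = {0}"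
    and ab: "a \<in> U" "b \<in> W" "vec v0 = a + b"
  shows "a \<in> free_space fib"
proof -
  have same: "(\<exists>p \<in> walks \<Omega>. wsrc \<Omega> p = u \<and> walk_map \<zeta> p = ws) \<longleftrightarrow>
      (\<exists>p \<in> walks \<Omega>. wsrc \<Omega> p = v0 \<and> walk_map \<zeta> p = ws)" (is "?L u \<longleftrightarrow> ?L v0")
    if u: "u \<in> Poly_Mapping.keys a" and ws: "ws \<noteq> []" "set ws \<subseteq> edges \<Lambda>" for u ws
  proof -
    let ?T = "wact (winv \<Lambda> ws @ ws)"
    have T: "?T a \<in> U" "?T b \<in> W"
      using submodule_wact[OF U] submodule_wact[OF W] ws edges_winv[OF ws(2)] ab by simp_all
    have sum: "?T (vec v0) = ?T a + ?T b" unfolding ab(3) by (rule lin_add[OF lin_word_act])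
    have k: "Poly_Mapping.lookup a u \<noteq> 0" using u by (simp add: in_keys_iff)
    show ?thesis
    proof (cases "?L v0")
      case True
      have "?T (vec v0) = vec v0" by (rule trans[OF wact_winv[OF ws] if_P[OF True]])
      then have "a + b = ?T a + ?T b" using sum ab(3) by simp
      \<comment> \<open>The left side lies in \<open>U\<close> and the right side in
        \<open>W\<close>, so both are zero.\<close>
      then have "?T a - a = b - ?T b" by (simp add: algebra_simps)
      then have "?T a - a \<in> U \<inter> W"
        using submodule_diff[OF U T(1) ab(1)] submodule_diff[OF W ab(2) T(2)] by simp
      then have Ta: "?T a = a" using UW by simp
      have Lu: "?L u"
      proof (rule ccontr)
        assume "\<not> ?L u"
        then have "Poly_Mapping.lookup (?T a) u = 0" by (rule trans[OF wact_winv_lookup[OF ws] if_not_P])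
        then show False using Ta k by simp
      qed
      show ?thesis by (rule iffI) (rule True, rule Lu)
    next
      case False
      have "?T (vec v0) = 0" by (rule trans[OF wact_winv[OF ws] if_not_P[OF False]])
      then have "?T a + ?T b = 0" using sum by simp
      then have "?T a = 0 - ?T b" by (simp add: algebra_simps eq_neg_iff_add_eq_0)
      then have "?T a \<in> U \<inter> W" using submodule_diff[OF W submoduleD(2)[OF W] T(2)] T(1) by simp
      then have Ta: "?T a = 0" using UW by simp
      have Lu: "\<not> ?L u"
      proof
        assume "?L u"
        then have "Poly_Mapping.lookup (?T a) u = Poly_Mapping.lookup a u"
          by (rule trans[OF wact_winv_lookup[OF ws] if_P])
        then show False using Ta k by simp
      qed
      show ?thesis by (rule iffI) (erule notE[OF Lu], erule notE[OF False])
    qed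
  qed
  have "u \<in> fib" if u: "u \<in> Poly_Mapping.keys a" for u
  proof -
    have uo: "u \<in> objs \<Omega>" using u submoduleD(1)[OF U ab(1)] by (auto simp: free_space_iff)
    have "walk_map \<zeta> ` walks_from \<Omega> u = walk_map \<zeta> ` walks_from \<Omega> v0"
    proof -
      have lab: "walk_map \<zeta> p \<noteq> [] \<and> set (walk_map \<zeta> p) \<subseteq> edges \<Lambda>" if "p \<in> walks \<Omega>" for p
        using walk_map_in[OF that] by (auto simp: walks_def)
      have mem: "ws \<in> walk_map \<zeta> ` walks_from \<Omega> x \<longleftrightarrow>
          ws \<noteq> [] \<and> set ws \<subseteq> edges \<Lambda> \<and> (\<exists>p \<in> walks \<Omega>. wsrc \<Omega> p = x \<and> walk_map \<zeta> p = ws)" for x ws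
        using lab by (auto simp: walks_from_def)
      show ?thesis
      proof (rule Set.set_eqI)
        fix ws
        show "ws \<in> walk_map \<zeta> ` walks_from \<Omega> u \<longleftrightarrow> ws \<in> walk_map \<zeta> ` walks_from \<Omega> v0"
          unfolding mem by (intro conj_cong refl) (rule same[OF u])
      qed
    qed
    then show ?thesis using uo qmap_omap_eq[OF uo v0_in] by (simp add: vsim_iff fib_iff y_def)
  qed
  then show ?thesis by (auto simp: free_space_iff)
qed

text \<open>The image of a vertex reached from \<open>v0\<close> by a word is that word applied to
  \<open>a\<close>, and this stays in the submodule.\<close>

lemma summand_end_map:
  assumes U: "submodule_of A V U" and a: "a \<in> U" "a \<in> free_space fib" and x: "x \<in> free_space (objs \<Omega>)"
  shows "end_map a x \<in> U"
proof (rule submodule_lin_extend[OF U x _ lin_end_map])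
  fix u assume "u \<in> objs \<Omega>"
  then obtain p where p: "vec u = wact (walk_map \<zeta> p) (vec v0)" "set (walk_map \<zeta> p) \<subseteq> edges \<Lambda>"
      "walk_map \<zeta> p \<noteq> []"
    using vec_eq_wact by metis
  have "end_map a (vec u) = wact (walk_map \<zeta> p) a"
    unfolding p(1) using wact_end_map[OF a(2) _ p(2), of "vec v0"] end_map_v0[OF a(2)] by simp
  then show "end_map a (vec u) \<in> U" using submodule_wact[OF U p(3,2) a(1)] by simp
qed

text \<open>The idempotent is the component \<open>a\<close> of \<open>v0\<close> in
  \<open>U\<close>, and \<open>end_map a\<close> is the projection onto \<open>U\<close> along
  \<open>W\<close>.\<close>

lemma idempotent_if_decomposition:
  assumes U: "submodule_of A V U" and W: "submodule_of A V W" and "U \<noteq> {0}" "W \<noteq> {0}"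
    and UW: "U \<inter> W = {0}" and sum: "free_space (objs \<Omega>) = {u + w | u w. u \<in> U \<and> w \<in> W}"
  shows "\<exists>e \<in> free_space fib. end_map e e = e \<and> e \<noteq> 0 \<and> e \<noteq> vec v0"
proof -
  have "vec v0 \<in> free_space (objs \<Omega>)" by simp
  then obtain a b where ab: "a \<in> U" "b \<in> W" "vec v0 = a + b" unfolding sum by blast
  have a: "a \<in> free_space fib" by (rule summand_keys[OF U W UW ab])
  have b: "b \<in> free_space fib"
    by (rule summand_keys[OF W U _ ab(2,1)]) (use UW ab(3) in \<open>auto simp: add.commute\<close>)
  have split: "x = end_map a x + end_map b x" if "x \<in> free_space (objs \<Omega>)" for x
    using end_map_by_v0[OF that] lin_add[OF lin_end_map_left, of a b x] ab(3) by simp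
  \<comment> \<open>The deviation of \<open>x\<close> from its image is \<open>end_map b x\<close>,
    which lies in \<open>W\<close> and, for \<open>x\<close> in \<open>U\<close>, also in
    \<open>U\<close>.\<close>
  have fix_U: "end_map a x = x" if "x \<in> U" for x
  proof -
    have x: "x \<in> free_space (objs \<Omega>)" using that by (rule submoduleD(1)[OF U])
    have "x - end_map a x \<in> U" using summand_end_map[OF U ab(1) a x] by (rule submodule_diff[OF U that])
    moreover have "x - end_map a x = end_map b x" using split[OF x] by (metis add_diff_cancel_left')
    moreover have "end_map b x \<in> W" by (rule summand_end_map[OF W ab(2) b x])
    ultimately have "end_map b x = 0" using UW by auto
    then show ?thesis using split[OF x] by simp
  qed
  have "a \<noteq> 0"
  proof
    assume "a = 0"
    then have "x = 0" if "x \<in> U" for x using fix_U[OF that] lin_0[OF lin_end_map_left] by simp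
    moreover have "0 \<in> U" by (rule submoduleD(2)[OF U])
    ultimately show False using \<open>U \<noteq> {0}\<close> by blast
  qed
  moreover have "a \<noteq> vec v0"
  proof
    assume "a = vec v0"
    then have "x \<in> U" if "x \<in> W" for x
      using summand_end_map[OF U ab(1) a submoduleD(1)[OF W that]] end_map_by_v0[OF submoduleD(1)[OF W that]]
      by simp
    then have "W \<subseteq> {0}" using UW by blast
    moreover have "0 \<in> W" by (rule submoduleD(2)[OF W])
    ultimately show False using \<open>W \<noteq> {0}\<close> by blast
  qed
  moreover have "end_map a a = a" using fix_U ab(1) by simp
  ultimately show ?thesis using a by blast
qed

text \<open>The summands are the image and the kernel of \<open>end_map e\<close>, the image being
  written as the set of fixed vectors. They contain the nonzero vectors \<open>e\<close> and
  \<open>vec v0 - e\<close>, respectively.\<close>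

lemma decomposition_if_idempotent:
  assumes e: "e \<in> free_space fib" "end_map e e = e" "e \<noteq> 0" "e \<noteq> vec v0"
  shows "\<exists>U W. submodule_of A V U \<and> submodule_of A V W \<and> U \<noteq> {0} \<and> W \<noteq> {0} \<and>
    U \<inter> W = {0} \<and> free_space (objs \<Omega>) = {u + w | u w. u \<in> U \<and> w \<in> W}"
proof -
  let ?V = "free_space (objs \<Omega>) :: ('p \<Rightarrow>\<^sub>0 'a) set"
  let ?F = "end_map e"
  let ?U = "{x \<in> ?V. ?F x = x}" and ?W = "{x \<in> ?V. ?F x = 0}"
  have act: "?F (aact r x) = aact r (?F x)" "aact r x \<in> ?V" if "r \<in> kp_free \<Lambda>" "x \<in> ?V" for r x
    using aact_end_map[OF e(1) that(2,1)] free_act_free[OF that] by simp_all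
  have F0: "?F 0 = 0" by (rule lin_0[OF lin_end_map])
  have U: "submodule_of A V ?U" unfolding submodule_iff
    by (simp add: F0 free_space_add free_space_scl lin_add[OF lin_end_map] lin_scl[OF lin_end_map] act)
  have W: "submodule_of A V ?W" unfolding submodule_iff
    by (simp add: F0 free_space_add free_space_scl lin_add[OF lin_end_map] lin_scl[OF lin_end_map] act
        lin_0[OF lin_free_act])
  have eV: "e \<in> ?V" using e(1) by (auto simp: free_space_iff fib_iff)
  then have "e \<in> ?U" using e(2) by simp
  then have nU: "?U \<noteq> {0}" using e(3) by blast
  have "vec v0 - e \<in> ?W"
    using eV e end_map_v0[OF e(1)] lin_diff[OF lin_end_map, of e "vec v0" e] by (simp add: free_space_diff)
  moreover have "vec v0 - e \<noteq> 0" using e(4) by simp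
  ultimately have nW: "?W \<noteq> {0}" by blast
  have UW: "?U \<inter> ?W = {0}" using F0 by auto
  have "?V = {u + w | u w. u \<in> ?U \<and> w \<in> ?W}"
  proof (intro equalityI subsetI)
    fix x assume x: "x \<in> ?V"
    have "?F x \<in> ?U" using end_map_free[OF e(1) x] end_map_idempotent[OF e(1,2) x] by simp
    moreover have "x - ?F x \<in> ?W"
      using x end_map_free[OF e(1) x] end_map_idempotent[OF e(1,2) x]
      by (simp add: free_space_diff lin_diff[OF lin_end_map])
    moreover have "x = ?F x + (x - ?F x)" by simp
    ultimately show "x \<in> {u + w | u w. u \<in> ?U \<and> w \<in> ?W}" by blast
  next
    fix x assume "x \<in> {u + w | u w. u \<in> ?U \<and> w \<in> ?W}"
    then show "x \<in> ?V" using free_space_add by blast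
  qed
  with U W nU nW UW show ?thesis by blast
qed

lemma indecomposable_iff_idempotent:
  "indecomposable_module A V \<longleftrightarrow>
    \<not> (\<exists>e \<in> free_space fib. end_map e e = e \<and> e \<noteq> 0 \<and> e \<noteq> vec v0)"
proof -
  have "vec v0 \<in> free_space (objs \<Omega>)" by simp
  moreover have "vec v0 \<noteq> 0" by (metis lookup_single_eq lookup_zero zero_neq_one)
  ultimately have nz: "free_space (objs \<Omega>) \<noteq> {0 :: 'p \<Rightarrow>\<^sub>0 'a}" by blast
  have "(\<exists>U W. submodule_of A V U \<and> submodule_of A V W \<and> U \<noteq> {0} \<and> W \<noteq> {0} \<and>
      U \<inter> W = {0} \<and> free_space (objs \<Omega>) = {u + w | u w. u \<in> U \<and> w \<in> W}) \<longleftrightarrow>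
    (\<exists>e \<in> free_space fib. end_map e e = e \<and> e \<noteq> 0 \<and> e \<noteq> vec v0)"
  proof
    assume "\<exists>U W. submodule_of A V U \<and> submodule_of A V W \<and> U \<noteq> {0} \<and> W \<noteq> {0} \<and>
      U \<inter> W = {0} \<and> free_space (objs \<Omega>) = {u + w | u w. u \<in> U \<and> w \<in> W}"
    then show "\<exists>e \<in> free_space fib. end_map e e = e \<and> e \<noteq> 0 \<and> e \<noteq> vec v0"
      by (elim exE conjE) (rule idempotent_if_decomposition)
  next
    assume "\<exists>e \<in> free_space fib. end_map e e = e \<and> e \<noteq> 0 \<and> e \<noteq> vec v0"
    then show "\<exists>U W. submodule_of A V U \<and> submodule_of A V W \<and> U \<noteq> {0} \<and> W \<noteq> {0} \<and>
      U \<inter> W = {0} \<and> free_space (objs \<Omega>) = {u + w | u w. u \<in> U \<and> w \<in> W}"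
      by (elim bexE conjE) (rule decomposition_if_idempotent)
  qed
  then show ?thesis unfolding indecomposable_module_def carrier_V using nz by simp
qed

subsection \<open>Idempotents of the group algebra\<close>

abbreviation "G \<equiv> fundamental_group \<Gamma> y"

definition closed_walks :: "'q set edge list set" where
  "closed_walks = {P \<in> walks \<Gamma>. wsrc \<Gamma> P = y \<and> wrng \<Gamma> P = y}"

definition cls :: "'q set edge list \<Rightarrow> 'q set edge list set" where
  "cls P = walk_equiv \<Gamma> `` {P}"

text \<open>
  Only the classes of walks with a forward edge form a group. The class of a closed walk without
  forward edges consists of this walk alone and does not occur in an idempotent of the group
  algebra.
\<close>

definition fwd_classes :: "'q set edge list set set" where
  "fwd_classes = cls ` {P \<in> closed_walks. \<exists>\<kappa>. Fwd \<kappa> \<in> set P}"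

text \<open>The end of the lift at \<open>v0\<close>; any member of the class may be chosen, because
  equivalent walks transport alike. For an honest fundamental group this is the usual bijection with
  the fibre.\<close>

definition \<theta> :: "'q set edge list set \<Rightarrow> 'p" where
  "\<theta> X = tr (SOME P. P \<in> X) v0"

lemma closed_walksD:
  assumes "P \<in> closed_walks"
  shows "P \<in> walks \<Gamma>" "wsrc \<Gamma> P = y" "wrng \<Gamma> P = y" "P \<noteq> []"
  using assms walks_not_Nil by (auto simp: closed_walks_def)

lemma closed_walks_append:
  assumes "P \<in> closed_walks" "Q \<in> closed_walks" shows "P @ Q \<in> closed_walks"
  using closed_walksD[OF assms(1)] closed_walksD[OF assms(2)] by (simp add: closed_walks_def walks_append)

lemma one_walk_closed: "one_walk \<in> closed_walks"
  using one_walk by (simp add: closed_walks_def)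

lemma carrier_G: "carrier G = cls ` closed_walks"
  by (auto simp: fundamental_group_def groupoid_hom_def closed_walks_def cls_def)

lemma one_G: "one G = cls one_walk"
  by (simp add: fundamental_group_def cls_def)

lemma cls_eq_iff:
  "P \<in> closed_walks \<Longrightarrow> Q \<in> closed_walks \<Longrightarrow> cls P = cls Q \<longleftrightarrow> (P, Q) \<in> walk_equiv \<Gamma>"
  unfolding cls_def by (rule eq_equiv_class_iff[OF quot.cod.equiv_walk_equiv]) (simp_all add: closed_walksD)

lemma mult_G:
  assumes "P \<in> closed_walks" "Q \<in> closed_walks"
  shows "mult G (cls P) (cls Q) = cls (P @ Q)"
proof -
  note P = closed_walksD[OF assms(1)] and Q = closed_walksD[OF assms(2)]
  have *: "walk_equiv \<Gamma> `` {P' @ Q'} = walk_equiv \<Gamma> `` {P @ Q}"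
    if "P' \<in> cls P" "Q' \<in> cls Q" for P' Q'
  proof (rule equiv_class_eq[OF quot.cod.equiv_walk_equiv], rule quot.cod.walk_equiv_append)
    have 1: "(P, P') \<in> walk_equiv \<Gamma>" and 2: "(Q, Q') \<in> walk_equiv \<Gamma>"
      using that by (simp_all add: cls_def)
    show "(P', P) \<in> walk_equiv \<Gamma>" "(Q', Q) \<in> walk_equiv \<Gamma>"
      by (rule quot.cod.walk_equiv_sym[OF 1], rule quot.cod.walk_equiv_sym[OF 2])
    have "wsrc \<Gamma> P' = y" using quot.cod.walk_equiv_ends[OF 1] P(2) by simp
    moreover have "wrng \<Gamma> Q' = y" using quot.cod.walk_equiv_ends[OF 2] Q(3) by simp
    ultimately show "wsrc \<Gamma> P' = wrng \<Gamma> Q'" by simp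
  qed
  have self: "R \<in> cls R" if "R \<in> walks \<Gamma>" for R using that by (simp add: cls_def)
  have "(\<Union>P' \<in> cls P. \<Union>Q' \<in> cls Q. walk_equiv \<Gamma> `` {P' @ Q'}) = walk_equiv \<Gamma> `` {P @ Q}"
    by (rule UN_constant_eq[OF self[OF P(1)]], rule ballI,
        rule UN_constant_eq[OF self[OF Q(1)]], rule ballI, rule *)
  then show ?thesis by (simp add: fundamental_group_def groupoid_comp_def cls_def)
qed

lemma theta_cls:
  assumes "P \<in> closed_walks" shows "\<theta> (cls P) = tr P v0"
proof -
  note P = closed_walksD[OF assms]
  have "(SOME Q. Q \<in> cls P) \<in> cls P"
    by (rule someI[of _ P]) (use P in \<open>simp add: cls_def\<close>)
  then have "(P, SOME Q. Q \<in> cls P) \<in> walk_equiv \<Gamma>" by (simp add: cls_def)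
  from tr_equiv[OF this v0_in] show ?thesis using P by (simp add: \<theta>_def y_def)
qed

lemma tr_fib: "P \<in> closed_walks \<Longrightarrow> tr P v0 \<in> fib"
  using tr_in[of P v0] by (simp add: closed_walks_def fib_iff y_def)

lemma theta_fib: "X \<in> carrier G \<Longrightarrow> \<theta> X \<in> fib"
  unfolding carrier_G using theta_cls tr_fib by auto

text \<open>Following \<open>P\<close> from \<theta> Y is the same as following it from
  \<open>v0\<close> and then applying the deck transformation that takes \<open>v0\<close> to
  \<theta> Y. The exchange of the factors is the source of the anti-isomorphism.\<close>

lemma theta_mult:
  assumes "X \<in> carrier G" "Y \<in> carrier G"
  shows "\<theta> (mult G X Y) = \<phi> (\<theta> Y) (\<theta> X)"
proof -
  obtain P Q where P: "P \<in> closed_walks" "X = cls P" and Q: "Q \<in> closed_walks" "Y = cls Q"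
    using assms unfolding carrier_G by blast
  have "\<theta> (mult G X Y) = tr (P @ Q) v0"
    unfolding P(2) Q(2) mult_G[OF P(1) Q(1)] by (rule theta_cls[OF closed_walks_append[OF P(1) Q(1)]])
  also have "\<dots> = tr P (tr Q v0)"
    using closed_walksD[OF P(1)] closed_walksD[OF Q(1)] by (intro tr_append) (simp_all add: y_def)
  also have "\<dots> = \<phi> (tr Q v0) (tr P v0)"
    using phi_tr[OF closed_walksD(1,2)[OF P(1)] tr_fib[OF Q(1)]] by simp
  finally show ?thesis by (simp add: P Q theta_cls)
qed

lemma fwd_classes_carrier: "X \<in> fwd_classes \<Longrightarrow> X \<in> carrier G"
  by (auto simp: fwd_classes_def carrier_G)

lemma one_fwd: "one G \<in> fwd_classes"
  unfolding one_G fwd_classes_def by (rule imageI) (simp add: one_walk_closed)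

lemma theta_one: "\<theta> (one G) = v0"
  by (simp only: one_G theta_cls[OF one_walk_closed] tr_one v0_fib)

lemma mult_fwd:
  assumes "X \<in> fwd_classes" "Y \<in> fwd_classes" shows "mult G X Y \<in> fwd_classes"
proof -
  obtain P Q \<kappa> where P: "P \<in> closed_walks" "X = cls P" "Fwd \<kappa> \<in> set P" and Q: "Q \<in> closed_walks" "Y = cls Q"
    using assms unfolding fwd_classes_def by blast
  show ?thesis unfolding P(2) Q(2) mult_G[OF P(1) Q(1)] fwd_classes_def
    by (rule imageI) (use closed_walks_append[OF P(1) Q(1)] P(3) in auto)
qed

text \<open>Equal ends give an equivalence up to an appended identity, and a walk with a forward
  edge absorbs that identity.\<close>

lemma theta_inj_fwd: "inj_on \<theta> fwd_classes"
proof (rule inj_onI)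
  fix X Y assume "X \<in> fwd_classes" "Y \<in> fwd_classes" and eq: "\<theta> X = \<theta> Y"
  then obtain P Q \<kappa> \<mu> where P: "P \<in> closed_walks" "X = cls P" "Fwd \<kappa> \<in> set P"
      and Q: "Q \<in> closed_walks" "Y = cls Q" "Fwd \<mu> \<in> set Q"
    unfolding fwd_classes_def by blast
  have "tr P v0 = tr Q v0" using eq P Q theta_cls by simp
  then have 1: "(P @ one_walk, Q @ one_walk) \<in> walk_equiv \<Gamma>"
    using closed_walksD[OF P(1)] closed_walksD[OF Q(1)] by (intro tr_eq_imp_equiv) simp_all
  have 2: "(P @ one_walk, P) \<in> walk_equiv \<Gamma>" "(Q @ one_walk, Q) \<in> walk_equiv \<Gamma>"
    using quot.cod.equiv_walk_idm[OF closed_walksD(1)[OF P(1)] P(3)]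
      quot.cod.equiv_walk_idm[OF closed_walksD(1)[OF Q(1)] Q(3)] closed_walksD[OF P(1)] closed_walksD[OF Q(1)]
    by simp_all
  have "(P, Q) \<in> walk_equiv \<Gamma>"
    by (rule quot.cod.walk_equiv_trans[OF quot.cod.walk_equiv_sym[OF 2(1)] quot.cod.walk_equiv_trans[OF 1 2(2)]])
  then show "X = Y" using cls_eq_iff[OF P(1) Q(1)] P(2) Q(2) by simp
qed

lemma theta_image_fwd: "\<theta> ` fwd_classes = fib"
proof (intro equalityI subsetI)
  fix w assume "w \<in> fib"
  then have w: "w \<in> objs \<Omega>" "\<pi> w = y" by (simp_all add: fib_iff)
  obtain p where p: "p \<in> walks \<Omega>" "wsrc \<Omega> p = v0" "wrng \<Omega> p = w" using ex_walk[OF v0_in w(1)] by blast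
  \<comment> \<open>The identity supplies a forward edge without changing the ends.\<close>
  let ?q = "p @ [Fwd (idm \<Omega> v0)]"
  have q: "?q \<in> walks \<Omega>" "wsrc \<Omega> ?q = v0" "wrng \<Omega> ?q = w"
    using p walks_not_Nil[OF p(1)] by (simp_all add: walks_append dom.src_idm dom.rng_idm)
  have c: "walk_map qmap ?q \<in> closed_walks"
    using quot.walk_map_in[OF q(1)] q w by (simp add: closed_walks_def y_def)
  then have "cls (walk_map qmap ?q) \<in> fwd_classes" unfolding fwd_classes_def by (intro imageI) auto
  moreover have "\<theta> (cls (walk_map qmap ?q)) = w"
    using theta_cls[OF c] tr_walk[OF q(1)] q(2,3) by simp
  ultimately show "w \<in> \<theta> ` fwd_classes" by blast
qed (use theta_fib fwd_classes_carrier in blast)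

definition \<sigma> :: "'p \<Rightarrow> 'q set edge list set" where
  "\<sigma> = inv_into fwd_classes \<theta>"

lemma sigma:
  "w \<in> fib \<Longrightarrow> \<sigma> w \<in> fwd_classes" "w \<in> fib \<Longrightarrow> \<theta> (\<sigma> w) = w" "X \<in> fwd_classes \<Longrightarrow> \<sigma> (\<theta> X) = X"
  unfolding \<sigma>_def
  by (simp_all add: inv_into_into f_inv_into_f theta_image_fwd inv_into_f_f[OF theta_inj_fwd])

lemma sigma_phi:
  assumes "w \<in> fib" "u \<in> fib" shows "\<sigma> (\<phi> w u) = mult G (\<sigma> u) (\<sigma> w)"
proof -
  have "\<phi> w u = \<theta> (mult G (\<sigma> u) (\<sigma> w))"
    using theta_mult[OF fwd_classes_carrier fwd_classes_carrier] sigma assms by simp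
  then show ?thesis using sigma(3) mult_fwd sigma(1) assms by simp
qed

section \<open>Correspondence between the group algebra and the fibre\<close>

definition to_fib :: "('q set edge list set \<Rightarrow>\<^sub>0 'a) \<Rightarrow> ('p \<Rightarrow>\<^sub>0 'a)" where
  "to_fib = lin_extend (\<lambda>X. vec (\<theta> X))"

definition of_fib :: "('p \<Rightarrow>\<^sub>0 'a) \<Rightarrow> ('q set edge list set \<Rightarrow>\<^sub>0 'a)" where
  "of_fib = lin_extend (\<lambda>w. Poly_Mapping.single (\<sigma> w) 1)"

lemma lin_to_fib: "lin to_fib" and lin_of_fib: "lin of_fib"
  by (simp_all add: to_fib_def of_fib_def)

lemma to_fib_single [simp]: "to_fib (Poly_Mapping.single X 1) = vec (\<theta> X)"
  and of_fib_single [simp]: "of_fib (vec w) = Poly_Mapping.single (\<sigma> w) 1"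
  by (simp_all add: to_fib_def of_fib_def)

lemma to_fib_in: "e \<in> free_space (carrier G) \<Longrightarrow> to_fib e \<in> free_space fib"
  unfolding to_fib_def by (erule free_space_lin_extend) (simp add: theta_fib)

lemma of_fib_in: "e \<in> free_space fib \<Longrightarrow> of_fib e \<in> free_space fwd_classes"
  unfolding of_fib_def by (erule free_space_lin_extend) (simp add: sigma)

lemma to_of_fib: "e \<in> free_space fib \<Longrightarrow> to_fib (of_fib e) = e"
  by (rule lin_eqI_free[OF lin_comp[OF lin_to_fib lin_of_fib] lin_id], assumption)
    (simp only: of_fib_single to_fib_single sigma)

lemma of_to_fib: "e \<in> free_space fwd_classes \<Longrightarrow> of_fib (to_fib e) = e"
  by (rule lin_eqI_free[OF lin_comp[OF lin_of_fib lin_to_fib] lin_id], assumption)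
    (simp only: of_fib_single to_fib_single sigma)

lemma to_fib_convolution:
  assumes "e \<in> free_space (carrier G)" "e' \<in> free_space (carrier G)"
  shows "to_fib (convolution (mult G) e e') = end_map (to_fib e') (to_fib e)"
proof (rule lin_eqI_free[OF _ _ assms(1)])
  show "lin (\<lambda>e. to_fib (convolution (mult G) e e'))" by (rule lin_comp[OF lin_to_fib lin_convolution_left])
  show "lin (\<lambda>e. end_map (to_fib e') (to_fib e))" by (rule lin_comp[OF lin_end_map lin_to_fib])
  fix X assume X: "X \<in> carrier G"
  show "to_fib (convolution (mult G) (Poly_Mapping.single X 1) e') =
      end_map (to_fib e') (to_fib (Poly_Mapping.single X 1))"
  proof (rule lin_eqI_free[OF _ _ assms(2)])
    show "lin (\<lambda>e'. to_fib (convolution (mult G) (Poly_Mapping.single X 1) e'))"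
      by (rule lin_comp[OF lin_to_fib lin_convolution_right])
    show "lin (\<lambda>e'. end_map (to_fib e') (to_fib (Poly_Mapping.single X 1)))"
      by (rule lin_comp[OF lin_end_map_left lin_to_fib])
  qed (simp add: theta_mult X)
qed

lemma of_fib_end_map:
  assumes "e \<in> free_space fib" "e' \<in> free_space fib"
  shows "of_fib (end_map e e') = convolution (mult G) (of_fib e') (of_fib e)"
proof (rule lin_eqI_free[OF _ _ assms(1)])
  show "lin (\<lambda>e. of_fib (end_map e e'))" by (rule lin_comp[OF lin_of_fib lin_end_map_left])
  show "lin (\<lambda>e. convolution (mult G) (of_fib e') (of_fib e))"
    by (rule lin_comp[OF lin_convolution_right lin_of_fib])
  fix w assume w: "w \<in> fib"
  show "of_fib (end_map (vec w) e') = convolution (mult G) (of_fib e') (of_fib (vec w))"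
  proof (rule lin_eqI_free[OF _ _ assms(2)])
    show "lin (\<lambda>e'. of_fib (end_map (vec w) e'))" by (rule lin_comp[OF lin_of_fib lin_end_map])
    show "lin (\<lambda>e'. convolution (mult G) (of_fib e') (of_fib (vec w)))"
      by (rule lin_comp[OF lin_convolution_left lin_of_fib])
  qed (simp add: sigma_phi w)
qed

text \<open>Let \<open>P\<close> have no forward edge. If its class occurs in \<open>e\<close>, it
  occurs in the square of \<open>e\<close>, hence is a product of two classes in the support. Since
  the class is a singleton, \<open>P\<close> is a concatenation of nonempty walks without forward
  edges whose classes occur in \<open>e\<close>; induction on the length excludes the first of
  them.\<close>

lemma idempotent_support:
  assumes e: "e \<in> free_space (carrier G)" and idem: "convolution (mult G) e e = (e :: _ \<Rightarrow>\<^sub>0 'a)"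
  shows "e \<in> free_space fwd_classes"
proof -
  have "cls P \<notin> Poly_Mapping.keys e" if "P \<in> closed_walks" "\<And>\<kappa>. Fwd \<kappa> \<notin> set P" for P
    using that
  proof (induction P rule: measure_induct_rule[of length])
    case (less P)
    show ?case
    proof
      assume "cls P \<in> Poly_Mapping.keys e"
      then have "cls P \<in> Poly_Mapping.keys (convolution (mult G) e e)" unfolding idem .
      then obtain X Y where XY: "cls P = mult G X Y" "X \<in> Poly_Mapping.keys e" "Y \<in> Poly_Mapping.keys e"
        using keys_convolution[of "mult G" e e] by blast
      then obtain B C where B: "B \<in> closed_walks" "X = cls B" and C: "C \<in> closed_walks" "Y = cls C"
        using e unfolding free_space_iff carrier_G by blast
      have "cls P = cls (B @ C)" using XY(1) mult_G[OF B(1) C(1)] B C by simp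
      then have "(P, B @ C) \<in> walk_equiv \<Gamma>"
        using cls_eq_iff[OF less.prems(1) closed_walks_append[OF B(1) C(1)]] by simp
      then have P: "B @ C = P" by (rule quot.cod.walk_equiv_no_Fwd) (rule less.prems(2))
      have "length B < length P" using closed_walksD(4)[OF C(1)] unfolding P[symmetric] by simp
      moreover have "Fwd \<kappa> \<notin> set B" for \<kappa> using less.prems(2)[of \<kappa>] unfolding P[symmetric] by simp
      ultimately have "cls B \<notin> Poly_Mapping.keys e" using less.IH B(1) by blast
      then show False using XY(2) B(2) by simp
    qed
  qed
  then show ?thesis using e unfolding free_space_iff carrier_G fwd_classes_def by blast
qed

text \<open>Both \<open>to_fib\<close> and \<open>of_fib\<close> exchange the order of products and
  so preserve idempotents. They are mutually inverse on the span of \<open>fwd_classes\<close>,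
  which contains every idempotent of the group algebra.\<close>

lemma group_algebra_idempotent_iff:
  "(\<exists>e :: _ \<Rightarrow>\<^sub>0 'a. nontrivial_idempotent (group_algebra G) e) \<longleftrightarrow>
    (\<exists>e \<in> free_space fib. end_map e e = e \<and> e \<noteq> 0 \<and> e \<noteq> vec v0)"
proof
  assume "\<exists>e :: _ \<Rightarrow>\<^sub>0 'a. nontrivial_idempotent (group_algebra G) e"
  then obtain e :: "_ \<Rightarrow>\<^sub>0 'a" where e: "e \<in> free_space (carrier G)" "convolution (mult G) e e = e" "e \<noteq> 0"
      "e \<noteq> Poly_Mapping.single (one G) 1"
    by (auto simp: nontrivial_idempotent_def group_algebra_def)
  have f: "e \<in> free_space fwd_classes" by (rule idempotent_support[OF e(1,2)])
  have "to_fib e \<noteq> 0" using of_to_fib[OF f] e(3) lin_0[OF lin_of_fib] by metis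
  moreover have "to_fib e \<noteq> vec v0"
  proof
    assume "to_fib e = vec v0"
    then have "e = of_fib (to_fib (Poly_Mapping.single (one G) 1))" using of_to_fib[OF f] theta_one by simp
    also have "\<dots> = Poly_Mapping.single (one G) 1" by (rule of_to_fib) (simp add: one_fwd)
    finally show False using e(4) by simp
  qed
  moreover have "end_map (to_fib e) (to_fib e) = to_fib e"
    using to_fib_convolution[OF e(1,1)] e(2) by simp
  ultimately show "\<exists>e \<in> free_space fib. end_map e e = e \<and> e \<noteq> 0 \<and> e \<noteq> vec v0"
    using to_fib_in[OF e(1)] by blast
next
  assume "\<exists>e \<in> free_space fib. end_map e e = e \<and> e \<noteq> 0 \<and> e \<noteq> vec v0"
  then obtain e where e: "e \<in> free_space fib" "end_map e e = e" "e \<noteq> 0" "e \<noteq> vec v0" by blast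
  have "of_fib e \<in> free_space (carrier G)"
    using of_fib_in[OF e(1)] fwd_classes_carrier by (auto simp: free_space_iff)
  moreover have "convolution (mult G) (of_fib e) (of_fib e) = of_fib e"
    using of_fib_end_map[OF e(1,1)] e(2) by simp
  moreover have "of_fib e \<noteq> 0" using to_of_fib[OF e(1)] e(3) lin_0[OF lin_to_fib] by metis
  moreover have "of_fib e \<noteq> Poly_Mapping.single (one G) 1"
  proof
    assume "of_fib e = Poly_Mapping.single (one G) 1"
    then have "e = vec v0" using to_of_fib[OF e(1)] theta_one by simp
    then show False using e(4) by simp
  qed
  ultimately have "nontrivial_idempotent (group_algebra G) (of_fib e)"
    by (simp add: nontrivial_idempotent_def group_algebra_def)
  then show "\<exists>e :: _ \<Rightarrow>\<^sub>0 'a. nontrivial_idempotent (group_algebra G) e" by blast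
qed

end

text \<open>Morphisms of given degree into a vertex of \<Omega> embed into the singleton set of
  those into its image; there is at least one because \<Omega> has no sources.\<close>

lemma rep_kgraph_covering:
  assumes "rep_kgraph \<Lambda> \<Delta> \<alpha>" "covering \<Delta> \<Omega> \<tau>"
  shows "rep_kgraph \<Lambda> \<Omega> (kmor_comp \<alpha> \<tau>)"
proof -
  have \<Delta>: "standing_k_graph \<Delta>" "kgraph_morphism \<Delta> \<Lambda> \<alpha>"
    and \<alpha>: "\<And>v. v \<in> objs \<Delta> \<Longrightarrow> bij_betw (mmap \<alpha>) (mors_from \<Delta> v) (mors_from \<Lambda> (omap \<alpha> v))"
      "\<And>v n. v \<in> objs \<Delta> \<Longrightarrow> is_singleton (mors_to_deg \<Delta> v n)"
    using assms(1) by (auto simp: rep_kgraph_def)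
  have \<Omega>: "standing_k_graph \<Omega>" "kgraph_morphism \<Omega> \<Delta> \<tau>"
    and \<tau>: "\<And>v. v \<in> objs \<Omega> \<Longrightarrow> bij_betw (mmap \<tau>) (mors_from \<Omega> v) (mors_from \<Delta> (omap \<tau> v))"
      "\<And>v. v \<in> objs \<Omega> \<Longrightarrow> bij_betw (mmap \<tau>) (mors_to \<Omega> v) (mors_to \<Delta> (omap \<tau> v))"
    using assms(2) by (auto simp: covering_def)
  interpret \<Omega>: standing_k_graph \<Omega> by (rule \<Omega>(1))
  interpret \<Delta>: standing_k_graph \<Delta> by (rule \<Delta>(1))
  interpret h: kgraph_hom \<Omega> \<Delta> \<tau> by unfold_locales (rule \<Omega>(2))
  have mor: "kgraph_morphism \<Omega> \<Lambda> (kmor_comp \<alpha> \<tau>)"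
    using \<Delta>(2) unfolding kgraph_morphism_def kmor_comp_def by (simp add: \<Omega>.src_in \<Omega>.rng_in)
  have bij: "bij_betw (mmap (kmor_comp \<alpha> \<tau>)) (mors_from \<Omega> v) (mors_from \<Lambda> (omap (kmor_comp \<alpha> \<tau>) v))"
    if "v \<in> objs \<Omega>" for v
    using bij_betw_trans[OF \<tau>(1)[OF that] \<alpha>(1)[OF h.hom_simps(1)[OF that]]] by (simp add: kmor_comp_def)
  have sing: "is_singleton (mors_to_deg \<Omega> v n)" if v: "v \<in> objs \<Omega>" for v n
  proof -
    have inj: "inj_on (mmap \<tau>) (mors_to_deg \<Omega> v n)"
      by (rule inj_on_subset[OF bij_betw_imp_inj_on[OF \<tau>(2)[OF v]]]) (simp add: mors_to_deg_def)
    have sub: "mmap \<tau> ` mors_to_deg \<Omega> v n \<subseteq> mors_to_deg \<Delta> (omap \<tau> v) n"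
      by (auto simp: mors_to_deg_def mors_to_def)
    obtain \<delta> where "mors_to_deg \<Delta> (omap \<tau> v) n = {\<delta>}"
      using \<alpha>(2)[OF h.hom_simps(1)[OF v], of n] by (rule is_singletonE)
    then have "mmap \<tau> ` mors_to_deg \<Omega> v n = {} \<or> mmap \<tau> ` mors_to_deg \<Omega> v n = {\<delta>}"
      using sub by (intro subset_singletonD) simp
    then have "mmap \<tau> ` mors_to_deg \<Omega> v n = {\<delta>}" using \<Omega>.no_sources[OF v] by simp
    then have "card (mors_to_deg \<Omega> v n) = 1" using card_image[OF inj] by simp
    then show ?thesis by (simp add: is_singleton_altdef)
  qed
  show ?thesis unfolding rep_kgraph_def using \<Omega>(1) mor bij sing by blast
qed

theorem theorem41:
  fixes \<Lambda> :: "('o, 'm, 'k::finite) kgraph"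
    and C :: "('u, 'u, 'o, 'm, 'k) rg_object set"
    and \<Delta> \<Omega> :: "('u, 'u, 'k) kgraph"
    and \<alpha> :: "('u, 'u, 'o, 'm) kmor"
    and \<tau> :: "('u, 'u, 'u, 'u) kmor"
    and \<Omega>\<^sub>C :: "('u, 'u, 'o, 'm, 'k) rg_object"
    and \<Gamma>\<^sub>C :: "('u set, 'u set, 'o, 'm, 'k) rg_object"
    and y :: "'u set"
    and G :: "'u set edge list set monoid"
  assumes "standing_k_graph \<Lambda>"
    and "C \<in> rg_components \<Lambda>"
    and "(\<Delta>, \<alpha>) \<in> C"
    and "universal_covering \<Delta> \<Omega> \<tau>"
    and "\<Omega>\<^sub>C = (\<Omega>, kmor_comp \<alpha> \<tau>)"
    and "\<Gamma>\<^sub>C = rg_quotient \<Omega>\<^sub>C"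
    and "y \<in> objs (fst \<Gamma>\<^sub>C)"
    and "G = fundamental_group (fst \<Gamma>\<^sub>C) y"
  shows "indecomposable_module (KP \<Lambda> :: ('a::field, _) k_algebra) (rep_module \<Omega>\<^sub>C) \<longleftrightarrow>
    \<not> (\<exists>e :: _ \<Rightarrow>\<^sub>0 'a. nontrivial_idempotent (group_algebra G) e)"
proof -
  interpret \<Lambda>: standing_k_graph \<Lambda> by (rule assms(1))
  have "(\<Delta>, \<alpha>) \<in> RG \<Lambda>"
    using assms(2,3) unfolding rg_components_def quotient_def equiv_gen_def by blast
  then have \<Delta>: "rep_kgraph \<Lambda> \<Delta> \<alpha>" by (simp add: RG_def)
  then have std: "standing_k_graph \<Delta>" by (simp add: rep_kgraph_def)
  have cov: "covering \<Delta> \<Omega> \<tau>" using assms(4) by (simp add: universal_covering_def)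
  let ?\<zeta> = "kmor_comp \<alpha> \<tau>"
  interpret \<Omega>: standing_k_graph \<Omega> using cov by (simp add: covering_def)
  interpret rep: rep_graph \<Omega> \<Lambda> ?\<zeta>
    by (rule rep_kgraph_imp_rep_graph[OF \<Lambda>.k_graph_axioms rep_kgraph_covering[OF \<Delta> cov]])
  have \<Gamma>: "fst \<Gamma>\<^sub>C = rep.\<Gamma>" by (simp add: assms(5,6) rg_quotient_def)
  \<comment> \<open>A vertex over the given \<open>y\<close> becomes the base point, so that the
    fibre and the group belong to this \<open>y\<close>.\<close>
  then obtain v0 where v0: "v0 \<in> objs \<Omega>" "y = omap rep.qmap v0"
    using assms(7) rep.quotient_objs by auto
  interpret S: simply_connected_rep \<Omega> \<Lambda> ?\<zeta> "TYPE('a)" v0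
  proof
    show "v0 \<in> objs \<Omega>" by (rule v0(1))
  qed (fact \<Omega>.ex_walk universal_covering_simply_connected[OF std assms(4)])+
  have "y = S.y" using v0(2) S.y_def by simp
  then show ?thesis
    using S.indecomposable_iff_idempotent S.group_algebra_idempotent_iff \<Gamma> assms(5,8) by simp
qed

end
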